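(* Consider the diamond network with orthogonal broadcast links, bit-pipe capacities $0\le C_1\le C_2$, and the binary adder MAC. Its capacity is $$C^\diamond=\max_{0\le p\le\frac12}\min\Big\{C_1+C_2-1+h_2(p),\ C_1+h_2(p),\ h_2(p)+1-p\Big\},$$ and this value coincides with both the lower bound of Theorem 1 and the upper bound of Theorem 3.
   Context: Diamond network with orthogonal broadcast component: a message $W$ uniform on $\{1,\dots,2^{nR}\}$ is encoded into $(V_1^n,V_2^n)$ with $H(V_1^n)\le nC_1$, $H(V_2^n)\le nC_2$; $V_i^n$ is delivered without error to relay $i$, which maps it to $X_i^n\in\{0,1\}^n$. The binary adder MAC outputs $Y_l=X_{1,l}+X_{2,l}\in\{0,1,2\}$. A decoder forms $\hat W$ from $Y^n$; $R$ is achievable if $\Pr(\hat W\ne W)$ can be made arbitrarily small for some $n$; $C^\diamond$ is the supremum of achievable rates. $h_2(q)=-q\log_2 q-(1-q)\log_2(1-q)$ is the binary entropy function. Lower bound of Theorem 1: supremum over $p(u,x_1,x_2)$ of $\min\{C_1+C_2-I(X_1;X_2|U),\ C_2+I(X_1;Y|X_2U),\ C_1+I(X_2;Y|X_1U),\ \frac12(C_1+C_2+I(X_1X_2;Y|U)-I(X_1;X_2|U)),\ I(X_1X_2;Y)\}$. Upper bound of Theorem 3: $\max_{p(x_1,x_2)}\min_{p(u|y)}\max_{p(q|x_1,x_2)}\min\{C_1+C_2,\ C_1+I(X_2;Y|X_1Q),\ C_2+I(X_1;Y|X_2Q),\ I(X_1X_2;Y|Q),\ C_1+C_2-I(X_1X_2;U|Q)+I(X_2;U|X_1Q)+I(X_1;U|X_2Q)\}$,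 evaluated for $p(x_1,x_2)p(q|x_1,x_2)p(y|x_1,x_2)p(u|y)$. *)

theory Defs
  imports "HOL-Probability.Probability"
begin

text \<open>Binary entropy function (base 2); note 0 * log 2 0 = 0 in Isabelle.\<close>
definition h2 :: "real \<Rightarrow> real" where
  "h2 q = - q * log 2 q - (1 - q) * log 2 (1 - q)"

definition ent :: "'a pmf \<Rightarrow> ('a \<Rightarrow> 'b) \<Rightarrow> real" where
  "ent P f = - (\<Sum>v \<in> f ` set_pmf P.
       pmf (map_pmf f P) v * log 2 (pmf (map_pmf f P) v))"

definition cmi :: "'a pmf \<Rightarrow> ('a \<Rightarrow> 'b) \<Rightarrow> ('a \<Rightarrow> 'c) \<Rightarrow> ('a \<Rightarrow> 'd) \<Rightarrow> real" where
  "cmi P A B C = ent P (\<lambda>w. (A w, C w)) + ent P (\<lambda>w. (B w, C w))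
                 - ent P (\<lambda>w. (A w, B w, C w)) - ent P C"

definition mi :: "'a pmf \<Rightarrow> ('a \<Rightarrow> 'b) \<Rightarrow> ('a \<Rightarrow> 'c) \<Rightarrow> real" where
  "mi P A B = cmi P A B (\<lambda>_. ())"

definition adder :: "bool \<Rightarrow> bool \<Rightarrow> nat" where
  "adder a b = of_bool a + of_bool b"

text \<open>Operational definition. A code of block length n with message set {1..M},
  M = ceiling(2^(nR)), W uniform: encoders e1,e2 (giving V1^n, V2^n as elements
  of a countable alphabet) with H(V_i^n) <= n C_i, relay maps r1,r2 into
  {0,1}^n, adder MAC, decoder d.\<close>
definition achievable :: "real \<Rightarrow> real \<Rightarrow> real \<Rightarrow> bool" where
  "achievable C1 C2 R \<longleftrightarrow>
    (\<forall>\<epsilon>>0. \<exists>n::nat. n \<ge> 1 \<and>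
      (\<exists>(e1::nat \<Rightarrow> nat) (e2::nat \<Rightarrow> nat) (r1::nat \<Rightarrow> bool list) (r2::nat \<Rightarrow> bool list)
         (d::nat list \<Rightarrow> nat).
         (let M = nat \<lceil>2 powr (real n * R)\<rceil>; W = pmf_of_set {1..M} in
           (\<forall>v. length (r1 v) = n) \<and> (\<forall>v. length (r2 v) = n) \<and>
           ent W e1 \<le> real n * C1 \<and> ent W e2 \<le> real n * C2 \<and>
           measure_pmf.prob W {w. d (map2 adder (r1 (e1 w)) (r2 (e2 w))) \<noteq> w} < \<epsilon>)))"

definition diamond_capacity :: "real \<Rightarrow> real \<Rightarrow> real" where
  "diamond_capacity C1 C2 = Sup {R. achievable C1 C2 R}"

definition lower_bound :: "real \<Rightarrow> real \<Rightarrow> real" where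
  "lower_bound C1 C2 = Sup ((\<lambda>P :: (nat \<times> bool \<times> bool) pmf.
     let U = (\<lambda>(u,x1,x2). u); X1 = (\<lambda>(u,x1,x2). x1); X2 = (\<lambda>(u,x1,x2). x2);
         Y = (\<lambda>(u,x1,x2). adder x1 x2) in
     min (C1 + C2 - cmi P X1 X2 U)
      (min (C2 + cmi P X1 Y (\<lambda>w. (X2 w, U w)))
       (min (C1 + cmi P X2 Y (\<lambda>w. (X1 w, U w)))
        (min ((C1 + C2 + cmi P (\<lambda>w. (X1 w, X2 w)) Y U - cmi P X1 X2 U) / 2)
             (mi P (\<lambda>w. (X1 w, X2 w)) Y)))))
   ` {P. finite (set_pmf P)})"

definition ub_joint :: "(bool \<times> bool) pmf \<Rightarrow> (bool \<times> bool \<Rightarrow> nat pmf) \<Rightarrow> (nat \<Rightarrow> nat pmf)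
    \<Rightarrow> (bool \<times> bool \<times> nat \<times> nat) pmf" where
  "ub_joint P Kq Ku = do { (x1, x2) \<leftarrow> P; q \<leftarrow> Kq (x1, x2); u \<leftarrow> Ku (adder x1 x2);
                           return_pmf (x1, x2, q, u) }"

definition ub_value :: "real \<Rightarrow> real \<Rightarrow> (bool \<times> bool \<times> nat \<times> nat) pmf \<Rightarrow> real" where
  "ub_value C1 C2 J =
     (let X1 = (\<lambda>(x1,x2,q,u). x1); X2 = (\<lambda>(x1,x2,q,u). x2);
          Q = (\<lambda>(x1,x2,q,u). q); U = (\<lambda>(x1,x2,q,u). u);
          Y = (\<lambda>(x1,x2,q,u). adder x1 x2);
          X12 = (\<lambda>w. (X1 w, X2 w)) in
      min (C1 + C2)
       (min (C1 + cmi J X2 Y (\<lambda>w. (X1 w, Q w)))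
        (min (C2 + cmi J X1 Y (\<lambda>w. (X2 w, Q w)))
         (min (cmi J X12 Y Q)
              (C1 + C2 - cmi J X12 U Q + cmi J X2 U (\<lambda>w. (X1 w, Q w))
                 + cmi J X1 U (\<lambda>w. (X2 w, Q w)))))))"

definition upper_bound :: "real \<Rightarrow> real \<Rightarrow> real" where
  "upper_bound C1 C2 = Sup ((\<lambda>P. Inf ((\<lambda>Ku. Sup ((\<lambda>Kq. ub_value C1 C2 (ub_joint P Kq Ku))
        ` {Kq. \<forall>x. finite (set_pmf (Kq x))}))
      ` {Ku. \<forall>y. finite (set_pmf (Ku y))})) ` UNIV)"

definition capacity_formula :: "real \<Rightarrow> real \<Rightarrow> real" where
  "capacity_formula C1 C2 = Sup ((\<lambda>p. min (C1 + C2 - 1 + h2 p) (min (C1 + h2 p) (h2 p + 1 - p)))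
      ` {0..1/2})"

end

theory Submission
  imports Defs "HOL-Real_Asymp.Real_Asymp"
begin

text \<open>
  Achievability. It suffices to find sets \<open>A1, A2\<close> of binary words of length \<open>n\<close> with \<open>2 powr (n * C1)\<close> and
  \<open>2 powr (n * C2)\<close> elements and at least \<open>2 powr (n * R)\<close> distinct sums: messages are the sums, relays get the
  summands, and decoding is error free. Random sets work: there are \<open>(n choose k) * 2 ^ (n - k)\<close> sums with \<open>k = n * p\<close>
  ones, each with \<open>2 ^ k\<close> representations, and the second Bonferroni inequality bounds the number of hit sums.

  Converse. The time sharing bounds \<open>R \<le> C1 + h2 s\<close> and \<open>R \<le> h2 s + 1 - s\<close>, with \<open>s\<close> the frequency of the
  output 1, settle everything except \<open>C2 < 1\<close>, \<open>C1 + C2 = 2 - p\<close> with \<open>1/3 < p < 1/2\<close>. There one takes the convex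
  combination of \<open>R \<le> H(Y)\<close> and \<open>R \<le> C1 + C2 - I(X1;X2)\<close> whose weight makes \<open>p\<close> stationary. Let \<open>T\<close> be
  the test channel output for which the inputs of a doubly symmetric source with parameter \<open>p\<close> are independent
  given \<open>T\<close>. Bounding \<open>H(T|X1)\<close> and \<open>H(T|X2)\<close> by cross entropies gives
  \<open>I(X1;X2) \<ge> H(T) - E[- log q(Y)]\<close> with \<open>q = p\<close> at output 1 and \<open>q = 1 - p\<close> otherwise. What remains involves \<open>Y\<close> and
  \<open>T\<close> only, tensorizes by the chain rule, and for a single letter follows from
  \<open>1 - h2 ((1 + m * z) / 2) \<le> m\<^sup>2 * (1 - h2 ((1 + z) / 2))\<close>.

  The same single letter inequality, conditioned on the auxiliary variable, bounds the two expressions of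
  Theorems 1 and 3 from above; the doubly symmetric source with constant auxiliary variable attains them.
\<close>

section \<open>Entropy of finitely supported distributions\<close>

text \<open>On the segment 1/3 < p < 1/2 the curve \<open>h2 p + 1 - p\<close> decreases, being
  maximal at 1/3, while \<open>C1 + C2 - 1 + h2 p\<close> increases up to 1/2; they cross at p = 2 -
  (C1 + C2). Neither bound alone reaches the crossing value, hence the weighted mean with stationary
  point p. The obstacle is I(X1;X2): a lower bound is needed for blocks whose letters are
  arbitrarily dependent, and this term does not split into single letters. The test channel output T
  removes it. Always I(X1;X2) = I(X1;X2|T) + H(T) - H(T|X1) - H(T|X2) + H(T|X1,X2), and the first
  summand is dropped. Because the law of T given the inputs has the product form W1 * W2 / q, the
  cross entropies of T relative to W1 and W2 cancel against H(T|X1,X2), and only q survives, which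
  depends on the inputs through Y alone. Both losses vanish for the doubly symmetric source with
  parameter p, so nothing is lost at the optimum.\<close>

definition wsum :: "'a pmf \<Rightarrow> ('a \<Rightarrow> real) \<Rightarrow> real" where
  "wsum P g = (\<Sum>w\<in>set_pmf P. pmf P w * g w)"

lemma wsum_cong: "(\<And>w. w \<in> set_pmf P \<Longrightarrow> g w = g' w) \<Longrightarrow> wsum P g = wsum P g'"
  unfolding wsum_def by (rule sum.cong) auto

lemma wsum_mono: "(\<And>w. w \<in> set_pmf P \<Longrightarrow> g w \<le> g' w) \<Longrightarrow> wsum P g \<le> wsum P g'"
  unfolding wsum_def by (rule sum_mono) (auto intro: mult_left_mono)

lemma wsum_add: "wsum P (\<lambda>w. g w + g' w) = wsum P g + wsum P g'"
  unfolding wsum_def by (simp add: algebra_simps sum.distrib)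

lemma wsum_diff: "wsum P (\<lambda>w. g w - g' w) = wsum P g - wsum P g'"
  unfolding wsum_def by (simp add: algebra_simps sum_subtractf)

lemma wsum_uminus: "wsum P (\<lambda>w. - g w) = - wsum P g"
  unfolding wsum_def by (simp add: sum_negf)

lemma wsum_cmult: "wsum P (\<lambda>w. a * g w) = a * wsum P g"
  unfolding wsum_def by (simp add: sum_distrib_left mult.left_commute)

lemma wsum_const: "finite (set_pmf P) \<Longrightarrow> wsum P (\<lambda>w. a) = a"
  unfolding wsum_def by (simp add: sum_distrib_right[symmetric] sum_pmf_eq_1)

lemma wsum_affine: "finite (set_pmf P) \<Longrightarrow> wsum P (\<lambda>w. g w * a - b) = wsum P g * a - b"
  using wsum_cmult[of P a g] by (simp add: wsum_diff wsum_const mult.commute)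

lemma pmf_map_sum:
  assumes "finite (set_pmf P)"
  shows "pmf (map_pmf f P) v = (\<Sum>w\<in>{w\<in>set_pmf P. f w = v}. pmf P w)"
proof -
  have "pmf (map_pmf f P) v = measure_pmf.prob P (f -` {v} \<inter> set_pmf P)"
    by (simp add: pmf_map measure_Int_set_pmf)
  also have "\<dots> = (\<Sum>w\<in>f -` {v} \<inter> set_pmf P. pmf P w)"
    using assms by (intro measure_measure_pmf_finite) auto
  also have "f -` {v} \<inter> set_pmf P = {w\<in>set_pmf P. f w = v}" by auto
  finally show ?thesis .
qed

lemma pmf_marginal:
  assumes fin: "finite (set_pmf P)" and B: "finite B" "A ` set_pmf P \<subseteq> B"
  shows "(\<Sum>a\<in>B. pmf (map_pmf (\<lambda>w. (A w, C w)) P) (a, c)) = pmf (map_pmf C P) c"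
proof -
  have "(\<Sum>a\<in>B. pmf (map_pmf (\<lambda>w. (A w, C w)) P) (a, c))
      = (\<Sum>a\<in>B. \<Sum>w\<in>{w\<in>{w\<in>set_pmf P. C w = c}. A w = a}. pmf P w)"
    by (intro sum.cong) (auto simp: pmf_map_sum[OF fin] intro!: sum.cong)
  also have "\<dots> = pmf (map_pmf C P) c"
    unfolding pmf_map_sum[OF fin] using fin B by (intro sum.group) auto
  finally show ?thesis .
qed

lemma wsum_comp_image:
  assumes "finite (set_pmf P)"
  shows "wsum P (\<lambda>w. g (f w)) = (\<Sum>v\<in>f ` set_pmf P. pmf (map_pmf f P) v * g v)"
proof -
  have "wsum P (\<lambda>w. g (f w)) = (\<Sum>v\<in>f ` set_pmf P. \<Sum>w\<in>{w\<in>set_pmf P. f w = v}. pmf P w * g (f w))"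
    unfolding wsum_def using assms by (rule sum.image_gen)
  also have "\<dots> = (\<Sum>v\<in>f ` set_pmf P. pmf (map_pmf f P) v * g v)"
    by (rule sum.cong) (auto simp: pmf_map_sum[OF assms] sum_distrib_right)
  finally show ?thesis .
qed

lemma wsum_cong_set:
  assumes "finite (set_pmf P)" "finite A" "f ` set_pmf P \<subseteq> A"
  shows "wsum P (\<lambda>w. g (f w)) = (\<Sum>v\<in>A. pmf (map_pmf f P) v * g v)"
  unfolding wsum_comp_image[OF assms(1)]
  using assms by (intro sum.mono_neutral_left) (auto simp: pmf_map_outside)

lemma wsum_map:
  assumes "finite (set_pmf P)"
  shows "wsum (map_pmf f P) g = wsum P (\<lambda>w. g (f w))"
  using wsum_comp_image[OF assms, of g f] by (simp add: wsum_def)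

lemma ent_wsum:
  assumes "finite (set_pmf P)"
  shows "ent P f = wsum P (\<lambda>w. - log 2 (pmf (map_pmf f P) (f w)))"
  using wsum_comp_image[OF assms, of "\<lambda>v. - log 2 (pmf (map_pmf f P) v)" f]
  by (simp add: ent_def sum_negf)

lemma pmf_map_pos: "w \<in> set_pmf P \<Longrightarrow> 0 < pmf (map_pmf f P) (f w)"
  by (simp add: pmf_positive)

lemma ent_map: "ent (map_pmf g P) f = ent P (\<lambda>w. f (g w))"
  by (simp add: ent_def pmf.map_comp o_def image_image)

text \<open>Entropy depends only on the partition into level sets. Tuples are reordered and
  determined coordinates are dropped by this rule throughout.\<close>

lemma ent_eqI:
  assumes "finite (set_pmf P)"
    and eq: "\<And>w w'. w \<in> set_pmf P \<Longrightarrow> w' \<in> set_pmf P \<Longrightarrow> f w = f w' \<longleftrightarrow> g w = g w'"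
  shows "ent P f = ent P g"
  unfolding ent_wsum[OF assms(1)]
proof (rule wsum_cong)
  fix w assume "w \<in> set_pmf P"
  then have "{w' \<in> set_pmf P. f w' = f w} = {w' \<in> set_pmf P. g w' = g w}" using eq by auto
  then show "- log 2 (pmf (map_pmf f P) (f w)) = - log 2 (pmf (map_pmf g P) (g w))"
    by (simp add: pmf_map_sum[OF assms(1)])
qed

lemma ent_cong_set:
  assumes "finite A" "f ` set_pmf P \<subseteq> A"
  shows "ent P f = - (\<Sum>v\<in>A. pmf (map_pmf f P) v * log 2 (pmf (map_pmf f P) v))"
proof -
  have "(\<Sum>v\<in>f ` set_pmf P. pmf (map_pmf f P) v * log 2 (pmf (map_pmf f P) v))
     = (\<Sum>v\<in>A. pmf (map_pmf f P) v * log 2 (pmf (map_pmf f P) v))"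
    using assms by (intro sum.mono_neutral_left) (auto simp: pmf_map_outside)
  then show ?thesis by (simp add: ent_def)
qed

lemma ent_const: "ent P (\<lambda>_. c) = 0"
  by (simp add: ent_def image_constant_conv set_pmf_not_empty map_pmf_const)

text \<open>Gibbs' inequality: \<open>ln t \<le> t - 1\<close> is averaged over the ratio t of
  \<open>k\<close> to the true conditional law, whose mean is at most 1. Most entropy bounds below
  amount to a choice of the reference kernel \<open>k\<close>.\<close>

lemma cond_ent_le_cross:
  assumes fin: "finite (set_pmf P)"
    and k0: "\<And>c a. 0 \<le> k c a"
    and kpos: "\<And>w. w \<in> set_pmf P \<Longrightarrow> 0 < k (C w) (A w)"
    and ksum: "\<And>c. c \<in> C ` set_pmf P \<Longrightarrow> (\<Sum>a\<in>A ` set_pmf P. k c a) \<le> 1"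
  shows "ent P (\<lambda>w. (A w, C w)) - ent P C \<le> wsum P (\<lambda>w. - log 2 (k (C w) (A w)))"
proof -
  let ?S = "set_pmf P"
  define pac where "pac = pmf (map_pmf (\<lambda>w. (A w, C w)) P)"
  define pc where "pc = pmf (map_pmf C P)"
  define \<phi> where "\<phi> = (\<lambda>(a, c). k c a * pc c / pac (a, c))"
  have pos: "0 < pac (A w, C w)" "0 < pc (C w)" if "w \<in> ?S" for w
    using that by (auto simp: pac_def pc_def intro: pmf_map_pos)
  have "wsum P (\<lambda>w. \<phi> (A w, C w)) = (\<Sum>v\<in>(\<lambda>w. (A w, C w)) ` ?S. pac v * \<phi> v)"
    unfolding pac_def by (rule wsum_comp_image[OF fin])
  also have "\<dots> = (\<Sum>v\<in>(\<lambda>w. (A w, C w)) ` ?S. k (snd v) (fst v) * pc (snd v))"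
    by (rule sum.cong) (auto simp: \<phi>_def dest: pos)
  also have "\<dots> \<le> (\<Sum>v\<in>A ` ?S \<times> C ` ?S. k (snd v) (fst v) * pc (snd v))"
    using fin by (intro sum_mono2) (auto simp: k0 pc_def)
  also have "\<dots> = (\<Sum>c\<in>C ` ?S. (\<Sum>a\<in>A ` ?S. k c a) * pc c)"
    unfolding sum.cartesian_product' by (subst sum.swap) (simp add: sum_distrib_right)
  also have "\<dots> \<le> (\<Sum>c\<in>C ` ?S. 1 * pc c)"
    using ksum by (intro sum_mono mult_right_mono) (auto simp: pc_def)
  also have "\<dots> = 1" unfolding pc_def
    using fin by (simp add: sum_pmf_eq_1)
  finally have le1: "wsum P (\<lambda>w. \<phi> (A w, C w)) \<le> 1" .
  have "wsum P (\<lambda>w. log 2 (k (C w) (A w)) + log 2 (pc (C w)) - log 2 (pac (A w, C w)))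
    \<le> wsum P (\<lambda>w. (1 / ln 2) * (\<phi> (A w, C w) - 1))"
  proof (rule wsum_mono)
    fix w assume w: "w \<in> ?S"
    have "ln (\<phi> (A w, C w)) \<le> \<phi> (A w, C w) - 1"
      using pos[OF w] kpos[OF w] by (intro ln_le_minus_one) (auto simp: \<phi>_def)
    moreover have "log 2 (k (C w) (A w)) + log 2 (pc (C w)) - log 2 (pac (A w, C w)) = ln (\<phi> (A w, C w)) / ln 2"
      using pos[OF w] kpos[OF w] by (simp add: \<phi>_def log_def ln_div ln_mult add_divide_distrib diff_divide_distrib)
    ultimately show "log 2 (k (C w) (A w)) + log 2 (pc (C w)) - log 2 (pac (A w, C w))
        \<le> (1 / ln 2) * (\<phi> (A w, C w) - 1)" by (simp add: divide_right_mono)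
  qed
  also have "\<dots> = (1 / ln 2) * (wsum P (\<lambda>w. \<phi> (A w, C w)) - 1)"
    by (simp only: wsum_cmult wsum_diff wsum_const[OF fin])
  also have "\<dots> \<le> 0" using le1 by (simp add: divide_nonpos_pos)
  finally show ?thesis
    by (simp add: ent_wsum[OF fin] wsum_add wsum_diff wsum_uminus pac_def pc_def)
qed

lemma ent_le_cross:
  assumes fin: "finite (set_pmf P)"
    and k0: "\<And>a. 0 \<le> k a"
    and kpos: "\<And>w. w \<in> set_pmf P \<Longrightarrow> 0 < k (A w)"
    and ksum: "(\<Sum>a\<in>A ` set_pmf P. k a) \<le> 1"
  shows "ent P A \<le> wsum P (\<lambda>w. - log 2 (k (A w)))"
proof -
  have "ent P A = ent P (\<lambda>w. (A w, ()))" using fin by (rule ent_eqI) auto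
  then show ?thesis
    using cond_ent_le_cross[OF fin, of "\<lambda>_. k" "\<lambda>_. ()" A] assms by (auto simp: ent_const)
qed

lemma ent_le_log_card:
  assumes fin: "finite (set_pmf P)" and A: "finite B" "A ` set_pmf P \<subseteq> B"
  shows "ent P A \<le> log 2 (card B)"
proof -
  have B: "card B > 0" using A set_pmf_not_empty[of P] by (auto simp: card_gt_0_iff)
  have "ent P A \<le> wsum P (\<lambda>w. - log 2 (1 / card B))"
  proof (rule ent_le_cross[OF fin, of "\<lambda>_. 1 / card B"])
    have "card (A ` set_pmf P) \<le> card B" by (rule card_mono) (use A in auto)
    then show "(\<Sum>a\<in>A ` set_pmf P. 1 / card B) \<le> 1" using B by (simp add: field_simps)
  qed (use B in auto)
  then show ?thesis using B by (simp add: wsum_const[OF fin] log_divide)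
qed

text \<open>Gibbs' inequality with the true law of \<open>A\<close> given \<open>C\<close> as
  reference kernel, used although \<open>B\<close> is known as well.\<close>

lemma ent_submodular:
  assumes fin: "finite (set_pmf P)"
  shows "ent P (\<lambda>w. (A w, B w, C w)) + ent P C \<le> ent P (\<lambda>w. (A w, C w)) + ent P (\<lambda>w. (B w, C w))"
proof -
  let ?S = "set_pmf P"
  define k where "k = (\<lambda>(bc::'c \<times> 'd) a. pmf (map_pmf (\<lambda>w. (A w, C w)) P) (a, snd bc) / pmf (map_pmf C P) (snd bc))"
  have "ent P (\<lambda>w. (A w, B w, C w)) - ent P (\<lambda>w. (B w, C w)) \<le> wsum P (\<lambda>w. - log 2 (k (B w, C w) (A w)))"
  proof (rule cond_ent_le_cross[OF fin])
    show "0 < k (B w, C w) (A w)" if "w \<in> ?S" for w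
      using pmf_map_pos[OF that, of "\<lambda>w. (A w, C w)"] pmf_map_pos[OF that, of C] by (simp add: k_def)
    fix bc assume "bc \<in> (\<lambda>w. (B w, C w)) ` ?S"
    then obtain w where w: "w \<in> ?S" "snd bc = C w" by auto
    have "(\<Sum>a\<in>A ` ?S. pmf (map_pmf (\<lambda>w. (A w, C w)) P) (a, C w)) = pmf (map_pmf C P) (C w)"
      using fin by (intro pmf_marginal) auto
    then show "(\<Sum>a\<in>A ` ?S. k bc a) \<le> 1"
      using pmf_map_pos[OF w(1), of C] by (simp add: k_def w sum_divide_distrib[symmetric])
  qed (simp add: k_def)
  also have "\<dots> = wsum P (\<lambda>w. - log 2 (pmf (map_pmf (\<lambda>w. (A w, C w)) P) (A w, C w)) - - log 2 (pmf (map_pmf C P) (C w)))"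
  proof (rule wsum_cong)
    fix w assume w: "w \<in> ?S"
    show "- log 2 (k (B w, C w) (A w)) = - log 2 (pmf (map_pmf (\<lambda>w. (A w, C w)) P) (A w, C w)) - - log 2 (pmf (map_pmf C P) (C w))"
      using pmf_map_pos[OF w, of "\<lambda>w. (A w, C w)"] pmf_map_pos[OF w, of C] by (simp add: k_def log_divide)
  qed
  also have "\<dots> = ent P (\<lambda>w. (A w, C w)) - ent P C"
    by (simp only: wsum_diff ent_wsum[OF fin])
  finally show ?thesis by simp
qed

lemma cmi_nonneg: "finite (set_pmf P) \<Longrightarrow> 0 \<le> cmi P A B C"
  using ent_submodular[of P A B C] by (simp add: cmi_def)

text \<open>Submodularity with both leading variables equal to \<open>f\<close> reads H(f) + H(g)
  \<le> 2 * H(f).\<close>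

lemma ent_mono:
  assumes fin: "finite (set_pmf P)"
    and fg: "\<And>w w'. w \<in> set_pmf P \<Longrightarrow> w' \<in> set_pmf P \<Longrightarrow> f w = f w' \<Longrightarrow> g w = g w'"
  shows "ent P g \<le> ent P f"
proof -
  have "ent P (\<lambda>w. (f w, f w, g w)) = ent P f" "ent P (\<lambda>w. (f w, g w)) = ent P f"
    using fg by (auto intro!: ent_eqI[OF fin])
  then show ?thesis using ent_submodular[OF fin, of f f g] by simp
qed

lemma ent_subadditive:
  assumes fin: "finite (set_pmf P)"
  shows "ent P (\<lambda>w. (A w, B w)) \<le> ent P A + ent P B"
proof -
  have "ent P (\<lambda>w. (A w, B w, ())) = ent P (\<lambda>w. (A w, B w))"
    "ent P (\<lambda>w. (A w, ())) = ent P A" "ent P (\<lambda>w. (B w, ())) = ent P B"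
    by (auto intro!: ent_eqI[OF fin])
  then show ?thesis using ent_submodular[OF fin, of A B "\<lambda>_. ()"] by (simp add: ent_const)
qed

section \<open>Conditioning on the value of a variable\<close>

lemma set_cond_fiber:
  assumes "q \<in> Q ` set_pmf P"
  shows "set_pmf (cond_pmf P (Q -` {q})) = {w \<in> set_pmf P. Q w = q}"
    and "pmf (cond_pmf P (Q -` {q})) w = (if Q w = q then pmf P w / pmf (map_pmf Q P) q else 0)"
proof -
  have ne: "set_pmf P \<inter> Q -` {q} \<noteq> {}" using assms by auto
  show "set_pmf (cond_pmf P (Q -` {q})) = {w \<in> set_pmf P. Q w = q}"
    by (subst set_cond_pmf[OF ne]) auto
  show "pmf (cond_pmf P (Q -` {q})) w = (if Q w = q then pmf P w / pmf (map_pmf Q P) q else 0)"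
    by (subst pmf_cond[OF ne]) (simp add: pmf_map)
qed

lemma wsum_cond:
  assumes fin: "finite (set_pmf P)"
  shows "wsum P g = (\<Sum>q\<in>Q ` set_pmf P. pmf (map_pmf Q P) q * wsum (cond_pmf P (Q -` {q})) g)"
proof -
  have "wsum P g = (\<Sum>q\<in>Q ` set_pmf P. \<Sum>w\<in>{w\<in>set_pmf P. Q w = q}. pmf P w * g w)"
    unfolding wsum_def using fin by (rule sum.image_gen)
  also have "\<dots> = (\<Sum>q\<in>Q ` set_pmf P. pmf (map_pmf Q P) q * wsum (cond_pmf P (Q -` {q})) g)"
  proof (rule sum.cong[OF refl])
    fix q assume q: "q \<in> Q ` set_pmf P"
    then have "pmf (map_pmf Q P) q > 0" by (auto intro: pmf_map_pos)
    then show "(\<Sum>w\<in>{w\<in>set_pmf P. Q w = q}. pmf P w * g w)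
      = pmf (map_pmf Q P) q * wsum (cond_pmf P (Q -` {q})) g"
      unfolding wsum_def set_cond_fiber[OF q] by (auto simp: sum_distrib_left intro!: sum.cong)
  qed
  finally show ?thesis .
qed

lemma pmf_map_cond:
  assumes fin: "finite (set_pmf P)" and q: "q \<in> Q ` set_pmf P"
  shows "pmf (map_pmf A (cond_pmf P (Q -` {q}))) a = pmf (map_pmf (\<lambda>w. (A w, Q w)) P) (a, q) / pmf (map_pmf Q P) q"
proof -
  have fin': "finite (set_pmf (cond_pmf P (Q -` {q})))" using fin by (simp add: set_cond_fiber[OF q])
  show ?thesis
    unfolding pmf_map_sum[OF fin'] pmf_map_sum[OF fin, of "\<lambda>w. (A w, Q w)"] set_cond_fiber[OF q] sum_divide_distrib
    by (auto intro!: sum.cong)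
qed

lemma cond_ent_eq:
  assumes fin: "finite (set_pmf P)"
  shows "ent P (\<lambda>w. (A w, Q w)) - ent P Q
    = (\<Sum>q\<in>Q ` set_pmf P. pmf (map_pmf Q P) q * ent (cond_pmf P (Q -` {q})) A)"
proof -
  have "ent P (\<lambda>w. (A w, Q w)) - ent P Q = wsum P (\<lambda>w. - log 2 (pmf (map_pmf (\<lambda>w. (A w, Q w)) P) (A w, Q w))
     - - log 2 (pmf (map_pmf Q P) (Q w)))"
    by (simp only: wsum_diff ent_wsum[OF fin])
  also have "\<dots> = (\<Sum>q\<in>Q ` set_pmf P. pmf (map_pmf Q P) q * ent (cond_pmf P (Q -` {q})) A)"
    unfolding wsum_cond[OF fin, where Q = Q]
  proof (rule sum.cong[OF refl])
    fix q assume q: "q \<in> Q ` set_pmf P"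
    let ?c = "cond_pmf P (Q -` {q})"
    have fin': "finite (set_pmf ?c)" using fin by (simp add: set_cond_fiber[OF q])
    have pq: "pmf (map_pmf Q P) q > 0" using q by (auto intro: pmf_map_pos)
    have "ent ?c A = wsum ?c (\<lambda>w. - log 2 (pmf (map_pmf (\<lambda>w. (A w, Q w)) P) (A w, Q w))
     - - log 2 (pmf (map_pmf Q P) (Q w)))"
      unfolding ent_wsum[OF fin']
    proof (rule wsum_cong)
      fix w assume "w \<in> set_pmf ?c"
      then have w: "w \<in> set_pmf P" "Q w = q" by (auto simp: set_cond_fiber[OF q])
      have "pmf (map_pmf A ?c) (A w) = pmf (map_pmf (\<lambda>w. (A w, Q w)) P) (A w, Q w) / pmf (map_pmf Q P) q"
        by (simp add: pmf_map_cond[OF fin q] w)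
      then show "- log 2 (pmf (map_pmf A ?c) (A w)) = - log 2 (pmf (map_pmf (\<lambda>w. (A w, Q w)) P) (A w, Q w))
           - - log 2 (pmf (map_pmf Q P) (Q w))"
        using pmf_map_pos[OF w(1), of "\<lambda>w. (A w, Q w)"] pq w by (simp add: log_divide)
    qed
    then show "pmf (map_pmf Q P) q * wsum ?c (\<lambda>w. - log 2 (pmf (map_pmf (\<lambda>w. (A w, Q w)) P) (A w, Q w))
     - - log 2 (pmf (map_pmf Q P) (Q w))) = pmf (map_pmf Q P) q * ent ?c A" by simp
  qed
  finally show ?thesis .
qed

section \<open>Adjoining a channel output to a random variable\<close>

definition attach :: "'a pmf \<Rightarrow> ('a \<Rightarrow> 'b pmf) \<Rightarrow> ('a \<times> 'b) pmf" where
  "attach P K = bind_pmf P (\<lambda>x. map_pmf (Pair x) (K x))"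

lemma map_fst_attach: "map_pmf fst (attach P K) = P"
  by (simp add: attach_def map_bind_pmf pmf.map_comp o_def map_pmf_const bind_return_pmf')

lemma set_attach: "set_pmf (attach P K) = (SIGMA x:set_pmf P. set_pmf (K x))"
  by (auto simp: attach_def)

lemma finite_attach:
  "finite (set_pmf P) \<Longrightarrow> (\<And>x. x \<in> set_pmf P \<Longrightarrow> finite (set_pmf (K x))) \<Longrightarrow> finite (set_pmf (attach P K))"
  by (auto simp: set_attach)

lemma ent_attach_fst: "ent (attach P K) (\<lambda>w. f (fst w)) = ent P f"
  using ent_map[of fst "attach P K" f] by (simp add: map_fst_attach)

lemma wsum_attach_fst:
  assumes "finite (set_pmf (attach P K))"
  shows "wsum (attach P K) (\<lambda>w. f (fst w)) = wsum P f"
  using wsum_map[OF assms, of fst f] by (simp add: map_fst_attach)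

lemma pmf_attach:
  assumes V: "\<And>x. x \<in> set_pmf P \<Longrightarrow> map_pmf B (K x) = V (C x)"
  shows "pmf (map_pmf (\<lambda>w. (B (snd w), C (fst w))) (attach P K)) (b, c) = pmf (map_pmf C P) c * pmf (V c) b"
proof -
  have "map_pmf (\<lambda>w. (B (snd w), C (fst w))) (attach P K) = bind_pmf P (\<lambda>x. map_pmf (\<lambda>b. (b, C x)) (map_pmf B (K x)))"
    by (simp add: attach_def map_bind_pmf pmf.map_comp o_def)
  also have "\<dots> = bind_pmf P (\<lambda>x. map_pmf (\<lambda>b. (b, C x)) (V (C x)))"
    by (rule bind_pmf_cong) (simp_all add: V)
  also have "\<dots> = bind_pmf (map_pmf C P) (\<lambda>c. map_pmf (\<lambda>b. (b, c)) (V c))"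
    by (simp add: bind_map_pmf)
  finally have eq: "map_pmf (\<lambda>w. (B (snd w), C (fst w))) (attach P K) = \<dots>" .
  have "pmf (map_pmf (\<lambda>b. (b, c')) (V c')) (b, c) = indicator {c} c' * pmf (V c) b" for c'
  proof (cases "c' = c")
    case True
    have "inj (\<lambda>b. (b, c))" by (auto simp: inj_def)
    from pmf_map_inj'[OF this] show ?thesis using True by simp
  next
    case False then show ?thesis by (auto intro!: pmf_map_outside)
  qed
  then show ?thesis
    unfolding eq pmf_bind by (simp add: measure_pmf_single)
qed

text \<open>Chain rule for an output \<open>B\<close> whose law depends on the input only through
  \<open>C\<close>. The last summand involves the kernel alone, so applying the lemma to a coarse
  and to a fine \<open>C\<close> shows that conditioning beyond the channel input does not change
  the conditional entropy.\<close>

lemma ent_attach: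
  assumes fin: "finite (set_pmf (attach P K))"
    and V: "\<And>x. x \<in> set_pmf P \<Longrightarrow> map_pmf B (K x) = V (C x)"
  shows "ent (attach P K) (\<lambda>w. (B (snd w), C (fst w)))
    = ent P C + wsum (attach P K) (\<lambda>w. - log 2 (pmf (V (C (fst w))) (B (snd w))))"
proof -
  have "ent (attach P K) (\<lambda>w. (B (snd w), C (fst w)))
     = wsum (attach P K) (\<lambda>w. - log 2 (pmf (map_pmf C P) (C (fst w))) + - log 2 (pmf (V (C (fst w))) (B (snd w))))"
    unfolding ent_wsum[OF fin] pmf_attach[of P B K V C, OF V, simplified]
  proof (rule wsum_cong)
    fix w assume "w \<in> set_pmf (attach P K)"
    then have w: "fst w \<in> set_pmf P" "snd w \<in> set_pmf (K (fst w))" by (auto simp: set_attach)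
    have "pmf (V (C (fst w))) (B (snd w)) > 0"
      using pmf_map_pos[OF w(2), of B] by (simp add: V[OF w(1)])
    then show "- log 2 (pmf (map_pmf C P) (C (fst w)) * pmf (V (C (fst w))) (B (snd w))) =
         - log 2 (pmf (map_pmf C P) (C (fst w))) + - log 2 (pmf (V (C (fst w))) (B (snd w)))"
      using pmf_map_pos[OF w(1), of C] by (simp add: log_mult)
  qed
  also have "\<dots> = wsum (attach P K) (\<lambda>w. - log 2 (pmf (map_pmf (\<lambda>w. C (fst w)) (attach P K)) (C (fst w))))
       + wsum (attach P K) (\<lambda>w. - log 2 (pmf (V (C (fst w))) (B (snd w))))"
    using pmf.map_comp[of C fst "attach P K"]
    by (simp only: wsum_add map_fst_attach o_def)
  also have "wsum (attach P K) (\<lambda>w. - log 2 (pmf (map_pmf (\<lambda>w. C (fst w)) (attach P K)) (C (fst w)))) = ent P C"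
    by (subst ent_wsum[OF fin, symmetric]) (rule ent_attach_fst)
  finally show ?thesis .
qed

section \<open>The single letter inequality\<close>

lemma h2_sym: "h2 (1 - p) = h2 p"
  by (simp add: h2_def algebra_simps)

lemma h2_half: "h2 (1/2) = 1"
  by (simp add: h2_def log_divide)

lemma log_le_tangent:
  assumes "0 < p" "0 \<le> s"
  shows "- s * log 2 s \<le> - s * log 2 p + (p - s) / ln 2"
proof (cases "s = 0")
  case False
  then have s: "s > 0" using assms by simp
  have "ln (p / s) \<le> p / s - 1" using s assms by (intro ln_le_minus_one) auto
  then have "s * ln (p / s) \<le> p - s" using s by (simp add: field_simps)
  then have "s * (ln p - ln s) \<le> p - s" using s assms by (simp add: ln_div)
  then have "(s * ln p - s * ln s) / ln 2 \<le> (p - s) / ln 2"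
    by (intro divide_right_mono) (auto simp: algebra_simps)
  then show ?thesis by (simp add: log_def diff_divide_distrib)
qed (use assms in auto)

lemma h2_le_cross:
  assumes "0 < p" "p < 1" "0 \<le> s" "s \<le> 1"
  shows "h2 s \<le> - s * log 2 p - (1 - s) * log 2 (1 - p)"
  using log_le_tangent[of p s] log_le_tangent[of "1 - p" "1 - s"] assms
  by (simp add: h2_def diff_divide_distrib algebra_simps)

lemma h2_nonneg:
  assumes "0 \<le> s" "s \<le> 1" shows "0 \<le> h2 s"
proof -
  have "x * log 2 x \<le> 0" if "0 \<le> x" "x \<le> 1" for x :: real
    using that by (cases "x = 0") (auto intro!: mult_nonneg_nonpos)
  from this[of s] this[of "1 - s"] show ?thesis using assms by (simp add: h2_def)
qed

lemma h2_le_1: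
  assumes "0 \<le> s" "s \<le> 1" shows "h2 s \<le> 1"
  using h2_le_cross[of "1/2" s] assms by (simp add: log_divide)

lemma continuous_on_x_ln_x: "continuous_on {0..} (\<lambda>x::real. x * ln x)"
  unfolding continuous_on
proof
  fix x :: real assume x: "x \<in> {0..}"
  show "((\<lambda>x. x * ln x) \<longlongrightarrow> x * ln x) (at x within {0..})"
  proof (cases "x = 0")
    case True
    have "((\<lambda>x::real. x * ln x) \<longlongrightarrow> 0) (at_right 0)" by real_asymp
    then show ?thesis using True by (simp add: at_within_Ici_at_right)
  next
    case False
    then show ?thesis using x by (auto intro!: tendsto_intros)
  qed
qed

lemma continuous_on_h2: "continuous_on {0..1} h2"
proof -
  have "continuous_on {0..1} (\<lambda>x::real. x * ln x)"
    by (rule continuous_on_subset[OF continuous_on_x_ln_x]) auto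
  moreover have "continuous_on {0..1} (\<lambda>x::real. (1 - x) * ln (1 - x))"
    by (rule continuous_on_compose2[OF continuous_on_x_ln_x, of _ "\<lambda>x. 1 - x"]) (auto intro!: continuous_intros)
  ultimately have "continuous_on {0..1} (\<lambda>x::real. - (x * ln x) / ln 2 - (1 - x) * ln (1 - x) / ln 2)"
    by (intro continuous_on_diff continuous_on_divide continuous_on_minus continuous_on_const) auto
  then show ?thesis by (simp add: h2_def[abs_def] log_def)
qed

text \<open>The capacity of a binary symmetric channel, as an even function of its bias
  \<open>z\<close>. Its derivative is artanh z / ln 2.\<close>

definition h2gap :: "real \<Rightarrow> real" where "h2gap z = 1 - h2 ((1 + z) / 2)"

lemma h2gap_minus: "h2gap (- z) = h2gap z"
  using h2_sym[of "(1 + z) / 2"] by (simp add: h2gap_def field_simps)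

lemma h2gap_bounds: "\<bar>z\<bar> \<le> 1 \<Longrightarrow> 0 \<le> h2gap z \<and> h2gap z \<le> 1"
  using h2_le_1[of "(1 + z) / 2"] h2_nonneg[of "(1 + z) / 2"] by (auto simp: h2gap_def)

lemma h2_deriv:
  assumes "0 < q" "q < 1"
  shows "(h2 has_real_derivative (ln (1 - q) - ln q) / ln 2) (at q)"
proof -
  have "((\<lambda>q. q * ln q) has_real_derivative 1 * ln q + 1 / q * 1 * q) (at q)"
    using assms by (intro DERIV_mult DERIV_ident DERIV_chain2[OF DERIV_ln_divide]) auto
  moreover have "((\<lambda>q. (1 - q) * ln (1 - q)) has_real_derivative -1 * ln (1 - q) + 1 / (1 - q) * (-1) * (1 - q)) (at q)"
    using assms by (intro DERIV_mult DERIV_chain2[OF DERIV_ln_divide]) (auto intro!: derivative_eq_intros)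
  ultimately have "((\<lambda>q. - (q * ln q) - (1 - q) * ln (1 - q)) has_real_derivative
      - (1 * ln q + 1 / q * 1 * q) - (-1 * ln (1 - q) + 1 / (1 - q) * (-1) * (1 - q))) (at q)"
    by (intro DERIV_diff DERIV_minus)
  also have "- (1 * ln q + 1 / q * 1 * q) - (-1 * ln (1 - q) + 1 / (1 - q) * (-1) * (1 - q)) = ln (1 - q) - ln q"
    using assms by simp
  finally have "((\<lambda>q. (- (q * ln q) - (1 - q) * ln (1 - q)) / ln 2) has_real_derivative (ln (1 - q) - ln q) / ln 2) (at q)"
    by (rule DERIV_cdivide)
  then show ?thesis by (simp add: h2_def[abs_def] log_def diff_divide_distrib)
qed

lemma h2gap_deriv:
  assumes "-1 < z" "z < 1"
  shows "(h2gap has_real_derivative (ln (1 + z) - ln (1 - z)) / (2 * ln 2)) (at z)"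
proof -
  have *: "1 - (1 + z) / 2 = (1 - z) / 2" by (simp add: field_simps)
  have "((\<lambda>z. h2 ((1 + z) / 2)) has_real_derivative (ln (1 - (1 + z) / 2) - ln ((1 + z) / 2)) / ln 2 * (1/2)) (at z)"
    by (rule DERIV_chain2[OF h2_deriv]) (use assms in \<open>auto intro!: derivative_eq_intros\<close>)
  also have "(ln (1 - (1 + z) / 2) - ln ((1 + z) / 2)) / ln 2 * (1/2) = - ((ln (1 + z) - ln (1 - z)) / (2 * ln 2))"
    unfolding * using assms by (simp add: ln_div field_simps)
  finally have "((\<lambda>z. 1 - h2 ((1 + z) / 2)) has_real_derivative 0 - - ((ln (1 + z) - ln (1 - z)) / (2 * ln 2))) (at z)"
    by (intro DERIV_diff DERIV_const)
  then show ?thesis unfolding h2gap_def[abs_def] by simp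
qed

text \<open>Up to a factor 2 this is artanh (m * z) \<le> m * artanh z, which holds because the
  derivative 1 / (1 - z * z) of artanh increases on [0, 1).\<close>

lemma ln_ratio_scale:
  assumes "0 \<le> m" "m \<le> 1" "0 \<le> z" "z < (1::real)"
  shows "ln (1 + m * z) - ln (1 - m * z) \<le> m * (ln (1 + z) - ln (1 - z))"
proof -
  let ?f = "\<lambda>z. m * (ln (1 + z) - ln (1 - z)) - (ln (1 + m * z) - ln (1 - m * z))"
  have mz: "m * y < 1" "0 \<le> m * y" "m * y \<le> y" if "0 \<le> y" "y \<le> z" for y
  proof -
    show "m * y \<le> y" using that assms by (simp add: mult_left_le_one_le)
    then show "m * y < 1" using that assms by linarith
    show "0 \<le> m * y" using that assms by simp
  qed
  have "?f 0 \<le> ?f z"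
  proof (rule DERIV_nonneg_imp_nondecreasing[OF assms(3)], goal_cases)
    case (1 y)
    note b = mz[OF 1]
    have y: "0 \<le> y" "y < 1" using 1 assms by auto
    have d: "(?f has_real_derivative (m * (1 / (1 + y) + 1 / (1 - y)) - (m / (1 + m * y) + m / (1 - m * y)))) (at y)"
      using b y by (auto intro!: derivative_eq_intros simp: algebra_simps)
    have e: "1 / (1 + y) + 1 / (1 - y) = 2 / (1 - y * y)" using y by (simp add: field_simps)
    have e2: "m / (1 + m * y) + m / (1 - m * y) = m * (2 / (1 - (m * y) * (m * y)))" using b by (simp add: field_simps)
    have "(m * y) * (m * y) \<le> y * y" using b y by (intro mult_mono) auto
    moreover have "y * y < 1" using y mult_strict_mono[of y 1 y 1] by auto
    ultimately have "2 / (1 - (m * y) * (m * y)) \<le> 2 / (1 - y * y)" by (intro divide_left_mono mult_pos_pos) auto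
    then have "m * (2 / (1 - (m * y) * (m * y))) \<le> m * (2 / (1 - y * y))" using assms by (intro mult_left_mono)
    then have "0 \<le> m * (1 / (1 + y) + 1 / (1 - y)) - (m / (1 + m * y) + m / (1 - m * y))"
      unfolding e e2 by simp
    with d show ?case by blast
  qed
  then show ?thesis by simp
qed

text \<open>One factor \<open>m\<close> comes from the chain rule, the other from
  \<open>ln_ratio_scale\<close>. Convexity alone would give a single factor; the square is sharp
  since \<open>h2gap\<close> is quadratic at 0.\<close>

lemma h2gap_scale:
  assumes m: "0 \<le> m" "m \<le> 1" and z: "\<bar>z\<bar> \<le> 1"
  shows "h2gap (m * z) \<le> m\<^sup>2 * h2gap z"
proof -
  have main: "h2gap (m * z) \<le> m\<^sup>2 * h2gap z" if z: "0 \<le> z" "z \<le> 1" for z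
  proof -
    let ?f = "\<lambda>z. m\<^sup>2 * h2gap z - h2gap (m * z)"
    have cont: "continuous_on {0..1} h2gap"
      unfolding h2gap_def[abs_def]
      by (intro continuous_intros continuous_on_compose2[OF continuous_on_h2]) auto
    \<comment> \<open>Derivatives are compared on the open interval only, because that of
      \<open>h2gap\<close> is unbounded at 1; continuity covers the endpoint.\<close>
    have "?f 0 \<le> ?f z"
    proof (rule DERIV_nonneg_imp_increasing_open[OF z(1)])
      fix y assume y: "0 < y" "y < z"
      have my: "0 \<le> m * y" "m * y < 1"
        using y z m mult_left_le_one_le[of y m] by (simp, linarith)
      have "((\<lambda>z. h2gap (m * z)) has_real_derivative (ln (1 + m * y) - ln (1 - m * y)) / (2 * ln 2) * m) (at y)"
        by (rule DERIV_chain2[OF h2gap_deriv]) (use my in \<open>auto intro!: derivative_eq_intros\<close>)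
      moreover have "(h2gap has_real_derivative (ln (1 + y) - ln (1 - y)) / (2 * ln 2)) (at y)"
        using y z by (intro h2gap_deriv) auto
      ultimately have d: "(?f has_real_derivative m\<^sup>2 * ((ln (1 + y) - ln (1 - y)) / (2 * ln 2)) - (ln (1 + m * y) - ln (1 - m * y)) / (2 * ln 2) * m) (at y)"
        by (intro DERIV_diff DERIV_cmult)
      have "m * (ln (1 + m * y) - ln (1 - m * y)) \<le> m * (m * (ln (1 + y) - ln (1 - y)))"
        using y z m by (intro mult_left_mono ln_ratio_scale) auto
      then have "m * (ln (1 + m * y) - ln (1 - m * y)) / (2 * ln 2) \<le> m * (m * (ln (1 + y) - ln (1 - y))) / (2 * ln 2)"
        by (intro divide_right_mono) auto
      then have "0 \<le> m\<^sup>2 * ((ln (1 + y) - ln (1 - y)) / (2 * ln 2)) - (ln (1 + m * y) - ln (1 - m * y)) / (2 * ln 2) * m"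
        by (simp add: power2_eq_square mult_ac)
      with d show "\<exists>D. (?f has_real_derivative D) (at y) \<and> 0 \<le> D" by blast
    next
      have "m * y \<le> 1" if "0 \<le> y" "y \<le> z" for y using that z m mult_left_le_one_le[of y m] by auto
      then show "continuous_on {0..z} ?f"
        using z m by (intro continuous_intros continuous_on_subset[OF cont] continuous_on_compose2[OF cont]) auto
    qed
    moreover have "h2gap 0 = 0" by (simp add: h2gap_def h2_half)
    ultimately show ?thesis by simp
  qed
  show ?thesis
  proof (cases "0 \<le> z")
    case True then show ?thesis using main z by simp
  next
    case False
    then show ?thesis using main[of "- z"] z h2gap_minus[of z] h2gap_minus[of "m * z"] by simp
  qed
qed

lemma ln_ratio_ge:
  assumes "0 \<le> z" "z < (1::real)" shows "2 * z \<le> ln (1 + z) - ln (1 - z)"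
proof -
  let ?f = "\<lambda>z. ln (1 + z) - ln (1 - z) - 2 * z"
  have "?f 0 \<le> ?f z"
  proof (rule DERIV_nonneg_imp_nondecreasing[OF assms(1)], goal_cases)
    case (1 y)
    then have y: "0 \<le> y" "y < 1" using assms by auto
    have d: "(?f has_real_derivative (1 / (1 + y) + 1 / (1 - y) - 2)) (at y)"
      using y by (auto intro!: derivative_eq_intros)
    have "y * y < 1" using y mult_strict_mono[of y 1 y 1] by auto
    then have "1 / (1 + y) + 1 / (1 - y) - 2 \<ge> 0" using y by (simp add: field_simps)
    with d show ?case by blast
  qed
  then show ?thesis by simp
qed

section \<open>The weight and its numerical estimates\<close>

text \<open>\<open>slope\<close> is the derivative of \<open>h2\<close>. It is the weight of \<open>h2 p + 1 - p\<close> for which \<open>p\<close> maximizes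
  the weighted mean of \<open>h2 p + 1 - p\<close> and \<open>C1 + C2 - 1 + h2 p\<close>; \<open>adder_rate\<close> is that mean
  without its summand \<open>(1 - slope p) * (C1 + C2)\<close>.\<close>
definition slope :: "real \<Rightarrow> real" where "slope p = log 2 ((1 - p) / p)"

definition adder_rate :: "real \<Rightarrow> real" where
  "adder_rate p = slope p * (h2 p + 1 - p) + (1 - slope p) * (h2 p - 1)"

text \<open>The window between 1/3 and 1/2 is where \<open>slope p\<close> is a proper convex
  weight. The third bound keeps this weight from vanishing faster than \<open>1 - 2 * p\<close> as p
  approaches 1/2.\<close>

lemma slope_bounds:
  assumes "1/3 < p" "p < 1/2"
  shows "0 < slope p" "slope p < 1" "2 * (1 - 2 * p) \<le> slope p * ln 2"
proof -
  have "1 < (1 - p) / p" "(1 - p) / p < 2" using assms by (auto simp: field_simps)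
  then show "0 < slope p" "slope p < 1" by (auto simp: slope_def)
  have "2 * (1 - 2 * p) \<le> ln (1 + (1 - 2 * p)) - ln (1 - (1 - 2 * p))"
    using assms by (intro ln_ratio_ge) auto
  also have "\<dots> = ln ((2 * (1 - p)) / (2 * p))"
    using assms by (subst ln_div) auto
  also have "(2 * (1 - p)) / (2 * p) = (1 - p) / p" using assms by (simp add: field_simps)
  also have "ln ((1 - p) / p) = slope p * ln 2" by (simp add: slope_def log_def)
  finally show "2 * (1 - 2 * p) \<le> slope p * ln 2" .
qed

text \<open>The cross entropy is affine in \<open>s\<close>: it is the tangent line of
  \<open>h2\<close> at \<open>p\<close>.\<close>

lemma cross_entropy_slope:
  assumes "0 < p" "p < 1"
  shows "- s * log 2 p - (1 - s) * log 2 (1 - p) = h2 p + slope p * (s - p)"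
  using assms by (simp add: h2_def slope_def log_divide algebra_simps)

text \<open>The divergence is bounded below by its tangent at \<open>s = 3/10\<close>.\<close>
lemma divergence_bound:
  assumes p: "1/3 < p" "p < 1/2" and s: "0 \<le> s" "s \<le> 1"
  defines "e \<equiv> 1 - 2 * p"
  defines "D \<equiv> - s * log 2 p - (1 - s) * log 2 (1 - p) - h2 s"
  shows "(25/72 - e) * 4 / (1 + e)\<^sup>2 * (1 - s)\<^sup>2 \<le> 1 - s + D"
proof -
  define x where "x = 1 - s"
  have x: "0 \<le> x" "x \<le> 1" and e: "0 < e" "e < 1/3" using s p by (auto simp: x_def e_def)
  have D0: "0 \<le> D" using h2_le_cross[of p s] p s by (simp add: D_def)
  \<comment> \<open>7/5 rounds up 4 * (25/72), and the denominator \<open>(1 + e)\<^sup>2\<close> is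
    at least 1. It remains to show \<open>K * x\<^sup>2 \<le> x + D\<close>.\<close>
  define K where "K = max 0 (7/5 - 4 * e)"
  have "(25/72 - e) * 4 / (1 + e)\<^sup>2 \<le> K"
  proof (cases "25/72 - e \<le> 0")
    case True
    then have "(25/72 - e) * 4 / (1 + e)\<^sup>2 \<le> 0" by (intro divide_nonpos_nonneg) auto
    then show ?thesis by (simp add: K_def)
  next
    case False
    have "1 \<le> (1 + e)\<^sup>2" using e by (intro one_le_power) auto
    then have "(25/72 - e) * 4 / (1 + e)\<^sup>2 \<le> (25/72 - e) * 4 / 1"
      using False by (intro divide_left_mono) auto
    then show ?thesis by (simp add: K_def)
  qed
  then have K: "(25/72 - e) * 4 / (1 + e)\<^sup>2 * x\<^sup>2 \<le> K * x\<^sup>2" by (rule mult_right_mono) simp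
  \<comment> \<open>In the tangent at 3/10 the coefficient of \<open>s\<close> is at least -1
    because p < 3/5. The coefficient of \<open>x\<close> is at least \<open>K - 1\<close>: use
    (7/5)^5 > 4 for the logarithm of 7/5 and ln 2 \<ge> 2/3 for that of 1 + e. Together they give
    \<open>K * x - 1 \<le> D\<close>.\<close>
  have "log 2 (3/10) - log 2 p = log 2 ((3/10) / p)" using p by (simp add: log_divide log_mult)
  also have "\<dots> \<ge> log 2 (1/2)" using p by (subst log_le_cancel_iff) (auto simp: field_simps)
  finally have l0: "-1 \<le> log 2 (3/10) - log 2 p" by (simp add: log_divide)
  have "2 * log 2 2 \<le> 5 * log 2 (7/5 :: real)"
  proof -
    have "log 2 (2 ^ 2) \<le> log 2 ((7/5 :: real) ^ 5)" by (subst log_le_cancel_iff) (auto simp: eval_nat_numeral)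
    then show ?thesis by (simp only: log_nat_power of_nat_numeral)
  qed
  then have l1: "2/5 \<le> log 2 (7/5 :: real)" by simp
  have "ln (1 + e) \<le> e" using e by (intro ln_add_one_self_le_self) auto
  also have "e \<le> 3/2 * e * ln 2" using mult_left_mono[OF ln2_ge_two_thirds, of "3/2 * e"] e by simp
  finally have l2: "log 2 (1 + e) \<le> 3/2 * e" by (simp add: log_def divide_le_eq)
  have "(7/10) / (1 - p) = (7/5) / (1 + e)" using p by (simp add: e_def field_simps)
  moreover have "log 2 (7/10) - log 2 (1 - p) = log 2 ((7/10) / (1 - p))" using p by (intro log_divide_pos[symmetric]) auto
  ultimately have "log 2 (7/10) - log 2 (1 - p) = log 2 ((7/5) / (1 + e))" by (simp only:)
  also have "\<dots> = log 2 (7/5) - log 2 (1 + e)" using e by (intro log_divide_pos) auto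
  finally have l3: "K - 1 \<le> log 2 (7/10) - log 2 (1 - p)" using l1 l2 e by (simp add: K_def)
  have "h2 s \<le> - s * log 2 (3/10) - (1 - s) * log 2 (7/10)"
    using h2_le_cross[of "3/10" s] s by simp
  then have "s * (log 2 (3/10) - log 2 p) + x * (log 2 (7/10) - log 2 (1 - p)) \<le> D"
    by (simp add: D_def x_def algebra_simps)
  moreover have "s * (-1) \<le> s * (log 2 (3/10) - log 2 p)" using l0 s by (intro mult_left_mono) auto
  moreover have "x * (K - 1) \<le> x * (log 2 (7/10) - log 2 (1 - p))" using l3 x by (intro mult_left_mono) auto
  ultimately have D1: "K * x - 1 \<le> D" by (simp add: x_def algebra_simps)
  have "(K * x - 1) * x \<le> D"
  proof (cases "K * x - 1 \<le> 0")
    case True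
    then have "(K * x - 1) * x \<le> 0" using x by (intro mult_nonpos_nonneg)
    then show ?thesis using D0 by simp
  next
    case False
    then have "(K * x - 1) * x \<le> (K * x - 1) * 1" using x by (intro mult_left_mono) auto
    then show ?thesis using D1 by simp
  qed
  then have "K * x\<^sup>2 \<le> x + D" by (simp add: power2_eq_square algebra_simps)
  with K show ?thesis by (simp add: x_def)
qed

definition ent3 :: "real \<Rightarrow> real \<Rightarrow> real \<Rightarrow> real" where
  "ent3 a s d = - a * log 2 a - s * log 2 s - d * log 2 d"

text \<open>Grouping: first decide whether the middle symbol occurs, then which of the outer two.
  For \<open>s = 1\<close> the quotient takes the default value 0, but then the factor
  \<open>1 - s\<close> is 0.\<close>

lemma ent3_split:
  assumes "0 \<le> a" "0 \<le> d" "a + s + d = 1"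
  shows "ent3 a s d = h2 s + (1 - s) * h2 ((1 + (a - d) / (1 - s)) / 2)"
proof (cases "s = 1")
  case True
  then have "a = 0" "d = 0" using assms by auto
  then show ?thesis using True by (simp add: ent3_def h2_def)
next
  case False
  define x where "x = 1 - s"
  have x: "x > 0" "x = a + d" using False assms by (auto simp: x_def)
  have e: "(1 + (a - d) / x) / 2 = a / x" "1 - a / x = d / x" using x by (auto simp: field_simps)
  have l: "y * log 2 (y / x) = y * log 2 y - y * log 2 x" if "0 \<le> y" for y
    using that x(1) by (cases "y = 0") (auto simp: log_divide algebra_simps)
  have "x * h2 (a / x) = - a * log 2 (a / x) - d * log 2 (d / x)"
    using x(1) by (simp add: h2_def e(2) algebra_simps)
  also have "\<dots> = - a * log 2 a - d * log 2 d + x * log 2 x"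
    using l[of a] l[of d] assms by (simp add: x(2) algebra_simps)
  finally show ?thesis unfolding x_def[symmetric] e
    by (simp add: ent3_def h2_def x_def)
qed

text \<open>After grouping and the tangent formula, the terms in \<open>h2 p\<close> cancel and the
  claim becomes \<open>(1 - \<nu>) * h2gap (m * \<tau>) \<le> \<nu> * (x * G + D)\<close>, with D
  the divergence of \<open>s\<close> from \<open>p\<close>. \<open>h2gap_scale\<close> extracts the
  factor G on the left, and D \<ge> D * G on the right. What is left is
  \<open>(1 - \<nu>) * m\<^sup>2 \<le> \<nu> * (x + D)\<close>, free of \<tau>, and this is where
  \<open>divergence_bound\<close> enters.\<close>

lemma adder_single_letter:
  fixes \<alpha> p a s d \<beta> :: real
  assumes \<alpha>: "0 < \<alpha>" "\<alpha> < 1/2" and p_def: "p = 2 * \<alpha> * (1 - \<alpha>)" and p: "1/3 < p" "p < 1/2"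
    and \<beta>_def: "\<beta> = \<alpha>\<^sup>2 / (1 - p)"
    and asd: "0 \<le> a" "0 \<le> s" "0 \<le> d" "a + s + d = 1"
  shows "slope p * ent3 a s d - (1 - slope p) * h2 (a * (1 - \<beta>) + s / 2 + d * \<beta>)
    + (1 - slope p) * (- s * log 2 p - (1 - s) * log 2 (1 - p)) \<le> adder_rate p"
proof -
  define \<nu> where "\<nu> = slope p"
  define x where "x = 1 - s"
  define \<tau> where "\<tau> = (a - d) / x"
  \<comment> \<open>\<tau> is the bias between the outer symbols. The test channel shrinks it by
    \<open>1 - 2 * \<beta>\<close> and turns the middle symbol into a fair bit, so its output has
    bias \<open>m * \<tau>\<close>.\<close>
  define m where "m = (1 - 2 * \<beta>) * x"
  define e where "e = 1 - 2 * p"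
  have \<nu>: "0 < \<nu>" "\<nu> < 1" "2 * e \<le> \<nu> * ln 2" using slope_bounds[OF p] by (auto simp: \<nu>_def e_def)
  have x: "0 \<le> x" "x \<le> 1" "x = a + d" using asd by (auto simp: x_def)
  have \<tau>: "\<bar>\<tau>\<bar> \<le> 1" using asd x
    by (cases "x = 0") (auto simp: \<tau>_def abs_le_iff field_simps)
  have q: "1 - p = \<alpha>\<^sup>2 + (1 - \<alpha>)\<^sup>2" "e = (1 - 2 * \<alpha>)\<^sup>2" by (simp_all add: p_def e_def power2_eq_square algebra_simps)
  have b: "1 - 2 * \<beta> = (1 - 2 * \<alpha>) / (1 - p)" using p by (simp add: \<beta>_def field_simps) (simp add: p_def power2_eq_square algebra_simps)
  have "1 - 2 * \<alpha> \<le> 1 - p" using \<alpha> by (simp add: p_def algebra_simps)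
  then have b01: "0 \<le> 1 - 2 * \<beta>" "1 - 2 * \<beta> \<le> 1" using p \<alpha> by (auto simp: b)
  then have m: "0 \<le> m" "m \<le> 1" using x by (auto simp: m_def intro: mult_le_one)
  have u: "a * (1 - \<beta>) + s / 2 + d * \<beta> = (1 + m * \<tau>) / 2"
  proof (cases "x = 0")
    case True
    then have "a = 0" "d = 0" using asd x by auto
    then show ?thesis using True asd by (simp add: m_def)
  next
    case False
    then have "m * \<tau> = (1 - 2 * \<beta>) * (a - d)" by (simp add: m_def \<tau>_def)
    moreover have "s = 1 - a - d" using asd by simp
    ultimately show ?thesis by (simp add: algebra_simps) 
  qed
  define G where "G = h2gap \<tau>"
  have G: "0 \<le> G" "G \<le> 1" using h2gap_bounds[OF \<tau>] by (auto simp: G_def)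
  have gm: "h2gap (m * \<tau>) \<le> m\<^sup>2 * G" using h2gap_scale[OF m \<tau>] by (simp add: G_def)
  define D where "D = - s * log 2 p - (1 - s) * log 2 (1 - p) - h2 s"
  have D0: "0 \<le> D" using h2_le_cross[of p s] p asd by (simp add: D_def)
  \<comment> \<open>25/72 is half of the upper bound 25/36 for ln 2: the tangent bound
    \<open>2 * e \<le> \<nu> * ln 2\<close> turns into a linear relation between e and \<nu>. It
    matters because \<open>m\<^sup>2\<close> is proportional to e.\<close>
  have "\<nu> * ln 2 \<le> \<nu> * (25/36)" using \<nu>(1) ln2_le_25_over_36 by (intro mult_left_mono) auto
  then have "e \<le> \<nu> * (25/72)" using \<nu>(3) by linarith
  then have "(1 - \<nu>) * e \<le> \<nu> * (25/72 - e)" by (simp add: algebra_simps)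
  then have "(1 - \<nu>) * e * (4 / (1 + e)\<^sup>2 * x\<^sup>2) \<le> \<nu> * (25/72 - e) * (4 / (1 + e)\<^sup>2 * x\<^sup>2)"
    by (rule mult_right_mono) simp
  also have "\<dots> = \<nu> * ((25/72 - e) * 4 / (1 + e)\<^sup>2 * x\<^sup>2)" by simp
  also have "\<dots> \<le> \<nu> * (x + D)"
    using divergence_bound[OF p, of s] asd \<nu> by (intro mult_left_mono) (auto simp: x_def D_def e_def)
  finally have "(1 - \<nu>) * (e * (4 / (1 + e)\<^sup>2 * x\<^sup>2)) \<le> \<nu> * (x + D)" by (simp add: mult.assoc)
  moreover have "m\<^sup>2 = e * (4 / (1 + e)\<^sup>2 * x\<^sup>2)"
  proof -
    have "(1 + e)\<^sup>2 = 4 * (1 - p)\<^sup>2" by (simp add: e_def power2_eq_square algebra_simps)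
    then have "4 / (1 + e)\<^sup>2 = 1 / (1 - p)\<^sup>2" by simp
    then show ?thesis unfolding m_def b by (simp add: q(2) power_mult_distrib power_divide)
  qed
  ultimately have "(1 - \<nu>) * m\<^sup>2 \<le> \<nu> * (x + D)" by simp
  then have "(1 - \<nu>) * m\<^sup>2 * G \<le> \<nu> * (x + D) * G" using G by (intro mult_right_mono)
  also have "\<dots> = \<nu> * x * G + \<nu> * D * G" by (simp add: algebra_simps)
  also have "\<nu> * D * G \<le> \<nu> * D * 1" using G D0 \<nu> by (intro mult_left_mono) auto
  finally have "(1 - \<nu>) * (m\<^sup>2 * G) \<le> \<nu> * (x * G + D)" by (simp add: algebra_simps)
  moreover have "(1 - \<nu>) * h2gap (m * \<tau>) \<le> (1 - \<nu>) * (m\<^sup>2 * G)" using gm \<nu> by (intro mult_left_mono) auto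
  ultimately have main: "(1 - \<nu>) * h2gap (m * \<tau>) \<le> \<nu> * (x * G + D)" by linarith
  have CE: "- s * log 2 p - (1 - s) * log 2 (1 - p) = h2 p + \<nu> * (s - p)"
    using cross_entropy_slope[of p s] p by (simp add: \<nu>_def)
  have h3: "ent3 a s d = h2 s + x * (1 - G)"
    using ent3_split[of a d s] asd by (simp add: x_def \<tau>_def G_def h2gap_def)
  have "\<nu> * (h2 s + x * (1 - G)) - (1 - \<nu>) * (1 - h2gap (m * \<tau>)) + (1 - \<nu>) * (h2 p + \<nu> * (s - p))
     \<le> \<nu> * (h2 p + 1 - p) + (1 - \<nu>) * (h2 p - 1)"
    using main unfolding D_def CE by (simp add: x_def algebra_simps)
  then show ?thesis unfolding CE h3 u adder_rate_def \<nu>_def[symmetric]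
    by (simp add: h2gap_def)
qed

section \<open>The test channel\<close>

text \<open>Cross entropies relative to \<open>W1\<close> and \<open>W2\<close> bound the two
  conditional entropies given a single input, whereas the one given both inputs is exact. By the
  product form of \<open>K\<close> the logarithms of \<open>W1\<close> and \<open>W2\<close> cancel,
  leaving that of \<open>q\<close>. It is kept separate from its consequence for I(X1;X2) because
  the last term of the upper bound contains exactly these three entropies.\<close>

lemma double_broadcast_bound:
  fixes K :: "'x1 \<Rightarrow> 'x2 \<Rightarrow> 't pmf" and W1 :: "'x1 \<Rightarrow> 't pmf" and W2 :: "'x2 \<Rightarrow> 't pmf"
    and X1 :: "'a \<Rightarrow> 'x1" and X2 :: "'a \<Rightarrow> 'x2" and Q :: "'a \<Rightarrow> 'q"
  assumes finP: "finite (set_pmf P)"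
    and finK: "\<And>x. x \<in> set_pmf P \<Longrightarrow> finite (set_pmf (K (X1 x) (X2 x)))"
    and q0: "\<And>x. x \<in> set_pmf P \<Longrightarrow> 0 < q (X1 x) (X2 x)"
    and K: "\<And>x t. x \<in> set_pmf P \<Longrightarrow>
       pmf (K (X1 x) (X2 x)) t = pmf (W1 (X1 x)) t * pmf (W2 (X2 x)) t / q (X1 x) (X2 x)"
  defines "J \<equiv> attach P (\<lambda>x. K (X1 x) (X2 x))"
  shows "ent J (\<lambda>w. (snd w, X1 (fst w), Q (fst w))) - ent P (\<lambda>x. (X1 x, Q x))
      + (ent J (\<lambda>w. (snd w, X2 (fst w), Q (fst w))) - ent P (\<lambda>x. (X2 x, Q x)))
      - (ent J (\<lambda>w. (snd w, X1 (fst w), X2 (fst w), Q (fst w))) - ent P (\<lambda>x. (X1 x, X2 x, Q x)))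
      \<le> wsum P (\<lambda>x. - log 2 (q (X1 x) (X2 x)))"
proof -
  have fin: "finite (set_pmf J)" unfolding J_def using finP finK by (rule finite_attach)
  have pos: "0 < pmf (W1 (X1 (fst w))) (snd w)" "0 < pmf (W2 (X2 (fst w))) (snd w)" "0 < q (X1 (fst w)) (X2 (fst w))"
    if "w \<in> set_pmf J" for w
  proof -
    have w: "fst w \<in> set_pmf P" "snd w \<in> set_pmf (K (X1 (fst w)) (X2 (fst w)))"
      using that by (auto simp: J_def set_attach)
    have "0 < pmf (K (X1 (fst w)) (X2 (fst w))) (snd w)" using w by (simp add: pmf_positive)
    then have "pmf (W1 (X1 (fst w))) (snd w) \<noteq> 0" "pmf (W2 (X2 (fst w))) (snd w) \<noteq> 0"
      using K[OF w(1)] by auto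
    then show "0 < pmf (W1 (X1 (fst w))) (snd w)" "0 < pmf (W2 (X2 (fst w))) (snd w)"
      by (simp_all add: pmf_pos)
    show "0 < q (X1 (fst w)) (X2 (fst w))" using q0 w by simp
  qed
  have s1: "(\<Sum>t\<in>snd ` set_pmf J. pmf M t) \<le> 1" for M :: "'t pmf"
    using fin by (subst measure_measure_pmf_finite[symmetric]) (auto simp: measure_pmf.prob_le_1)
  have "ent J (\<lambda>w. (snd w, X1 (fst w), Q (fst w))) - ent J (\<lambda>w. (X1 (fst w), Q (fst w)))
     \<le> wsum J (\<lambda>w. - log 2 (pmf (W1 (fst (X1 (fst w), Q (fst w)))) (snd w)))"
    by (rule cond_ent_le_cross[OF fin, of "\<lambda>c. pmf (W1 (fst c))"]) (auto simp: s1 dest: pos)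
  moreover have "ent J (\<lambda>w. (snd w, X2 (fst w), Q (fst w))) - ent J (\<lambda>w. (X2 (fst w), Q (fst w)))
     \<le> wsum J (\<lambda>w. - log 2 (pmf (W2 (fst (X2 (fst w), Q (fst w)))) (snd w)))"
    by (rule cond_ent_le_cross[OF fin, of "\<lambda>c. pmf (W2 (fst c))"]) (auto simp: s1 dest: pos)
  moreover have "ent J (\<lambda>w. (snd w, X1 (fst w), X2 (fst w), Q (fst w))) = ent P (\<lambda>x. (X1 x, X2 x, Q x))
     + wsum J (\<lambda>w. - log 2 (pmf (K (X1 (fst w)) (X2 (fst w))) (snd w)))"
    using ent_attach[of P "\<lambda>x. K (X1 x) (X2 x)" "\<lambda>t. t" "\<lambda>(x1, x2, _). K x1 x2" "\<lambda>x. (X1 x, X2 x, Q x)"] fin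
    by (simp add: J_def)
  moreover have "wsum J (\<lambda>w. - log 2 (pmf (K (X1 (fst w)) (X2 (fst w))) (snd w)))
    = wsum J (\<lambda>w. - log 2 (pmf (W1 (X1 (fst w))) (snd w)) + - log 2 (pmf (W2 (X2 (fst w))) (snd w))
        - - log 2 (q (X1 (fst w)) (X2 (fst w))))"
  proof (rule wsum_cong)
    fix w assume w: "w \<in> set_pmf J"
    then have "fst w \<in> set_pmf P" by (auto simp: J_def set_attach)
    then show "- log 2 (pmf (K (X1 (fst w)) (X2 (fst w))) (snd w)) = - log 2 (pmf (W1 (X1 (fst w))) (snd w))
      + - log 2 (pmf (W2 (X2 (fst w))) (snd w)) - - log 2 (q (X1 (fst w)) (X2 (fst w)))"
      using pos[OF w] by (simp add: K log_divide log_mult)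
  qed
  moreover have "wsum J (\<lambda>w. - log 2 (q (X1 (fst w)) (X2 (fst w)))) = wsum P (\<lambda>x. - log 2 (q (X1 x) (X2 x)))"
    using fin unfolding J_def by (rule wsum_attach_fst)
  moreover have "ent J (\<lambda>w. (X1 (fst w), Q (fst w))) = ent P (\<lambda>x. (X1 x, Q x))"
    "ent J (\<lambda>w. (X2 (fst w), Q (fst w))) = ent P (\<lambda>x. (X2 x, Q x))"
    unfolding J_def by (rule ent_attach_fst)+
  ultimately show ?thesis by (simp only: wsum_add wsum_diff fst_conv)
qed

text \<open>I(X1;X2|Q) exceeds H(T|Q) minus the left-hand side of
  \<open>double_broadcast_bound\<close> by I(X1;X2|T,Q), which is nonnegative.\<close>

lemma cmi_ge_test_channel:
  fixes K :: "'x1 \<Rightarrow> 'x2 \<Rightarrow> 't pmf" and W1 :: "'x1 \<Rightarrow> 't pmf" and W2 :: "'x2 \<Rightarrow> 't pmf"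
    and X1 :: "'a \<Rightarrow> 'x1" and X2 :: "'a \<Rightarrow> 'x2" and Q :: "'a \<Rightarrow> 'q"
  assumes finP: "finite (set_pmf P)"
    and finK: "\<And>x. x \<in> set_pmf P \<Longrightarrow> finite (set_pmf (K (X1 x) (X2 x)))"
    and q0: "\<And>x. x \<in> set_pmf P \<Longrightarrow> 0 < q (X1 x) (X2 x)"
    and K: "\<And>x t. x \<in> set_pmf P \<Longrightarrow>
       pmf (K (X1 x) (X2 x)) t = pmf (W1 (X1 x)) t * pmf (W2 (X2 x)) t / q (X1 x) (X2 x)"
  defines "J \<equiv> attach P (\<lambda>x. K (X1 x) (X2 x))"
  shows "ent J (\<lambda>w. (snd w, Q (fst w))) - ent P Q - wsum P (\<lambda>x. - log 2 (q (X1 x) (X2 x))) \<le> cmi P X1 X2 Q"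
proof -
  have fin: "finite (set_pmf J)" unfolding J_def using finP finK by (rule finite_attach)
  have "ent J (\<lambda>w. (X1 (fst w), X2 (fst w), (snd w, Q (fst w)))) + ent J (\<lambda>w. (snd w, Q (fst w)))
    \<le> ent J (\<lambda>w. (X1 (fst w), (snd w, Q (fst w)))) + ent J (\<lambda>w. (X2 (fst w), (snd w, Q (fst w))))"
    by (rule ent_submodular[OF fin])
  moreover have "ent J (\<lambda>w. (X1 (fst w), X2 (fst w), (snd w, Q (fst w)))) = ent J (\<lambda>w. (snd w, X1 (fst w), X2 (fst w), Q (fst w)))"
    "ent J (\<lambda>w. (X1 (fst w), (snd w, Q (fst w)))) = ent J (\<lambda>w. (snd w, X1 (fst w), Q (fst w)))"
    "ent J (\<lambda>w. (X2 (fst w), (snd w, Q (fst w)))) = ent J (\<lambda>w. (snd w, X2 (fst w), Q (fst w)))"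
    by (rule ent_eqI[OF fin]; auto)+
  moreover note double_broadcast_bound[of P K X1 X2 q W1 W2 Q, OF finP finK q0 K]
  ultimately show ?thesis unfolding J_def[symmetric] by (simp add: cmi_def)
qed

section \<open>Memoryless extensions and the test channel of the adder\<close>

fun plift :: "('a \<Rightarrow> 'b pmf) \<Rightarrow> 'a list \<Rightarrow> 'b list pmf" where
  "plift K [] = return_pmf []"
| "plift K (x # xs) = map_pmf (\<lambda>(y, ys). y # ys) (pair_pmf (K x) (plift K xs))"

lemma finite_plift: "(\<And>x. x \<in> set xs \<Longrightarrow> finite (set_pmf (K x))) \<Longrightarrow> finite (set_pmf (plift K xs))"
  by (induction xs) auto

lemma pmf_plift_Nil: "pmf (plift K (x # xs)) [] = 0"
  by (auto simp: pmf_eq_0_set_pmf)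

lemma pmf_plift_Cons: "pmf (plift K (x # xs)) (y # ys) = pmf (K x) y * pmf (plift K xs) ys"
proof -
  have inj: "inj (\<lambda>(y, ys). y # ys)" by (auto simp: inj_def)
  show ?thesis using pmf_map_inj'[OF inj, of "pair_pmf (K x) (plift K xs)" "(y, ys)"] by (simp add: pmf_pair)
qed

locale adder_test_channel =
  fixes \<alpha> p \<beta> :: real
  assumes \<alpha>: "0 < \<alpha>" "\<alpha> < 1/2" and p_eq: "p = 2 * \<alpha> * (1 - \<alpha>)" and p: "1/3 < p" "p < 1/2"
    and \<beta>_eq: "\<beta> = \<alpha>\<^sup>2 / (1 - p)"
begin

text \<open>The doubly symmetric source with crossover probability \<open>p\<close> is a cascade of two binary symmetric
  channels with crossover probability \<open>\<alpha>\<close> fed by a uniform bit. \<open>chan\<close> is the posterior law of that bit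
  given the adder output, so that it makes the two inputs conditionally independent.\<close>

definition bsc :: "bool \<Rightarrow> bool pmf" where
  "bsc x = bernoulli_pmf (if x then 1 - \<alpha> else \<alpha>)"

definition chan :: "nat \<Rightarrow> bool pmf" where
  "chan y = bernoulli_pmf (if y = 0 then \<beta> else if y = 1 then 1/2 else 1 - \<beta>)"

text \<open>The conditional probability of one input given the other under the doubly symmetric
  source, as a function of the adder output. It serves as the normalising factor \<open>q\<close> of
  \<open>double_broadcast_bound\<close>.\<close>

definition wt :: "nat \<Rightarrow> real" where
  "wt y = (if y = 1 then p else 1 - p)"

text \<open>Since 1 - p is the sum of the squares of \<alpha> and 1 - \<alpha>, the numbers \<beta>
  and 1 - \<beta> are the two posterior probabilities of the uniform bit after two agreeing
  observations.\<close>

lemma \<beta>_bounds: "0 < \<beta>" "\<beta> < 1" "1 - \<beta> = (1 - \<alpha>)\<^sup>2 / (1 - p)"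
proof -
  have q: "1 - p = \<alpha>\<^sup>2 + (1 - \<alpha>)\<^sup>2" by (simp add: p_eq power2_eq_square algebra_simps)
  show "0 < \<beta>" using \<alpha> p by (simp add: \<beta>_eq)
  show e: "1 - \<beta> = (1 - \<alpha>)\<^sup>2 / (1 - p)" using p by (simp add: \<beta>_eq q field_simps)
  have "0 < (1 - \<alpha>)\<^sup>2 / (1 - p)" using \<alpha> p by simp
  then show "\<beta> < 1" using e by linarith
qed

lemma wt_pos: "0 < wt y" using p by (simp add: wt_def)

lemma finite_chan: "finite (set_pmf (chan y))" by simp

text \<open>Bayes' rule: the uniform prior cancels against the factor 1/2 by which the input
  probabilities differ from \<open>wt\<close>.\<close>

lemma chan_factor: "pmf (chan (adder x1 x2)) t = pmf (bsc x1) t * pmf (bsc x2) t / wt (adder x1 x2)"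
proof -
  have f: "\<alpha> * \<alpha> / (1 - p) = \<beta>" "(1 - \<alpha>) * (1 - \<alpha>) / (1 - p) = 1 - \<beta>"
    using \<beta>_bounds(3) by (simp_all add: \<beta>_eq power2_eq_square)
  have g: "\<alpha> * (1 - \<alpha>) / p = 1/2" "(1 - \<alpha>) * \<alpha> / p = 1/2"
    using \<alpha> by (auto simp: p_eq)
  show ?thesis
    using \<alpha> p \<beta>_bounds(1,2)
    by (cases x1; cases x2; cases t) (simp_all add: chan_def bsc_def wt_def adder_def f g)
qed

lemma plift_chan_factor:
  "length x1 = length x2 \<Longrightarrow> pmf (plift chan (map2 adder x1 x2)) ts
    = pmf (plift bsc x1) ts * pmf (plift bsc x2) ts / prod_list (map wt (map2 adder x1 x2))"
proof (induction x1 x2 arbitrary: ts rule: list_induct2)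
  case (Cons a as b bs)
  then show ?case
    by (cases ts) (auto simp: pmf_plift_Nil pmf_plift_Cons chan_factor simp del: plift.simps)
next
  case Nil
  show ?case by (cases ts) auto
qed

text \<open>The single letter inequality averaged over the fibres of \<open>Q\<close>, each with its
  own law of the output. An arbitrary \<open>Q\<close> is allowed since it will be the tail of the
  channel output during tensorization and the auxiliary variable in the lower and upper
  bounds.\<close>

lemma adder_cond_bound:
  assumes finP: "finite (set_pmf P)" and Y: "\<And>x. x \<in> set_pmf P \<Longrightarrow> Y x \<in> {0, 1, 2}"
  shows "slope p * (ent P (\<lambda>x. (Y x, Q x)) - ent P Q)
     - (1 - slope p) * (ent (attach P (\<lambda>x. chan (Y x))) (\<lambda>w. (snd w, Q (fst w))) - ent P Q)
     + (1 - slope p) * wsum P (\<lambda>x. - log 2 (wt (Y x))) \<le> adder_rate p"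
proof -
  let ?S = "set_pmf P"
  define J where "J = attach P (\<lambda>x. chan (Y x))"
  have fin: "finite (set_pmf J)" unfolding J_def by (rule finite_attach[OF finP finite_chan])
  define pq where "pq = pmf (map_pmf Q P)"
  define pyq where "pyq y q = pmf (map_pmf (\<lambda>x. (Y x, Q x)) P) (y, q)" for y q
  define ptq where "ptq t q = pmf (map_pmf (\<lambda>w. (snd w, Q (fst w))) J) (t, q)" for t q
  have pq: "0 < pq q" if "q \<in> Q ` ?S" for q using that by (auto simp: pq_def intro: pmf_map_pos)
  have QJ: "(\<lambda>w. Q (fst w)) ` set_pmf J = Q ` ?S"
  proof -
    have "(\<lambda>w. Q (fst w)) ` set_pmf J = Q ` (set_pmf (map_pmf fst J))" by (simp add: image_image)
    then show ?thesis by (simp add: J_def map_fst_attach)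
  qed
  have mapQ: "map_pmf (\<lambda>w. Q (fst w)) J = map_pmf Q P"
    using pmf.map_comp[of Q fst J] by (simp add: J_def map_fst_attach o_def)
  have sum_pyq: "pyq 0 q + pyq 1 q + pyq 2 q = pq q" for q
    using pmf_marginal[OF finP, of "{0,1,2}" Y Q q, OF _ image_subsetI[OF Y]] by (simp add: pyq_def pq_def)
  have sum_ptq: "ptq False q + ptq True q = pq q" for q
    using pmf_marginal[OF fin, of UNIV snd "\<lambda>w. Q (fst w)" q, OF _ subset_UNIV] by (simp add: UNIV_bool ptq_def pq_def mapQ)
  have ptq: "ptq False q = (1 - \<beta>) * pyq 0 q + 1/2 * pyq 1 q + \<beta> * pyq 2 q" for q
  proof -
    have "ptq False q = (\<Sum>y\<in>{0,1,2}. pmf (map_pmf (\<lambda>w. (Y (fst w), snd w, Q (fst w))) J) (y, False, q))"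
      unfolding ptq_def
      by (rule pmf_marginal[OF fin, symmetric]) (use Y in \<open>fastforce simp: J_def set_attach\<close>)+
    also have "\<dots> = (\<Sum>y\<in>{0,1,2}. pmf (map_pmf (\<lambda>w. (snd w, Y (fst w), Q (fst w))) J) (False, y, q))"
      by (rule sum.cong[OF refl], unfold pmf_map_sum[OF fin], rule sum.cong) auto
    also have "\<dots> = (\<Sum>y\<in>{0,1,2}. pyq y q * pmf (chan y) False)"
      unfolding J_def pyq_def
      using pmf_attach[of P "\<lambda>t. t" "\<lambda>x. chan (Y x)" "\<lambda>(y, q). chan y" "\<lambda>x. (Y x, Q x)" False] by simp
    also have "\<dots> = (1 - \<beta>) * pyq 0 q + 1/2 * pyq 1 q + \<beta> * pyq 2 q"
      using \<beta>_bounds(1,2) by (simp add: chan_def)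
    finally show ?thesis .
  qed
  have e1: "ent P (\<lambda>x. (Y x, Q x)) - ent P Q = (\<Sum>q\<in>Q ` ?S. pq q * ent3 (pyq 0 q / pq q) (pyq 1 q / pq q) (pyq 2 q / pq q))"
    unfolding cond_ent_eq[OF finP] pq_def[symmetric]
  proof (rule sum.cong[OF refl])
    fix q assume q: "q \<in> Q ` ?S"
    have "ent (cond_pmf P (Q -` {q})) Y = ent3 (pyq 0 q / pq q) (pyq 1 q / pq q) (pyq 2 q / pq q)"
      by (subst ent_cong_set[of "{0,1,2}"])
        (use Y in \<open>fastforce simp: set_cond_fiber[OF q] pmf_map_cond[OF finP q] ent3_def pyq_def pq_def\<close>)+
    then show "pq q * ent (cond_pmf P (Q -` {q})) Y = pq q * ent3 (pyq 0 q / pq q) (pyq 1 q / pq q) (pyq 2 q / pq q)" by simp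
  qed
  have e2: "ent J (\<lambda>w. (snd w, Q (fst w))) - ent P Q = (\<Sum>q\<in>Q ` ?S. pq q * h2 (ptq False q / pq q))"
  proof -
    have "ent P Q = ent J (\<lambda>w. Q (fst w))" unfolding J_def by (rule ent_attach_fst[symmetric])
    then have "ent J (\<lambda>w. (snd w, Q (fst w))) - ent P Q = (\<Sum>q\<in>Q ` ?S. pq q * ent (cond_pmf J ((\<lambda>w. Q (fst w)) -` {q})) snd)"
      using cond_ent_eq[OF fin, of snd "\<lambda>w. Q (fst w)"] by (simp add: QJ mapQ pq_def)
    also have "\<dots> = (\<Sum>q\<in>Q ` ?S. pq q * h2 (ptq False q / pq q))"
    proof (rule sum.cong[OF refl])
      fix q assume q: "q \<in> Q ` ?S"
      have q': "q \<in> (\<lambda>w. Q (fst w)) ` set_pmf J" using q QJ by simp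
      have t: "ptq True q / pq q = 1 - ptq False q / pq q"
        using sum_ptq[of q] pq[OF q] by (simp add: field_simps)
      have "ent (cond_pmf J ((\<lambda>w. Q (fst w)) -` {q})) snd = h2 (ptq False q / pq q)"
        unfolding h2_def t[symmetric]
        by (subst ent_cong_set[of UNIV])
          (auto simp: pmf_map_cond[OF fin q'] UNIV_bool ptq_def pq_def mapQ)
      then show "pq q * ent (cond_pmf J ((\<lambda>w. Q (fst w)) -` {q})) snd = pq q * h2 (ptq False q / pq q)" by simp
    qed
    finally show ?thesis .
  qed
  have e3: "wsum P (\<lambda>x. - log 2 (wt (Y x))) = (\<Sum>q\<in>Q ` ?S. pq q * (- (pyq 1 q / pq q) * log 2 p - (1 - pyq 1 q / pq q) * log 2 (1 - p)))"
    unfolding wsum_cond[OF finP, where Q = Q] pq_def[symmetric]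
  proof (rule sum.cong[OF refl])
    fix q assume q: "q \<in> Q ` ?S"
    have fin': "finite (set_pmf (cond_pmf P (Q -` {q})))" using finP by (simp add: set_cond_fiber[OF q])
    have t: "1 - pyq 1 q / pq q = pyq 0 q / pq q + pyq 2 q / pq q"
      using sum_pyq[of q] pq[OF q] by (simp add: field_simps)
    have "wsum (cond_pmf P (Q -` {q})) (\<lambda>x. - log 2 (wt (Y x))) = - (pyq 1 q / pq q) * log 2 p - (1 - pyq 1 q / pq q) * log 2 (1 - p)"
      unfolding t
      by (subst wsum_cong_set[OF fin', of "{0,1,2}" Y])
        (use Y in \<open>fastforce simp: set_cond_fiber[OF q] pmf_map_cond[OF finP q] pyq_def pq_def wt_def algebra_simps\<close>)+
    then show "pq q * wsum (cond_pmf P (Q -` {q})) (\<lambda>x. - log 2 (wt (Y x))) =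
      pq q * (- (pyq 1 q / pq q) * log 2 p - (1 - pyq 1 q / pq q) * log 2 (1 - p))" by simp
  qed
  have distr: "a * (q * x) - b * (q * y) + b * (q * z) = q * (a * x - b * y + b * z)" for a b q x y z :: real
    by (simp add: algebra_simps)
  have "slope p * (ent P (\<lambda>x. (Y x, Q x)) - ent P Q) - (1 - slope p) * (ent J (\<lambda>w. (snd w, Q (fst w))) - ent P Q)
     + (1 - slope p) * wsum P (\<lambda>x. - log 2 (wt (Y x)))
    = (\<Sum>q\<in>Q ` ?S. pq q * (slope p * ent3 (pyq 0 q / pq q) (pyq 1 q / pq q) (pyq 2 q / pq q)
       - (1 - slope p) * h2 (ptq False q / pq q)
       + (1 - slope p) * (- (pyq 1 q / pq q) * log 2 p - (1 - pyq 1 q / pq q) * log 2 (1 - p))))"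
    unfolding e1 e2 e3 sum_distrib_left sum_subtractf[symmetric] sum.distrib[symmetric]
    by (rule sum.cong[OF refl], rule distr)
  also have "\<dots> \<le> (\<Sum>q\<in>Q ` ?S. pq q * adder_rate p)"
  proof (rule sum_mono)
    fix q assume q: "q \<in> Q ` ?S"
    have u: "ptq False q / pq q = pyq 0 q / pq q * (1 - \<beta>) + pyq 1 q / pq q / 2 + pyq 2 q / pq q * \<beta>"
      unfolding ptq by (simp add: add_divide_distrib mult.commute)
    have "slope p * ent3 (pyq 0 q / pq q) (pyq 1 q / pq q) (pyq 2 q / pq q)
       - (1 - slope p) * h2 (ptq False q / pq q)
       + (1 - slope p) * (- (pyq 1 q / pq q) * log 2 p - (1 - pyq 1 q / pq q) * log 2 (1 - p)) \<le> adder_rate p"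
      unfolding u
    proof (rule adder_single_letter[OF \<alpha> p_eq p \<beta>_eq])
      show "pyq 0 q / pq q + pyq 1 q / pq q + pyq 2 q / pq q = 1"
        using sum_pyq[of q] pq[OF q] by (simp add: add_divide_distrib[symmetric])
    qed (simp_all add: pyq_def pq_def)
    then show "pq q * (slope p * ent3 (pyq 0 q / pq q) (pyq 1 q / pq q) (pyq 2 q / pq q)
       - (1 - slope p) * h2 (ptq False q / pq q)
       + (1 - slope p) * (- (pyq 1 q / pq q) * log 2 p - (1 - pyq 1 q / pq q) * log 2 (1 - p))) \<le> pq q * adder_rate p"
      by (rule mult_left_mono) (simp add: pq_def)
  qed
  also have "\<dots> = adder_rate p"
    using finP by (simp add: sum_distrib_right[symmetric] pq_def sum_pmf_eq_1)
  finally show ?thesis unfolding J_def .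
qed

text \<open>Tensorization: the first letter is conditioned on the tail of the test channel output.\<close>
lemma adder_block_bound:
  assumes "finite (set_pmf P)" and "\<And>ys. ys \<in> set_pmf P \<Longrightarrow> length ys = n \<and> set ys \<subseteq> {0, 1, 2}"
  shows "slope p * ent P (\<lambda>ys. ys) - (1 - slope p) * ent (attach P (plift chan)) snd
     + (1 - slope p) * wsum P (\<lambda>ys. - log 2 (prod_list (map wt ys))) \<le> real n * adder_rate p"
  using assms
proof (induction n arbitrary: P)
  case 0
  have fin: "finite (set_pmf (attach P (plift chan)))"
    by (rule finite_attach[OF 0(1)]) (simp add: finite_plift finite_chan)
  have Nil: "ys = []" if "ys \<in> set_pmf P" for ys using 0(2)[OF that] by simp
  have "ent P (\<lambda>ys. ys) = ent P (\<lambda>_. ())" by (rule ent_eqI[OF 0(1)]) (auto dest: Nil)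
  moreover have "ent (attach P (plift chan)) snd = ent (attach P (plift chan)) (\<lambda>_. ())"
    by (rule ent_eqI[OF fin]) (auto simp: set_attach dest!: Nil)
  moreover have "wsum P (\<lambda>ys. - log 2 (prod_list (map wt ys))) = wsum P (\<lambda>_. 0)"
    by (rule wsum_cong) (auto dest!: Nil)
  ultimately show ?case by (simp add: ent_const wsum_const[OF 0(1)])
next
  case (Suc n)
  note finP = Suc.prems(1)
  have cons: "ys = hd ys # tl ys" if "ys \<in> set_pmf P" for ys
    using Suc.prems(2)[OF that] by (cases ys) auto
  define P' where "P' = map_pmf tl P"
  \<comment> \<open>The channel outputs of the tail are drawn first and that of the head on top of
    them, so that in \<open>B\<close> they can act as the variable \<open>Q\<close> for the head
    letter.\<close>
  define B where "B = attach P (\<lambda>ys. plift chan (tl ys))"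
  define J where "J = attach B (\<lambda>w. chan (hd (fst w)))"
  have finB: "finite (set_pmf B)" unfolding B_def
    by (rule finite_attach[OF finP]) (simp add: finite_plift finite_chan)
  have finJ: "finite (set_pmf J)" unfolding J_def by (rule finite_attach[OF finB finite_chan])
  have IH: "slope p * ent P' (\<lambda>ys. ys) - (1 - slope p) * ent (attach P' (plift chan)) snd
     + (1 - slope p) * wsum P' (\<lambda>ys. - log 2 (prod_list (map wt ys))) \<le> real n * adder_rate p"
  proof (rule Suc.IH)
    show "finite (set_pmf P')" using finP by (simp add: P'_def)
    fix ys assume "ys \<in> set_pmf P'"
    then obtain zs where zs: "zs \<in> set_pmf P" "ys = tl zs" by (auto simp: P'_def)
    then show "length ys = n \<and> set ys \<subseteq> {0, 1, 2}"
      using Suc.prems(2)[OF zs(1)] by (cases zs) auto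
  qed
  have "attach P' (plift chan) = map_pmf (\<lambda>w. (tl (fst w), snd w)) B"
    by (simp add: B_def attach_def P'_def bind_map_pmf map_bind_pmf pmf.map_comp o_def)
  then have entJ': "ent (attach P' (plift chan)) snd = ent B snd" by (simp add: ent_map)
  have "attach P (plift chan) = map_pmf (\<lambda>w. (fst (fst w), snd w # snd (fst w))) J"
  proof -
    have "map_pmf (\<lambda>w. (fst (fst w), snd w # snd (fst w))) J
      = bind_pmf P (\<lambda>ys. bind_pmf (plift chan (tl ys)) (\<lambda>ts. map_pmf (\<lambda>t. (ys, t # ts)) (chan (hd ys))))"
      by (simp add: J_def B_def attach_def map_bind_pmf bind_assoc_pmf bind_map_pmf pmf.map_comp o_def)
    also have "\<dots> = bind_pmf P (\<lambda>ys. map_pmf (Pair ys) (plift chan ys))"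
    proof (rule bind_pmf_cong[OF refl])
      fix ys assume "ys \<in> set_pmf P"
      then have "plift chan ys = map_pmf (\<lambda>(y, ys). y # ys) (pair_pmf (chan (hd ys)) (plift chan (tl ys)))"
        using cons plift.simps(2) by metis
      then show "bind_pmf (plift chan (tl ys)) (\<lambda>ts. map_pmf (\<lambda>t. (ys, t # ts)) (chan (hd ys))) = map_pmf (Pair ys) (plift chan ys)"
        \<comment> \<open>\<open>plift\<close> draws the head output before those of the tail,
          \<open>J\<close> in the opposite order; the draws are independent and commute.\<close>
        by (subst bind_commute_pmf[of "chan (hd ys)" "plift chan (tl ys)" "\<lambda>t ts. return_pmf (ys, t # ts)", symmetric] |
            simp add: pair_pmf_def map_pmf_def bind_assoc_pmf bind_return_pmf)+
    qed
    finally show ?thesis by (simp add: attach_def)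
  qed
  then have "ent (attach P (plift chan)) snd = ent J (\<lambda>w. snd w # snd (fst w))" by (simp add: ent_map)
  also have "\<dots> = ent J (\<lambda>w. (snd w, snd (fst w)))" by (rule ent_eqI[OF finJ]) auto
  finally have entJ: "ent (attach P (plift chan)) snd = ent J (\<lambda>w. (snd w, snd (fst w)))" .
  have "slope p * (ent B (\<lambda>x. (hd (fst x), snd x)) - ent B snd)
     - (1 - slope p) * (ent (attach B (\<lambda>x. chan (hd (fst x)))) (\<lambda>w. (snd w, snd (fst w))) - ent B snd)
     + (1 - slope p) * wsum B (\<lambda>x. - log 2 (wt (hd (fst x)))) \<le> adder_rate p"
  proof (rule adder_cond_bound[OF finB])
    fix x assume "x \<in> set_pmf B"
    then have "fst x \<in> set_pmf P" by (auto simp: B_def set_attach)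
    then show "hd (fst x) \<in> {0, 1, 2}" using Suc.prems(2)[of "fst x"] cons[of "fst x"] by (cases "fst x") auto
  qed
  then have step: "slope p * (ent B (\<lambda>x. (hd (fst x), snd x)) - ent B snd)
     - (1 - slope p) * (ent J (\<lambda>w. (snd w, snd (fst w))) - ent B snd)
     + (1 - slope p) * wsum P (\<lambda>x. - log 2 (wt (hd x))) \<le> adder_rate p"
    using wsum_attach_fst[OF finB[unfolded B_def], of "\<lambda>x. - log 2 (wt (hd x))"] by (simp add: J_def B_def)
  \<comment> \<open>The tail outputs S are generated from the tail alone, so they have the same
    conditional entropy given the whole block as given its tail. Hence H(hd|tl) = H(hd|tl,S), which
    submodularity bounds by H(hd|S).\<close>
  have "ent P (\<lambda>ys. ys) - ent P tl = ent B (\<lambda>w. (snd w, fst w)) - ent B (\<lambda>w. (snd w, tl (fst w)))"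
    using ent_attach[of P "\<lambda>ys. plift chan (tl ys)" "\<lambda>t. t" "\<lambda>ys. plift chan (tl ys)" "\<lambda>ys. ys"]
      ent_attach[of P "\<lambda>ys. plift chan (tl ys)" "\<lambda>t. t" "plift chan" tl] finB
    by (simp add: B_def)
  moreover have "ent B (\<lambda>w. (snd w, fst w)) = ent B (\<lambda>w. (hd (fst w), tl (fst w), snd w))"
  proof (rule ent_eqI[OF finB])
    fix w w' assume "w \<in> set_pmf B" "w' \<in> set_pmf B"
    then have "fst w = hd (fst w) # tl (fst w)" "fst w' = hd (fst w') # tl (fst w')"
      by (auto simp: B_def set_attach intro: cons)
    then show "(snd w, fst w) = (snd w', fst w') \<longleftrightarrow> (hd (fst w), tl (fst w), snd w) = (hd (fst w'), tl (fst w'), snd w')"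
      by (metis prod.inject)
  qed
  moreover have "ent B (\<lambda>w. (snd w, tl (fst w))) = ent B (\<lambda>w. (tl (fst w), snd w))"
    by (rule ent_eqI[OF finB]) auto
  moreover have "ent B (\<lambda>w. (hd (fst w), tl (fst w), snd w)) + ent B snd
      \<le> ent B (\<lambda>w. (hd (fst w), snd w)) + ent B (\<lambda>w. (tl (fst w), snd w))"
    by (rule ent_submodular[OF finB])
  moreover have "ent P tl = ent P' (\<lambda>ys. ys)" by (simp add: P'_def ent_map)
  ultimately have "ent P (\<lambda>ys. ys) \<le> ent P' (\<lambda>ys. ys) + (ent B (\<lambda>w. (hd (fst w), snd w)) - ent B snd)" by linarith
  then have chain: "slope p * ent P (\<lambda>ys. ys) \<le> slope p * (ent P' (\<lambda>ys. ys) + (ent B (\<lambda>w. (hd (fst w), snd w)) - ent B snd))"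
    using slope_bounds(1)[OF p] by (intro mult_left_mono) auto
  have "wsum P (\<lambda>ys. - log 2 (prod_list (map wt ys))) = wsum P (\<lambda>ys. - log 2 (wt (hd ys)) + - log 2 (prod_list (map wt (tl ys))))"
  proof (rule wsum_cong)
    fix ys assume "ys \<in> set_pmf P"
    then obtain z zs where "ys = z # zs" using cons by metis
    moreover have "0 < prod_list (map wt zs)" for zs by (induction zs) (auto simp: wt_pos)
    ultimately show "- log 2 (prod_list (map wt ys)) = - log 2 (wt (hd ys)) + - log 2 (prod_list (map wt (tl ys)))"
      using wt_pos by (simp add: log_mult less_imp_neq[symmetric])
  qed
  also have "\<dots> = wsum P (\<lambda>ys. - log 2 (wt (hd ys))) + wsum P' (\<lambda>ys. - log 2 (prod_list (map wt ys)))"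
    unfolding wsum_add P'_def wsum_map[OF finP] ..
  finally have ws: "wsum P (\<lambda>ys. - log 2 (prod_list (map wt ys))) = \<dots>" .
  show ?case unfolding ws entJ using IH[unfolded entJ'] step chain by (simp add: algebra_simps)
qed

end

section \<open>The entropy of the output block\<close>

lemma test_channel_exists:
  assumes "1/3 < p" "p < 1/2"
  obtains \<alpha> \<beta> where "adder_test_channel \<alpha> p \<beta>"
proof -
  define r where "r = sqrt (1 - 2 * p)"
  have r: "0 < r" "r < 1" "r * r = 1 - 2 * p" using assms by (auto simp: r_def)
  have "2 * ((1 - r) / 2) * (1 - (1 - r) / 2) = (1 - r * r) / 2" by (simp add: field_simps)
  then have "p = 2 * ((1 - r) / 2) * (1 - (1 - r) / 2)" using r(3) by simp
  then have "adder_test_channel ((1 - r) / 2) p (((1 - r) / 2)\<^sup>2 / (1 - p))"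
    using assms r(1,2) unfolding adder_test_channel_def by simp
  then show ?thesis using that by blast
qed

lemma capacity_formula_ge:
  assumes "0 \<le> p" "p \<le> 1/2"
  shows "min (C1 + C2 - 1 + h2 p) (min (C1 + h2 p) (h2 p + 1 - p)) \<le> capacity_formula C1 C2"
  unfolding capacity_formula_def
proof (rule cSUP_upper)
  show "bdd_above ((\<lambda>p. min (C1 + C2 - 1 + h2 p) (min (C1 + h2 p) (h2 p + 1 - p))) ` {0..1/2})"
  proof (rule bdd_aboveI2)
    fix p :: real assume "p \<in> {0..1/2}"
    then show "min (C1 + C2 - 1 + h2 p) (min (C1 + h2 p) (h2 p + 1 - p)) \<le> 2"
      using h2_le_1[of p] by auto
  qed
qed (use assms in auto)

lemma capacity_formula_nonneg:
  assumes "0 \<le> C1" "C1 \<le> C2" shows "0 \<le> capacity_formula C1 C2"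
  by (rule order_trans[OF _ capacity_formula_ge[of "1/2"]]) (use assms in \<open>auto simp: h2_half\<close>)

text \<open>The optimisation over p shared by all three converses. If \<open>C2 \<ge> 1\<close>, the
  first term is never below the second. Otherwise, for \<open>C1 + C2 \<le> 3/2\<close> the value at
  1/2 is the cut-set bound \<open>C1 + C2\<close>; for \<open>C1 + C2 \<ge> 5/3\<close> the value at
  1/3 is the maximum of \<open>h2 p + 1 - p\<close>; in between, p is the crossing point, where the
  right-hand side of the last hypothesis equals \<open>h2 p + 1 - p\<close>.\<close>

lemma le_capacity_formulaI:
  assumes C: "0 \<le> C1" "C1 \<le> C2" and s: "0 \<le> s" "s \<le> 1"
    and R1: "R \<le> C1 + h2 s" and R2: "R \<le> h2 s + 1 - s" and R3: "R \<le> C1 + C2"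
    and R4: "\<And>p. 1/3 < p \<Longrightarrow> p < 1/2 \<Longrightarrow> C1 + C2 = 2 - p \<Longrightarrow> R \<le> adder_rate p + (1 - slope p) * (C1 + C2)"
  shows "R \<le> capacity_formula C1 C2"
proof -
  note F = order_trans[OF _ capacity_formula_ge]
  consider "C2 \<ge> 1" | "C2 < 1" "C1 + C2 \<le> 3/2" | "C2 < 1" "C1 + C2 \<ge> 5/3" | "C2 < 1" "3/2 < C1 + C2" "C1 + C2 < 5/3"
    by linarith
  then show ?thesis
  proof cases
    case 1
    \<comment> \<open>Folding \<open>s\<close> into [0, 1/2] preserves its entropy and can only
      increase \<open>h2 s + 1 - s\<close>.\<close>
    define p where "p = min s (1 - s)"
    have "h2 p = h2 s" by (simp add: p_def min_def h2_sym)
    moreover have "0 \<le> p" "p \<le> 1/2" "p \<le> s" using s by (auto simp: p_def min_def)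
    ultimately show ?thesis using 1 R1 R2 by (intro F[of _ C1 C2 p]) auto
  next
    case 2
    then show ?thesis using R3 by (intro F[of _ C1 C2 "1/2"]) (auto simp: h2_half)
  next
    case 3
    have "h2 s \<le> h2 (1/3) + slope (1/3) * (s - 1/3)"
      using h2_le_cross[of "1/3" s] cross_entropy_slope[of "1/3" s] s by simp
    moreover have "slope (1/3) = 1" by (simp add: slope_def)
    ultimately have "h2 s - s \<le> h2 (1/3) - 1/3" by simp
    then show ?thesis using R2 3 by (intro F[of _ C1 C2 "1/3"]) auto
  next
    case 4
    define p where "p = 2 - (C1 + C2)"
    have p: "1/3 < p" "p < 1/2" "C1 + C2 = 2 - p" using 4 by (auto simp: p_def)
    have "R \<le> h2 p + 1 - p" using R4[OF p] unfolding p(3) adder_rate_def by (simp add: algebra_simps)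
    then show ?thesis using p 4 by (intro F[of _ C1 C2 p]) auto
  qed
qed

section \<open>Cross entropy bounds in terms of the frequency of the output 1\<close>

definition ones :: "nat list \<Rightarrow> nat" where
  "ones ys = length (filter (\<lambda>y. y = 1) ys)"

lemma ones_simps [simp]: "ones [] = 0" "ones (y # ys) = (if y = 1 then Suc (ones ys) else ones ys)"
  by (simp_all add: ones_def)

lemma ones_le: "ones ys \<le> length ys" by (simp add: ones_def)

text \<open>The law of largest entropy on {0, 1, 2} that gives the middle symbol probability
  \<open>s\<close>; its entropy is \<open>h2 s + 1 - s\<close>.\<close>

definition ternary :: "real \<Rightarrow> nat pmf" where
  "ternary s = bind_pmf (bernoulli_pmf s) (\<lambda>b. if b then return_pmf 1 else map_pmf (\<lambda>b. if b then 2 else 0) (bernoulli_pmf (1/2)))"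

lemma pmf_ternary:
  assumes "0 \<le> s" "s \<le> 1" "y \<in> {0, 1, 2}"
  shows "pmf (ternary s) y = (if y = 1 then s else (1 - s) / 2)"
proof -
  have "pmf (map_pmf (\<lambda>b. if b then 2 else (0::nat)) (bernoulli_pmf (1/2))) y = (if y = 1 then 0 else 1/2)"
  proof -
    have "{b. (if b then 2 else 0) = y} = (if y = 0 then {False} else if y = 2 then {True} else {})"
      using assms(3) by auto
    then show ?thesis using assms(3)
      by (auto simp: pmf_map vimage_def measure_pmf_single)
  qed
  then show ?thesis using assms by (auto simp: ternary_def pmf_bind)
qed

lemma pmf_plift_ternary:
  assumes s: "0 \<le> s" "s \<le> 1"
  shows "length zs = length ys \<Longrightarrow> set ys \<subseteq> {0, 1, 2} \<Longrightarrow>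
    pmf (plift (\<lambda>_. ternary s) zs) ys = s ^ ones ys * ((1 - s) / 2) ^ (length ys - ones ys)"
proof (induction zs ys rule: list_induct2)
  case (Cons z zs y ys)
  then show ?case using ones_le[of ys]
    by (auto simp: pmf_plift_Cons pmf_ternary[OF s] Suc_diff_le simp del: plift.simps)
qed auto

lemma pmf_plift_flip:
  assumes s: "0 \<le> s" "s \<le> 1"
  shows "length xs = length ys \<Longrightarrow>
    pmf (plift (\<lambda>x. bernoulli_pmf (if x then 1 - s else s)) xs) ys
      = s ^ ones (map2 adder xs ys) * (1 - s) ^ (length ys - ones (map2 adder xs ys))"
proof (induction xs ys rule: list_induct2)
  case (Cons x xs y ys)
  then show ?case using ones_le[of "map2 adder xs ys"] s
    by (cases x; cases y) (auto simp: pmf_plift_Cons adder_def Suc_diff_le simp del: plift.simps)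
qed auto

text \<open>A base may vanish as long as its exponent does too; this happens for s = 0 and s =
  1.\<close>

lemma log_power_prod:
  assumes "0 \<le> a" "0 \<le> b" "k > 0 \<Longrightarrow> a > 0" "l > 0 \<Longrightarrow> b > 0"
  shows "0 < a ^ k * b ^ l" "- log 2 (a ^ k * b ^ l) = - real k * log 2 a - real l * log 2 b"
proof -
  have "0 < a ^ k" using assms by (cases "k = 0") auto
  moreover have "0 < b ^ l" using assms by (cases "l = 0") auto
  ultimately have pos: "0 < a ^ k" "0 < b ^ l" .
  then show "0 < a ^ k * b ^ l" by simp
  have "log 2 (a ^ k) = k * log 2 a" using assms by (cases "k = 0") (auto simp: log_nat_power)
  moreover have "log 2 (b ^ l) = l * log 2 b" using assms by (cases "l = 0") (auto simp: log_nat_power)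
  ultimately show "- log 2 (a ^ k * b ^ l) = - real k * log 2 a - real l * log 2 b"
    using pos by (simp add: log_mult_pos)
qed

lemma set_map2_adder: "set (map2 adder xs ys) \<subseteq> {0, 1, 2}"
  by (auto simp: adder_def split: if_splits)

lemma adder_left_cancel: "adder a b = adder a c \<longleftrightarrow> b = c"
  by (cases b; cases c) (auto simp: adder_def)

lemma map2_adder_inj:
  "length x = length y \<Longrightarrow> length x = length y' \<Longrightarrow> map2 adder x y = map2 adder x y' \<Longrightarrow> y = y'"
proof (induction x arbitrary: y y')
  case (Cons a x)
  then show ?case by (cases y; cases y') (auto simp: adder_left_cancel)
qed auto

lemma map2_adder_commute: "map2 adder x y = map2 adder y x"
  by (induction x y rule: list_induct2') (auto simp: adder_def)

context
  fixes P :: "'a pmf" and X1 X2 :: "'a \<Rightarrow> bool list" and n :: nat and s :: real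
  assumes fin: "finite (set_pmf P)" and n: "n \<ge> 1"
    and len: "\<And>w. w \<in> set_pmf P \<Longrightarrow> length (X1 w) = n \<and> length (X2 w) = n"
    and s_def: "s = wsum P (\<lambda>w. real (ones (map2 adder (X1 w) (X2 w)))) / real n"
begin

lemma ones_le_n: "w \<in> set_pmf P \<Longrightarrow> ones (map2 adder (X1 w) (X2 w)) \<le> n"
  using len[of w] ones_le[of "map2 adder (X1 w) (X2 w)"] by simp

lemma s_bounds: "0 \<le> s" "s \<le> 1"
proof -
  have "wsum P (\<lambda>w. 0) \<le> wsum P (\<lambda>w. real (ones (map2 adder (X1 w) (X2 w))))" by (rule wsum_mono) auto
  then show "0 \<le> s" by (simp add: s_def wsum_const[OF fin])
  have "wsum P (\<lambda>w. real (ones (map2 adder (X1 w) (X2 w)))) \<le> wsum P (\<lambda>w. real n)"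
    by (rule wsum_mono) (auto dest: ones_le_n)
  then show "s \<le> 1" using n by (simp add: s_def wsum_const[OF fin])
qed

text \<open>A mean that is extremal forces every block of the support to be extremal. This keeps the
  reference laws below positive on the support even when \<open>s\<close> is 0 or 1.\<close>

lemma s_extreme:
  assumes w: "w \<in> set_pmf P"
  shows "ones (map2 adder (X1 w) (X2 w)) > 0 \<Longrightarrow> s > 0" "n - ones (map2 adder (X1 w) (X2 w)) > 0 \<Longrightarrow> 1 - s > 0"
proof -
  let ?o = "\<lambda>w. ones (map2 adder (X1 w) (X2 w))"
  have pos: "0 < wsum P g" if "\<And>v. v \<in> set_pmf P \<Longrightarrow> 0 \<le> g v" "0 < g w" for g
    unfolding wsum_def using fin w that
    by (intro sum_pos2[of _ w]) (auto intro!: mult_nonneg_nonneg mult_pos_pos simp: pmf_positive)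
  show "s > 0" if "?o w > 0" using that n pos[of "\<lambda>w. real (?o w)"] by (simp add: s_def)
  show "1 - s > 0" if "n - ?o w > 0"
  proof -
    have "0 < wsum P (\<lambda>w. real n - real (?o w))" by (rule pos) (use that ones_le_n in auto)
    then show ?thesis using n by (simp add: s_def wsum_diff wsum_const[OF fin])
  qed
qed

lemma wsum_ones: "wsum P (\<lambda>w. real (ones (map2 adder (X1 w) (X2 w)))) = real n * s"
  using n by (simp add: s_def)

text \<open>The reference law has independent letters with law \<open>ternary s\<close>. The
  logarithm of a block's probability is affine in its number of ones, so the expectation depends on
  \<open>s\<close> only and no concavity argument over the letters is needed.\<close>

lemma ent_adder_le: "ent P (\<lambda>w. map2 adder (X1 w) (X2 w)) \<le> real n * (h2 s + 1 - s)"
proof -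
  let ?y = "\<lambda>w. map2 adder (X1 w) (X2 w)"
  let ?k = "pmf (plift (\<lambda>_. ternary s) (replicate n ()))"
  have k: "?k (?y w) = s ^ ones (?y w) * ((1 - s) / 2) ^ (n - ones (?y w))" if "w \<in> set_pmf P" for w
    using pmf_plift_ternary[OF s_bounds, of "replicate n ()" "?y w"] len[OF that] set_map2_adder by auto
  note L = log_power_prod[of s "(1 - s) / 2"]
  have L1: "0 < ?k (?y w)" "- log 2 (?k (?y w)) = - real (ones (?y w)) * log 2 s - real (n - ones (?y w)) * log 2 ((1 - s) / 2)"
    if w: "w \<in> set_pmf P" for w
    unfolding k[OF w] by (rule L; use s_bounds s_extreme[OF w] in auto)+
  have "ent P ?y \<le> wsum P (\<lambda>w. - log 2 (?k (?y w)))"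
  proof (rule ent_le_cross[OF fin])
    show "sum ?k (?y ` set_pmf P) \<le> 1"
      using fin by (subst measure_measure_pmf_finite[symmetric]) (auto simp: measure_pmf.prob_le_1)
  qed (use L1 in auto)
  also have "\<dots> = wsum P (\<lambda>w. real (ones (?y w)) * (log 2 ((1 - s) / 2) - log 2 s) - real n * log 2 ((1 - s) / 2))"
    by (rule wsum_cong) (use ones_le_n in \<open>auto simp: L1(2) of_nat_diff algebra_simps\<close>)
  also have "\<dots> = real n * s * (log 2 ((1 - s) / 2) - log 2 s) - real n * log 2 ((1 - s) / 2)"
    by (simp only: wsum_affine[OF fin] wsum_ones)
  also have "\<dots> = real n * (- s * log 2 s - (1 - s) * log 2 ((1 - s) / 2))" by (simp add: algebra_simps)
  also have "- s * log 2 s - (1 - s) * log 2 ((1 - s) / 2) = h2 s + 1 - s"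
    by (cases "s = 1") (auto simp: h2_def log_divide algebra_simps)
  finally show ?thesis .
qed

text \<open>The reference kernel is a memoryless binary symmetric channel from \<open>X1\<close> to
  \<open>X2\<close> with crossover probability \<open>s\<close>: the adder output is 1 exactly where
  the inputs disagree, so the same \<open>s\<close> governs this bound and the previous one.\<close>

lemma cond_ent_le_h2: "ent P (\<lambda>w. (X2 w, X1 w)) - ent P X1 \<le> real n * h2 s"
proof -
  let ?y = "\<lambda>w. map2 adder (X1 w) (X2 w)"
  let ?k = "\<lambda>x. pmf (plift (\<lambda>x. bernoulli_pmf (if x then 1 - s else s)) x)"
  have k: "?k (X1 w) (X2 w) = s ^ ones (?y w) * (1 - s) ^ (n - ones (?y w))" if "w \<in> set_pmf P" for w
    using pmf_plift_flip[OF s_bounds, of "X1 w" "X2 w"] len[OF that] by auto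
  note L = log_power_prod[of s "1 - s"]
  have L1: "0 < ?k (X1 w) (X2 w)" "- log 2 (?k (X1 w) (X2 w)) = - real (ones (?y w)) * log 2 s - real (n - ones (?y w)) * log 2 (1 - s)"
    if w: "w \<in> set_pmf P" for w
    unfolding k[OF w] by (rule L; use s_bounds s_extreme[OF w] in auto)+
  have "ent P (\<lambda>w. (X2 w, X1 w)) - ent P X1 \<le> wsum P (\<lambda>w. - log 2 (?k (X1 w) (X2 w)))"
  proof (rule cond_ent_le_cross[OF fin])
    show "sum (?k x) (X2 ` set_pmf P) \<le> 1" for x
      using fin by (subst measure_measure_pmf_finite[symmetric]) (auto simp: measure_pmf.prob_le_1)
  qed (use L1 in auto)
  also have "\<dots> = wsum P (\<lambda>w. real (ones (?y w)) * (log 2 (1 - s) - log 2 s) - real n * log 2 (1 - s))"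
    by (rule wsum_cong) (use ones_le_n in \<open>auto simp: L1(2) of_nat_diff algebra_simps\<close>)
  also have "\<dots> = real n * s * (log 2 (1 - s) - log 2 s) - real n * log 2 (1 - s)"
    by (simp only: wsum_affine[OF fin] wsum_ones)
  also have "\<dots> = real n * h2 s" by (simp add: h2_def algebra_simps)
  finally show ?thesis .
qed

end

lemma attach_map: "attach (map_pmf f P) K = map_pmf (\<lambda>w. (f (fst w), snd w)) (attach P (\<lambda>x. K (f x)))"
  by (simp add: attach_def bind_map_pmf map_bind_pmf pmf.map_comp o_def)

lemma ent_output_block_le:
  assumes C: "0 \<le> C1" "C1 \<le> C2" and fin: "finite (set_pmf P)" and n: "n \<ge> 1"
    and len: "\<And>w. w \<in> set_pmf P \<Longrightarrow> length (X1 w) = n \<and> length (X2 w) = n"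
    and H1: "ent P X1 \<le> real n * C1" and H2: "ent P X2 \<le> real n * C2"
  shows "ent P (\<lambda>w. map2 adder (X1 w) (X2 w)) \<le> real n * capacity_formula C1 C2"
proof -
  let ?Y = "\<lambda>w. map2 adder (X1 w) (X2 w)"
  define R where "R = ent P ?Y / real n"
  have Rn: "ent P ?Y = real n * R" using n by (simp add: R_def)
  define s where "s = wsum P (\<lambda>w. real (ones (?Y w))) / real n"
  have Y12: "ent P ?Y \<le> ent P (\<lambda>w. (X2 w, X1 w))" by (rule ent_mono[OF fin]) auto
  have "R \<le> capacity_formula C1 C2"
  proof (rule le_capacity_formulaI[OF C s_bounds[OF fin n len s_def]], assumption)
    show "R \<le> C1 + h2 s"
    proof -
      have "real n * R \<le> real n * C1 + real n * h2 s"
        using cond_ent_le_h2[OF fin n len s_def] Y12 H1 Rn by simp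
      then have "real n * R \<le> real n * (C1 + h2 s)" by (simp add: algebra_simps)
      then show ?thesis using n by simp
    qed
    show "R \<le> h2 s + 1 - s"
    proof -
      have "real n * R \<le> real n * (h2 s + 1 - s)" using ent_adder_le[OF fin n len s_def] Rn by simp
      then show ?thesis using n by (simp only: mult_le_cancel_left_pos)
    qed
    show "R \<le> C1 + C2"
    proof -
      have "real n * R \<le> real n * (C1 + C2)"
        using Y12 ent_subadditive[OF fin, of X2 X1] H1 H2 Rn by (simp add: algebra_simps)
      then show ?thesis using n by simp
    qed
    fix p :: real assume p: "1/3 < p" "p < 1/2" "C1 + C2 = 2 - p"
    obtain \<alpha> \<beta> where "adder_test_channel \<alpha> p \<beta>" using test_channel_exists p by blast
    then interpret adder_test_channel \<alpha> p \<beta> .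
    define J where "J = attach P (\<lambda>w. plift chan (?Y w))"
    define E where "E = wsum P (\<lambda>w. - log 2 (prod_list (map wt (?Y w))))"
    have prodpos: "0 < prod_list (map wt zs)" for zs by (induction zs) (auto simp: wt_pos)
    \<comment> \<open>The memoryless extension of the test channel again has the required product
      form, with the product of the letters' \<open>wt\<close> as normalising factor.\<close>
    have "ent J (\<lambda>w. (snd w, ())) - ent P (\<lambda>_. ()) - E \<le> cmi P X1 X2 (\<lambda>_. ())"
      unfolding J_def E_def
      by (rule cmi_ge_test_channel[OF fin, where K = "\<lambda>x y. plift chan (map2 adder x y)" and ?W1.0 = "plift bsc" and ?W2.0 = "plift bsc"])
        (use len in \<open>auto simp: plift_chan_factor simp del: map_map intro!: finite_plift finite_chan prodpos\<close>)
    moreover have finJ: "finite (set_pmf J)" unfolding J_def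
      by (rule finite_attach[OF fin]) (auto intro!: finite_plift finite_chan)
    moreover have "ent J (\<lambda>w. (snd w, ())) = ent J snd" by (rule ent_eqI[OF finJ]) auto
    moreover have "ent P (\<lambda>w. (X1 w, ())) = ent P X1" "ent P (\<lambda>w. (X2 w, ())) = ent P X2"
      "ent P (\<lambda>w. (X1 w, X2 w, ())) = ent P (\<lambda>w. (X2 w, X1 w))" by (rule ent_eqI[OF fin]; auto)+
    ultimately have I: "ent J snd - E \<le> ent P X1 + ent P X2 - ent P (\<lambda>w. (X2 w, X1 w))"
      by (simp add: cmi_def ent_const)
    have "slope p * ent (map_pmf ?Y P) (\<lambda>ys. ys) - (1 - slope p) * ent (attach (map_pmf ?Y P) (plift chan)) snd
     + (1 - slope p) * wsum (map_pmf ?Y P) (\<lambda>ys. - log 2 (prod_list (map wt ys))) \<le> real n * adder_rate p"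
    proof (rule adder_block_bound)
      fix ys assume "ys \<in> set_pmf (map_pmf ?Y P)"
      then obtain w where "w \<in> set_pmf P" "ys = ?Y w" by (auto simp del: map_map)
      then show "length ys = n \<and> set ys \<subseteq> {0, 1, 2}" using len set_map2_adder by simp
    qed (use fin in simp)
    then have B: "slope p * ent P ?Y - (1 - slope p) * ent J snd + (1 - slope p) * E \<le> real n * adder_rate p"
      by (simp add: ent_map wsum_map[OF fin] attach_map J_def E_def)
    \<comment> \<open>H(Y) \<le> H(X1,X2) = H(X1) + H(X2) - I(X1;X2). This bound receives the weight
      \<open>1 - slope p\<close>; the weight \<open>slope p\<close> on H(Y) itself is already in
      \<open>B\<close>, and H(T) and \<open>E\<close> cancel in the sum.\<close>
    have "ent P ?Y \<le> real n * (C1 + C2) - (ent J snd - E)" using I Y12 H1 H2 by (simp add: algebra_simps)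
    then have "(1 - slope p) * ent P ?Y \<le> (1 - slope p) * (real n * (C1 + C2) - (ent J snd - E))"
      using slope_bounds[OF p(1,2)] by (intro mult_left_mono) auto
    then have "ent P ?Y \<le> real n * (adder_rate p + (1 - slope p) * (C1 + C2))" using B by (simp add: algebra_simps)
    then show "R \<le> adder_rate p + (1 - slope p) * (C1 + C2)" using n Rn by simp
  qed
  then show ?thesis unfolding Rn by (rule mult_left_mono) simp
qed

section \<open>The lower and upper bounds\<close>

lemma adder_right_cancel: "adder b a = adder c a \<longleftrightarrow> b = c"
  by (cases b; cases c) (auto simp: adder_def)

lemma adder_range: "adder a b \<in> {0, 1, 2}"
  by (cases a; cases b) (auto simp: adder_def)

text \<open>Given one input, the adder output and the other input determine each other; given both
  inputs the output is fixed. So all terms with the output reduce to entropies of the inputs or of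
  the output.\<close>

lemma cmi_adder:
  assumes fin: "finite (set_pmf P)"
  shows "cmi P X1 (\<lambda>w. adder (X1 w) (X2 w)) (\<lambda>w. (X2 w, U w)) = ent P (\<lambda>w. (X1 w, X2 w, U w)) - ent P (\<lambda>w. (X2 w, U w))"
    and "cmi P X2 (\<lambda>w. adder (X1 w) (X2 w)) (\<lambda>w. (X1 w, U w)) = ent P (\<lambda>w. (X1 w, X2 w, U w)) - ent P (\<lambda>w. (X1 w, U w))"
    and "cmi P (\<lambda>w. (X1 w, X2 w)) (\<lambda>w. adder (X1 w) (X2 w)) U = ent P (\<lambda>w. (adder (X1 w) (X2 w), U w)) - ent P U"
proof -
  let ?Y = "\<lambda>w. adder (X1 w) (X2 w)" and ?H = "ent P (\<lambda>w. (X1 w, X2 w, U w))"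
  have "ent P (\<lambda>w. (?Y w, X2 w, U w)) = ?H" "ent P (\<lambda>w. (X1 w, ?Y w, X2 w, U w)) = ?H"
    by (rule ent_eqI[OF fin]; auto simp: adder_right_cancel)+
  then show "cmi P X1 ?Y (\<lambda>w. (X2 w, U w)) = ?H - ent P (\<lambda>w. (X2 w, U w))" by (simp add: cmi_def)
  have "ent P (\<lambda>w. (?Y w, X1 w, U w)) = ?H" "ent P (\<lambda>w. (X2 w, ?Y w, X1 w, U w)) = ?H" "ent P (\<lambda>w. (X2 w, X1 w, U w)) = ?H"
    by (rule ent_eqI[OF fin]; auto simp: adder_left_cancel)+
  then show "cmi P X2 ?Y (\<lambda>w. (X1 w, U w)) = ?H - ent P (\<lambda>w. (X1 w, U w))" by (simp add: cmi_def)
  have "ent P (\<lambda>w. ((X1 w, X2 w), U w)) = ?H" "ent P (\<lambda>w. ((X1 w, X2 w), ?Y w, U w)) = ?H"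
    by (rule ent_eqI[OF fin]; auto)+
  then show "cmi P (\<lambda>w. (X1 w, X2 w)) ?Y U = ent P (\<lambda>w. (?Y w, U w)) - ent P U" by (simp add: cmi_def)
qed

text \<open>The block bounds at length 1. The auxiliary variable disappears from the first one since
  conditioning on it only lowers the entropy.\<close>

lemma single_letter_h2:
  assumes fin: "finite (set_pmf P)"
  obtains s where "0 \<le> s" "s \<le> 1"
    "ent P (\<lambda>w. (X1 w, X2 w, U w)) - ent P (\<lambda>w. (X1 w, U w)) \<le> h2 s"
    "ent P (\<lambda>w. adder (X1 w) (X2 w)) \<le> h2 s + 1 - s"
proof -
  define s where "s = wsum P (\<lambda>w. real (ones (map2 adder [X1 w] [X2 w]))) / real 1"
  have len: "length [X1 w] = 1 \<and> length [X2 w] = 1" for w by simp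
  have e: "ent P (\<lambda>w. ([X2 w], [X1 w])) = ent P (\<lambda>w. (X2 w, X1 w))" "ent P (\<lambda>w. [X1 w]) = ent P X1"
    "ent P (\<lambda>w. map2 adder [X1 w] [X2 w]) = ent P (\<lambda>w. adder (X1 w) (X2 w))"
    by (rule ent_eqI[OF fin]; auto)+
  show ?thesis
  proof (rule that)
    show "0 \<le> s" "s \<le> 1" using s_bounds[OF fin le_refl len s_def] by auto
    show "ent P (\<lambda>w. adder (X1 w) (X2 w)) \<le> h2 s + 1 - s"
      using ent_adder_le[OF fin le_refl len s_def] unfolding e by simp
    have "ent P (\<lambda>w. (X2 w, X1 w)) - ent P X1 \<le> h2 s"
      using cond_ent_le_h2[OF fin le_refl len s_def] unfolding e by simp
    moreover have "ent P (\<lambda>w. (X2 w, U w, X1 w)) + ent P X1 \<le> ent P (\<lambda>w. (X2 w, X1 w)) + ent P (\<lambda>w. (U w, X1 w))"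
      by (rule ent_submodular[OF fin])
    moreover have "ent P (\<lambda>w. (X2 w, U w, X1 w)) = ent P (\<lambda>w. (X1 w, X2 w, U w))" "ent P (\<lambda>w. (U w, X1 w)) = ent P (\<lambda>w. (X1 w, U w))"
      by (rule ent_eqI[OF fin]; auto)+
    ultimately show "ent P (\<lambda>w. (X1 w, X2 w, U w)) - ent P (\<lambda>w. (X1 w, U w)) \<le> h2 s" by simp
  qed
qed

text \<open>The channel sees only \<open>Y\<close>, so U - Y - T is a Markov chain, and data
  processing gives I(T;U) \<le> I(Y;U). It serves to trade H(Y|U) for H(Y).\<close>

lemma attach_data_processing:
  fixes V :: "'y \<Rightarrow> 't pmf"
  assumes fin: "finite (set_pmf (attach P (\<lambda>x. V (Y x))))"
  defines "J \<equiv> attach P (\<lambda>x. V (Y x))"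
  shows "ent P (\<lambda>x. (Y x, U x)) + ent J snd \<le> ent P Y + ent J (\<lambda>w. (snd w, U (fst w)))"
proof -
  have "ent J (\<lambda>w. (Y (fst w), U (fst w), snd w)) + ent J snd \<le> ent J (\<lambda>w. (Y (fst w), snd w)) + ent J (\<lambda>w. (U (fst w), snd w))"
    unfolding J_def by (rule ent_submodular[OF fin])
  moreover have "ent J (\<lambda>w. (Y (fst w), U (fst w), snd w)) = ent J (\<lambda>w. (snd w, Y (fst w), U (fst w)))"
    "ent J (\<lambda>w. (Y (fst w), snd w)) = ent J (\<lambda>w. (snd w, Y (fst w)))"
    "ent J (\<lambda>w. (U (fst w), snd w)) = ent J (\<lambda>w. (snd w, U (fst w)))"
    unfolding J_def by (rule ent_eqI[OF fin]; auto)+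
  moreover have "ent J (\<lambda>w. (snd w, Y (fst w), U (fst w))) - ent P (\<lambda>x. (Y x, U x)) = ent J (\<lambda>w. (snd w, Y (fst w))) - ent P Y"
    using ent_attach[of P "\<lambda>x. V (Y x)" "\<lambda>t. t" "\<lambda>(y, _). V y" "\<lambda>x. (Y x, U x)"]
      ent_attach[of P "\<lambda>x. V (Y x)" "\<lambda>t. t" V Y] fin by (simp add: J_def)
  ultimately show ?thesis by simp
qed

lemma lower_value_le:
  fixes X1 X2 :: "'a \<Rightarrow> bool" and U :: "'a \<Rightarrow> 'u"
  assumes C: "0 \<le> C1" "C1 \<le> C2" and fin: "finite (set_pmf P)"
  defines "Y \<equiv> \<lambda>w. adder (X1 w) (X2 w)"
  assumes R1: "R \<le> C1 + C2 - cmi P X1 X2 U"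
    and R3: "R \<le> C1 + cmi P X2 Y (\<lambda>w. (X1 w, U w))"
    and R4: "R \<le> (C1 + C2 + cmi P (\<lambda>w. (X1 w, X2 w)) Y U - cmi P X1 X2 U) / 2"
    and R5: "R \<le> mi P (\<lambda>w. (X1 w, X2 w)) Y"
  shows "R \<le> capacity_formula C1 C2"
proof -
  have HY: "mi P (\<lambda>w. (X1 w, X2 w)) Y = ent P Y"
  proof -
    have "ent P (\<lambda>w. (Y w, ())) = ent P Y" by (rule ent_eqI[OF fin]) auto
    then show ?thesis unfolding mi_def Y_def cmi_adder(3)[OF fin] by (simp add: ent_const)
  qed
  obtain s where s: "0 \<le> s" "s \<le> 1"
    "ent P (\<lambda>w. (X1 w, X2 w, U w)) - ent P (\<lambda>w. (X1 w, U w)) \<le> h2 s" "ent P Y \<le> h2 s + 1 - s"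
    unfolding Y_def by (rule single_letter_h2[OF fin, where ?X1.0 = X1 and ?X2.0 = X2 and U = U])
  show ?thesis
  proof (rule le_capacity_formulaI[OF C s(1,2)])
    show "R \<le> C1 + h2 s" using R3 s(3) unfolding Y_def cmi_adder(2)[OF fin] by simp
    show "R \<le> h2 s + 1 - s" using R5 HY s(4) by simp
    show "R \<le> C1 + C2" using R1 cmi_nonneg[OF fin, of X1 X2 U] by simp
    fix p :: real assume p: "1/3 < p" "p < 1/2" "C1 + C2 = 2 - p"
    obtain \<alpha> \<beta> where "adder_test_channel \<alpha> p \<beta>" using test_channel_exists p by blast
    then interpret adder_test_channel \<alpha> p \<beta> .
    define J where "J = attach P (\<lambda>w. chan (Y w))"
    define \<nu> where "\<nu> = slope p"
    define I where "I = cmi P X1 X2 U"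
    define HYU where "HYU = ent P (\<lambda>w. (Y w, U w)) - ent P U"
    define HTU where "HTU = ent J (\<lambda>w. (snd w, U (fst w))) - ent P U"
    define E where "E = wsum P (\<lambda>w. - log 2 (wt (Y w)))"
    have \<nu>: "0 < \<nu>" "\<nu> < 1" using slope_bounds[OF p(1,2)] by (auto simp: \<nu>_def)
    have finJ: "finite (set_pmf J)" unfolding J_def by (rule finite_attach[OF fin finite_chan])
    have I: "HTU - E \<le> I" unfolding HTU_def E_def I_def J_def Y_def
      by (rule cmi_ge_test_channel[OF fin, where K = "\<lambda>x y. chan (adder x y)" and ?W1.0 = bsc and ?W2.0 = bsc])
         (auto simp: chan_factor wt_pos)
    then have I': "(1 - \<nu>) * (HTU - E) \<le> (1 - \<nu>) * I" using \<nu> by (intro mult_left_mono) auto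
    have BU: "\<nu> * HYU - (1 - \<nu>) * HTU + (1 - \<nu>) * E \<le> adder_rate p"
      unfolding \<nu>_def HYU_def HTU_def E_def J_def
      by (rule adder_cond_bound[OF fin]) (auto simp: Y_def adder_range[simplified])
    have R4': "2 * R \<le> C1 + C2 + HYU - I"
      using R4 unfolding Y_def cmi_adder(3)[OF fin] by (simp add: HYU_def I_def Y_def)
    show "R \<le> adder_rate p + (1 - slope p) * (C1 + C2)"
    proof (cases "\<nu> \<le> 1/2")
      case True
      \<comment> \<open>The half-sum hypothesis \<open>R4\<close> gets weight 2 * \<nu> and
        \<open>R1\<close> the rest. Together this is weight \<nu> on H(Y|U) and
        \<open>1 - \<nu>\<close> on \<open>C1 + C2 - I\<close>, the combination bounded by
        \<open>BU\<close>.\<close>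
      have "\<nu> * (2 * R) \<le> \<nu> * (C1 + C2 + HYU - I)" using R4' \<nu> by (intro mult_left_mono) auto
      moreover have "(1 - 2 * \<nu>) * R \<le> (1 - 2 * \<nu>) * (C1 + C2 - I)" using R1 True by (intro mult_left_mono) (auto simp: I_def)
      ultimately show ?thesis using I' BU unfolding \<nu>_def[symmetric] by (simp add: algebra_simps)
    next
      case False
      \<comment> \<open>Now 2 * \<nu> exceeds 1. \<open>R4\<close> gets weight
        \<open>2 * (1 - \<nu>)\<close> and H(Y) the rest; data processing replaces H(Y|U) by H(Y) +
        H(T|U) - H(T), after which the single letter bound with trivial conditioning
        applies.\<close>
      have "\<nu> * (ent P (\<lambda>w. (Y w, ())) - ent P (\<lambda>_. ())) - (1 - \<nu>) * (ent J (\<lambda>w. (snd w, ())) - ent P (\<lambda>_. ())) + (1 - \<nu>) * E \<le> adder_rate p"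
        unfolding \<nu>_def E_def J_def
        by (rule adder_cond_bound[OF fin]) (auto simp: Y_def adder_range[simplified])
      moreover have "ent P (\<lambda>w. (Y w, ())) = ent P Y" by (rule ent_eqI[OF fin]) auto
      moreover have "ent J (\<lambda>w. (snd w, ())) = ent J snd" by (rule ent_eqI[OF finJ]) auto
      ultimately have B: "\<nu> * ent P Y - (1 - \<nu>) * ent J snd + (1 - \<nu>) * E \<le> adder_rate p" by (simp add: ent_const)
      have "HYU + ent J snd \<le> ent P Y + HTU"
        using attach_data_processing[of P chan Y U] finJ by (simp add: HYU_def HTU_def J_def)
      then have "(1 - \<nu>) * (HYU + ent J snd) \<le> (1 - \<nu>) * (ent P Y + HTU)" using \<nu> by (intro mult_left_mono) auto
      moreover have "(1 - \<nu>) * (2 * R) \<le> (1 - \<nu>) * (C1 + C2 + HYU - I)" using R4' \<nu> by (intro mult_left_mono) auto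
      moreover have "(2 * \<nu> - 1) * R \<le> (2 * \<nu> - 1) * ent P Y" using R5 HY False by (intro mult_left_mono) auto
      ultimately show ?thesis using I' B unfolding \<nu>_def[symmetric] by (simp add: algebra_simps)
    qed
  qed
qed

section \<open>Attainment of the lower bound by the doubly symmetric binary source\<close>

definition dsbs :: "real \<Rightarrow> (bool \<times> bool) pmf" where
  "dsbs p = attach (bernoulli_pmf (1/2)) (\<lambda>x. bernoulli_pmf (if x then 1 - p else p))"

lemma pmf_dsbs:
  assumes "0 \<le> p" "p \<le> 1"
  shows "pmf (dsbs p) (a, b) = (if a = b then (1 - p) / 2 else p / 2)"
proof -
  have "pmf (map_pmf (\<lambda>w. (snd w, fst w)) (dsbs p)) (b, a) = pmf (bernoulli_pmf (1/2)) a * pmf (bernoulli_pmf (if a then 1 - p else p)) b"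
    using pmf_attach[of "bernoulli_pmf (1/2)" "\<lambda>t. t" "\<lambda>x. bernoulli_pmf (if x then 1 - p else p)" "\<lambda>x. bernoulli_pmf (if x then 1 - p else p)" "\<lambda>x. x" b a]
    by (simp add: dsbs_def)
  moreover have "pmf (map_pmf (\<lambda>w. (snd w, fst w)) (dsbs p)) (b, a) = pmf (dsbs p) (a, b)"
    using pmf_map_inj'[of "\<lambda>w. (snd w, fst w)" "dsbs p" "(a, b)"] by (auto simp: inj_def)
  ultimately show ?thesis using assms by (cases a; cases b) auto
qed

lemma dsbs_ent:
  assumes p: "0 \<le> p" "p \<le> 1"
  shows "ent (dsbs p) (\<lambda>w. w) = 1 + h2 p" "ent (dsbs p) fst = 1" "ent (dsbs p) snd = 1"
    "ent (dsbs p) (\<lambda>w. adder (fst w) (snd w)) = h2 p + 1 - p"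
proof -
  have l: "x / 2 * log 2 (x / 2) = (x * log 2 x - x) / 2" for x :: real
    by (cases "x = 0") (auto simp: log_divide field_simps)
  have m: "pmf (map_pmf f (dsbs p)) v = (\<Sum>w\<in>UNIV. if f w = v then pmf (dsbs p) w else 0)" for f :: "bool \<times> bool \<Rightarrow> 'b" and v
  proof -
    have "pmf (map_pmf f (dsbs p)) v = (\<Sum>w\<in>f -` {v}. pmf (dsbs p) w)"
      by (simp add: pmf_map measure_measure_pmf_finite)
    also have "\<dots> = (\<Sum>w\<in>UNIV. if f w = v then pmf (dsbs p) w else 0)"
      by (subst sum.inter_filter[symmetric]) (auto simp: vimage_def)
    finally show ?thesis .
  qed
  have U: "(\<Sum>w\<in>UNIV. g w) = g (False, False) + g (False, True) + g (True, False) + g (True, True)" for g :: "bool \<times> bool \<Rightarrow> real"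
    by (simp add: UNIV_Times_UNIV[symmetric] sum.cartesian_product' UNIV_bool del: UNIV_Times_UNIV)
  note P = pmf_dsbs[OF p]
  have "ent (dsbs p) (\<lambda>w. w) = - (\<Sum>w\<in>UNIV. pmf (dsbs p) w * log 2 (pmf (dsbs p) w))"
    by (subst ent_cong_set[of UNIV]) auto
  also have "\<dots> = - (2 * ((1 - p) / 2 * log 2 ((1 - p) / 2)) + 2 * (p / 2 * log 2 (p / 2)))" unfolding U by (simp add: P)
  also have "\<dots> = 1 + h2 p" unfolding l by (simp add: h2_def field_simps)
  finally show "ent (dsbs p) (\<lambda>w. w) = 1 + h2 p" .
  have h: "pmf (map_pmf fst (dsbs p)) b = 1/2" "pmf (map_pmf snd (dsbs p)) b = 1/2" for b
    unfolding m U by (cases b; simp add: P field_simps)+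
  show "ent (dsbs p) fst = 1" "ent (dsbs p) snd = 1"
    by (subst ent_cong_set[OF finite subset_UNIV], simp add: h UNIV_bool log_divide)+
  have y: "pmf (map_pmf (\<lambda>w. adder (fst w) (snd w)) (dsbs p)) v = (if v = 1 then p else if v \<in> {0, 2} then (1 - p) / 2 else 0)" for v
    unfolding m U by (auto simp: P adder_def)
  have "ent (dsbs p) (\<lambda>w. adder (fst w) (snd w)) = - (p * log 2 p + 2 * ((1 - p) / 2 * log 2 ((1 - p) / 2)))"
    by (subst ent_cong_set[of "{0, 1, 2}", OF _ image_subsetI[OF adder_range]]) (auto simp: y)
  also have "\<dots> = h2 p + 1 - p" unfolding l by (simp add: h2_def field_simps)
  finally show "ent (dsbs p) (\<lambda>w. adder (fst w) (snd w)) = h2 p + 1 - p" .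
qed

lemma dsbs_quantities:
  assumes p: "0 \<le> p" "p \<le> 1" and fin: "finite (set_pmf J)"
    and J: "map_pmf (\<lambda>w. (X1 w, X2 w)) J = dsbs p" and Q: "\<And>w w'. w \<in> set_pmf J \<Longrightarrow> w' \<in> set_pmf J \<Longrightarrow> Q w = Q w'"
  shows "cmi J X1 X2 Q = 1 - h2 p"
    "cmi J X1 (\<lambda>w. adder (X1 w) (X2 w)) (\<lambda>w. (X2 w, Q w)) = h2 p"
    "cmi J X2 (\<lambda>w. adder (X1 w) (X2 w)) (\<lambda>w. (X1 w, Q w)) = h2 p"
    "cmi J (\<lambda>w. (X1 w, X2 w)) (\<lambda>w. adder (X1 w) (X2 w)) Q = h2 p + 1 - p"
proof -
  have t: "ent J (\<lambda>w. f (X1 w, X2 w)) = ent (dsbs p) f" for f :: "bool \<times> bool \<Rightarrow> 'z"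
    unfolding J[symmetric] by (simp add: ent_map)
  have "ent J (\<lambda>w. (X1 w, X2 w, Q w)) = ent J (\<lambda>w. (X1 w, X2 w))" "ent J (\<lambda>w. (X1 w, Q w)) = ent J X1"
    "ent J (\<lambda>w. (X2 w, Q w)) = ent J X2" "ent J Q = ent J (\<lambda>_. ())"
    "ent J (\<lambda>w. (adder (X1 w) (X2 w), Q w)) = ent J (\<lambda>w. adder (X1 w) (X2 w))"
    by (rule ent_eqI[OF fin]; use Q in blast)+
  moreover have "ent J (\<lambda>w. (X1 w, X2 w)) = 1 + h2 p" "ent J X1 = 1" "ent J X2 = 1" "ent J (\<lambda>w. adder (X1 w) (X2 w)) = h2 p + 1 - p"
    using dsbs_ent[OF p] t[of "\<lambda>w. w"] t[of fst] t[of snd] t[of "\<lambda>w. adder (fst w) (snd w)"] by auto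
  ultimately show "cmi J X1 X2 Q = 1 - h2 p"
    "cmi J X1 (\<lambda>w. adder (X1 w) (X2 w)) (\<lambda>w. (X2 w, Q w)) = h2 p"
    "cmi J X2 (\<lambda>w. adder (X1 w) (X2 w)) (\<lambda>w. (X1 w, Q w)) = h2 p"
    "cmi J (\<lambda>w. (X1 w, X2 w)) (\<lambda>w. adder (X1 w) (X2 w)) Q = h2 p + 1 - p"
    unfolding cmi_adder[OF fin] by (simp_all add: cmi_def ent_const)
qed

lemma cSUP_eq_capacity_formula:
  assumes le: "\<And>x. x \<in> A \<Longrightarrow> f x \<le> capacity_formula C1 C2"
    and ge: "\<And>p. 0 \<le> p \<Longrightarrow> p \<le> 1/2 \<Longrightarrow>
      \<exists>x\<in>A. min (C1 + C2 - 1 + h2 p) (min (C1 + h2 p) (h2 p + 1 - p)) \<le> f x"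
  shows "Sup (f ` A) = capacity_formula C1 C2"
proof (rule antisym)
  have "A \<noteq> {}" using ge[of 0] by auto
  then show "Sup (f ` A) \<le> capacity_formula C1 C2" using le by (rule cSUP_least)
  show "capacity_formula C1 C2 \<le> Sup (f ` A)"
    unfolding capacity_formula_def
  proof (rule cSUP_least)
    fix p :: real assume "p \<in> {0..1/2}"
    then obtain x where x: "x \<in> A" "min (C1 + C2 - 1 + h2 p) (min (C1 + h2 p) (h2 p + 1 - p)) \<le> f x" using ge[of p] by auto
    have "bdd_above (f ` A)" using le by (rule bdd_aboveI2)
    from cSUP_upper[OF x(1) this] x(2) show "min (C1 + C2 - 1 + h2 p) (min (C1 + h2 p) (h2 p + 1 - p)) \<le> Sup (f ` A)" by simp
  qed simp
qed

lemma lower_bound_eq: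
  assumes C: "0 \<le> C1" "C1 \<le> C2"
  shows "lower_bound C1 C2 = capacity_formula C1 C2"
  unfolding lower_bound_def
proof (rule cSUP_eq_capacity_formula)
  have fs: "(\<lambda>(u, x1, x2). u) = (\<lambda>w::nat \<times> bool \<times> bool. fst w)" "(\<lambda>(u, x1, x2). x1) = (\<lambda>w::nat \<times> bool \<times> bool. fst (snd w))"
    "(\<lambda>(u, x1, x2). x2) = (\<lambda>w::nat \<times> bool \<times> bool. snd (snd w))"
    "(\<lambda>(u, x1, x2). adder x1 x2) = (\<lambda>w::nat \<times> bool \<times> bool. adder (fst (snd w)) (snd (snd w)))" by auto
  {
    fix P :: "(nat \<times> bool \<times> bool) pmf" assume "P \<in> {P. finite (set_pmf P)}"
    then have fin: "finite (set_pmf P)" by simp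
    show "(let U = \<lambda>(u, x1, x2). u; X1 = \<lambda>(u, x1, x2). x1; X2 = \<lambda>(u, x1, x2). x2; Y = \<lambda>(u, x1, x2). adder x1 x2
      in min (C1 + C2 - cmi P X1 X2 U)
      (min (C2 + cmi P X1 Y (\<lambda>w. (X2 w, U w)))
       (min (C1 + cmi P X2 Y (\<lambda>w. (X1 w, U w)))
        (min ((C1 + C2 + cmi P (\<lambda>w. (X1 w, X2 w)) Y U - cmi P X1 X2 U) / 2)
             (mi P (\<lambda>w. (X1 w, X2 w)) Y))))) \<le> capacity_formula C1 C2"
      unfolding Let_def fs
      by (rule lower_value_le[OF C fin, where U = fst and ?X1.0 = "\<lambda>w. fst (snd w)" and ?X2.0 = "\<lambda>w. snd (snd w)"]) (simp_all only: min_le_iff_disj order_refl simp_thms)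
  }
  fix p :: real assume p: "0 \<le> p" "p \<le> 1/2"
  then have p1: "p \<le> 1" by simp
  define P :: "(nat \<times> bool \<times> bool) pmf" where "P = map_pmf (Pair 0) (dsbs p)"
  have fin: "finite (set_pmf P)" by (simp add: P_def)
  have J: "map_pmf (\<lambda>w. (fst (snd w), snd (snd w))) P = dsbs p" by (simp add: P_def pmf.map_comp o_def)
  note q = dsbs_quantities[OF p(1) p1 fin J]
  have q1: "cmi P (\<lambda>w. fst (snd w)) (\<lambda>w. snd (snd w)) fst = 1 - h2 p"
    "cmi P (\<lambda>w. fst (snd w)) (\<lambda>w. adder (fst (snd w)) (snd (snd w))) (\<lambda>w. (snd (snd w), fst w)) = h2 p"
    "cmi P (\<lambda>w. snd (snd w)) (\<lambda>w. adder (fst (snd w)) (snd (snd w))) (\<lambda>w. (fst (snd w), fst w)) = h2 p"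
    "cmi P (\<lambda>w. (fst (snd w), snd (snd w))) (\<lambda>w. adder (fst (snd w)) (snd (snd w))) fst = h2 p + 1 - p"
    by (rule q; auto simp: P_def)+
  have q2: "mi P (\<lambda>w. (fst (snd w), snd (snd w))) (\<lambda>w. adder (fst (snd w)) (snd (snd w))) = h2 p + 1 - p"
    unfolding mi_def by (rule q) simp
  show "\<exists>P :: (nat \<times> bool \<times> bool) pmf\<in>{P. finite (set_pmf P)}. min (C1 + C2 - 1 + h2 p) (min (C1 + h2 p) (h2 p + 1 - p)) \<le>
    (let U = \<lambda>(u, x1, x2). u; X1 = \<lambda>(u, x1, x2). x1; X2 = \<lambda>(u, x1, x2). x2; Y = \<lambda>(u, x1, x2). adder x1 x2
      in min (C1 + C2 - cmi P X1 X2 U)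
      (min (C2 + cmi P X1 Y (\<lambda>w. (X2 w, U w)))
       (min (C1 + cmi P X2 Y (\<lambda>w. (X1 w, U w)))
        (min ((C1 + C2 + cmi P (\<lambda>w. (X1 w, X2 w)) Y U - cmi P X1 X2 U) / 2)
             (mi P (\<lambda>w. (X1 w, X2 w)) Y)))))"
    \<comment> \<open>With constant \<open>U\<close> the half-sum term is the arithmetic mean of the
      first and the last term, and \<open>C2 + h2 p\<close> is at least \<open>C1 + h2 p\<close>; so
      neither can be strictly smallest.\<close>
    by (rule bexI[of _ P]) (unfold Let_def fs q1 q2, use C fin in \<open>auto simp: min_def\<close>)
qed

text \<open>Brings the last term of the upper bound into the form of
  \<open>double_broadcast_bound\<close>, with H(U|Q) subtracted.\<close>

lemma upper_terms_eq:
  assumes fin: "finite (set_pmf J)"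
  shows "- cmi J (\<lambda>w. (X1 w, X2 w)) U Q + cmi J X2 U (\<lambda>w. (X1 w, Q w)) + cmi J X1 U (\<lambda>w. (X2 w, Q w))
    = ent J (\<lambda>w. (U w, X1 w, Q w)) - ent J (\<lambda>w. (X1 w, Q w)) + (ent J (\<lambda>w. (U w, X2 w, Q w)) - ent J (\<lambda>w. (X2 w, Q w)))
      - (ent J (\<lambda>w. (U w, X1 w, X2 w, Q w)) - ent J (\<lambda>w. (X1 w, X2 w, Q w))) - (ent J (\<lambda>w. (U w, Q w)) - ent J Q)"
proof -
  let ?H = "ent J (\<lambda>w. (X1 w, X2 w, Q w))" and ?HU = "ent J (\<lambda>w. (U w, X1 w, X2 w, Q w))"
  have "ent J (\<lambda>w. ((X1 w, X2 w), Q w)) = ?H" "ent J (\<lambda>w. (X2 w, X1 w, Q w)) = ?H"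
    "ent J (\<lambda>w. ((X1 w, X2 w), U w, Q w)) = ?HU" "ent J (\<lambda>w. (X2 w, U w, X1 w, Q w)) = ?HU" "ent J (\<lambda>w. (X1 w, U w, X2 w, Q w)) = ?HU"
    by (rule ent_eqI[OF fin]; auto)+
  then show ?thesis by (simp add: cmi_def)
qed

text \<open>The two sides differ by I(X1;X2|U,Q). Hence no choice of the channel to \<open>U\<close>
  can push the last term of the upper bound below \<open>C1 + C2\<close> minus I(X1;X2|Q).\<close>

lemma upper_terms_ge:
  assumes fin: "finite (set_pmf J)"
  shows "- cmi J X1 X2 Q
    \<le> - cmi J (\<lambda>w. (X1 w, X2 w)) U Q + cmi J X2 U (\<lambda>w. (X1 w, Q w)) + cmi J X1 U (\<lambda>w. (X2 w, Q w))"
proof -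
  have "ent J (\<lambda>w. (X1 w, X2 w, U w, Q w)) + ent J (\<lambda>w. (U w, Q w)) \<le> ent J (\<lambda>w. (X1 w, U w, Q w)) + ent J (\<lambda>w. (X2 w, U w, Q w))"
    by (rule ent_submodular[OF fin])
  moreover have "ent J (\<lambda>w. (X1 w, X2 w, U w, Q w)) = ent J (\<lambda>w. (U w, X1 w, X2 w, Q w))"
    "ent J (\<lambda>w. (X1 w, U w, Q w)) = ent J (\<lambda>w. (U w, X1 w, Q w))" "ent J (\<lambda>w. (X2 w, U w, Q w)) = ent J (\<lambda>w. (U w, X2 w, Q w))"
    by (rule ent_eqI[OF fin]; auto)+
  ultimately show ?thesis unfolding upper_terms_eq[OF fin] by (simp add: cmi_def)
qed

text \<open>The hypothesis \<open>main\<close> isolates what depends on a good choice of the channel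
  to \<open>U\<close>; outside the critical range of \<open>C1 + C2\<close> it is vacuous.\<close>

lemma upper_value_le:
  fixes X1 X2 :: "'a \<Rightarrow> bool" and Q :: "'a \<Rightarrow> 'q" and U :: "'a \<Rightarrow> 'u"
  assumes C: "0 \<le> C1" "C1 \<le> C2" and fin: "finite (set_pmf J)"
  defines "Y \<equiv> \<lambda>w. adder (X1 w) (X2 w)"
  assumes R1: "R \<le> C1 + C2" and R2: "R \<le> C1 + cmi J X2 Y (\<lambda>w. (X1 w, Q w))"
    and R3: "R \<le> cmi J (\<lambda>w. (X1 w, X2 w)) Y Q"
    and R4: "R \<le> C1 + C2 + (- cmi J (\<lambda>w. (X1 w, X2 w)) U Q + cmi J X2 U (\<lambda>w. (X1 w, Q w)) + cmi J X1 U (\<lambda>w. (X2 w, Q w)))"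
    and main: "\<And>p. 1/3 < p \<Longrightarrow> p < 1/2 \<Longrightarrow> C1 + C2 = 2 - p \<Longrightarrow>
       slope p * (ent J (\<lambda>w. (Y w, Q w)) - ent J Q) + (1 - slope p) *
         (- cmi J (\<lambda>w. (X1 w, X2 w)) U Q + cmi J X2 U (\<lambda>w. (X1 w, Q w)) + cmi J X1 U (\<lambda>w. (X2 w, Q w))) \<le> adder_rate p"
  shows "R \<le> capacity_formula C1 C2"
proof -
  obtain s where s: "0 \<le> s" "s \<le> 1"
    "ent J (\<lambda>w. (X1 w, X2 w, Q w)) - ent J (\<lambda>w. (X1 w, Q w)) \<le> h2 s" "ent J Y \<le> h2 s + 1 - s"
    unfolding Y_def by (rule single_letter_h2[OF fin, where ?X1.0 = X1 and ?X2.0 = X2 and U = Q])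
  have R3': "R \<le> ent J (\<lambda>w. (Y w, Q w)) - ent J Q" using R3 unfolding Y_def cmi_adder(3)[OF fin] .
  show ?thesis
  proof (rule le_capacity_formulaI[OF C s(1,2)])
    show "R \<le> C1 + h2 s" using R2 s(3) unfolding Y_def cmi_adder(2)[OF fin] by simp
    show "R \<le> h2 s + 1 - s" using R3' s(4) ent_subadditive[OF fin, of Y Q] by simp
    show "R \<le> C1 + C2" by (rule R1)
    fix p :: real assume p: "1/3 < p" "p < 1/2" "C1 + C2 = 2 - p"
    have "slope p * R \<le> slope p * (ent J (\<lambda>w. (Y w, Q w)) - ent J Q)"
      using R3' slope_bounds[OF p(1,2)] by (intro mult_left_mono) auto
    moreover have "(1 - slope p) * R \<le> (1 - slope p) * (C1 + C2 + (- cmi J (\<lambda>w. (X1 w, X2 w)) U Q + cmi J X2 U (\<lambda>w. (X1 w, Q w)) + cmi J X1 U (\<lambda>w. (X2 w, Q w))))"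
      using R4 slope_bounds[OF p(1,2)] by (intro mult_left_mono) auto
    ultimately show "R \<le> adder_rate p + (1 - slope p) * (C1 + C2)" using main[OF p] by (simp add: algebra_simps)
  qed
qed

lemma ub_joint_attach:
  "ub_joint P Kq (\<lambda>y. map_pmf f (V y)) = map_pmf (\<lambda>w. (fst (fst (fst w)), snd (fst (fst w)), snd (fst w), f (snd w)))
     (attach (attach P Kq) (\<lambda>x. V (adder (fst (fst x)) (snd (fst x)))))"
  by (simp add: ub_joint_def attach_def map_bind_pmf bind_assoc_pmf bind_map_pmf pmf.map_comp o_def case_prod_unfold map_pmf_def bind_return_pmf)

lemma finite_ub_joint:
  assumes "\<forall>x. finite (set_pmf (Kq x))" "\<forall>y. finite (set_pmf (Ku y))"
  shows "finite (set_pmf (ub_joint P Kq Ku))"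
proof -
  have "finite (set_pmf (attach (attach P Kq) (\<lambda>x. Ku (adder (fst (fst x)) (snd (fst x))))))"
    using assms by (intro finite_attach) auto
  then show ?thesis using ub_joint_attach[of P Kq "\<lambda>u. u" Ku] by simp
qed

lemma map_ub_joint: "map_pmf (\<lambda>w. (fst w, fst (snd w))) (ub_joint P Kq Ku) = P"
  by (simp add: ub_joint_def map_bind_pmf case_prod_beta map_pmf_const bind_const bind_return_pmf')

lemma ub_value_alt:
  "ub_value C1 C2 J = (let X1 = fst; X2 = (\<lambda>w. fst (snd w)); Q = (\<lambda>w. fst (snd (snd w))); U = (\<lambda>w. snd (snd (snd w)));
      Y = (\<lambda>w. adder (fst w) (fst (snd w))) in
    min (C1 + C2) (min (C1 + cmi J X2 Y (\<lambda>w. (X1 w, Q w))) (min (C2 + cmi J X1 Y (\<lambda>w. (X2 w, Q w)))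
      (min (cmi J (\<lambda>w. (X1 w, X2 w)) Y Q)
        (C1 + C2 + (- cmi J (\<lambda>w. (X1 w, X2 w)) U Q + cmi J X2 U (\<lambda>w. (X1 w, Q w)) + cmi J X1 U (\<lambda>w. (X2 w, Q w))))))))"
proof -
  have fs: "(\<lambda>(x1, x2, q, u). x1) = (fst :: bool \<times> bool \<times> nat \<times> nat \<Rightarrow> bool)" "(\<lambda>(x1, x2, q, u). x2) = (\<lambda>w :: bool \<times> bool \<times> nat \<times> nat. fst (snd w))"
    "(\<lambda>(x1, x2, q, u). q) = (\<lambda>w :: bool \<times> bool \<times> nat \<times> nat. fst (snd (snd w)))"
    "(\<lambda>(x1, x2, q, u). u) = (\<lambda>w :: bool \<times> bool \<times> nat \<times> nat. snd (snd (snd w)))"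
    "(\<lambda>(x1, x2, q, u). adder x1 x2) = (\<lambda>w :: bool \<times> bool \<times> nat \<times> nat. adder (fst w) (fst (snd w)))" by auto
  show ?thesis unfolding ub_value_def Let_def fs by (simp add: algebra_simps)
qed

text \<open>For an infimum over channels one good channel is enough. In the critical range it is the
  posterior channel for the p fixed by \<open>C1 + C2\<close>, with its bit read as a number;
  elsewhere a constant will do. \<open>double_broadcast_bound\<close> is uniform in
  \<open>Q\<close>, so no later choice of \<open>Kq\<close> can exceed the bound.\<close>

lemma ub_good_test_channel:
  assumes C: "0 \<le> C1" "C1 \<le> C2"
  obtains Ku where "\<forall>y. finite (set_pmf (Ku y))"
    "\<forall>Kq. (\<forall>x. finite (set_pmf (Kq x))) \<longrightarrow> ub_value C1 C2 (ub_joint P Kq Ku) \<le> capacity_formula C1 C2"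
proof (cases "\<exists>p. 1/3 < p \<and> p < 1/2 \<and> C1 + C2 = 2 - p")
  case False
  show ?thesis
  proof (rule that[of "\<lambda>_. return_pmf 0"], simp, intro allI impI)
    fix Kq :: "bool \<times> bool \<Rightarrow> nat pmf" assume "\<forall>x. finite (set_pmf (Kq x))"
    then have fin: "finite (set_pmf (ub_joint P Kq (\<lambda>_. return_pmf 0)))" by (intro finite_ub_joint) auto
    show "ub_value C1 C2 (ub_joint P Kq (\<lambda>_. return_pmf 0)) \<le> capacity_formula C1 C2"
      unfolding ub_value_alt Let_def
      by (rule upper_value_le[OF C fin, where ?X1.0 = fst and ?X2.0 = "\<lambda>w. fst (snd w)" and Q = "\<lambda>w. fst (snd (snd w))" and U = "\<lambda>w. snd (snd (snd w))"])
        (use False in \<open>auto simp only: min_le_iff_disj order_refl simp_thms\<close>)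
  qed
next
  case True
  then obtain p where pC: "1/3 < p" "p < 1/2" "C1 + C2 = 2 - p" by auto
  obtain \<alpha> \<beta> where "adder_test_channel \<alpha> p \<beta>" using test_channel_exists pC by blast
  then interpret adder_test_channel \<alpha> p \<beta> .
  let ?Ku = "\<lambda>y. map_pmf of_bool (chan y) :: nat pmf"
  show ?thesis
  proof (rule that[of ?Ku], simp, intro allI impI)
    fix Kq :: "bool \<times> bool \<Rightarrow> nat pmf" assume Kq: "\<forall>x. finite (set_pmf (Kq x))"
    define J where "J = ub_joint P Kq ?Ku"
    have fin: "finite (set_pmf J)" unfolding J_def using Kq by (intro finite_ub_joint) auto
    define B where "B = attach P Kq"
    define x1 x2 where "x1 w = fst (fst w)" and "x2 w = snd (fst w)" for w :: "(bool \<times> bool) \<times> nat"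
    define JJ where "JJ = attach B (\<lambda>x. chan (adder (x1 x) (x2 x)))"
    have finB: "finite (set_pmf B)" unfolding B_def using Kq by (intro finite_attach) auto
    have finJJ: "finite (set_pmf JJ)" unfolding JJ_def by (rule finite_attach[OF finB finite_chan])
    have J: "J = map_pmf (\<lambda>w. (x1 (fst w), x2 (fst w), snd (fst w), of_bool (snd w))) JJ"
      unfolding J_def JJ_def B_def x1_def x2_def by (rule ub_joint_attach)
    let ?X1 = "fst :: bool \<times> bool \<times> nat \<times> nat \<Rightarrow> bool" and ?X2 = "\<lambda>w :: bool \<times> bool \<times> nat \<times> nat. fst (snd w)"
      and ?Q = "\<lambda>w :: bool \<times> bool \<times> nat \<times> nat. fst (snd (snd w))" and ?U = "\<lambda>w :: bool \<times> bool \<times> nat \<times> nat. snd (snd (snd w))"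
    have eU: "ent J (\<lambda>w. (?U w, ?X1 w, ?Q w)) = ent JJ (\<lambda>w. (snd w, x1 (fst w), snd (fst w)))"
      "ent J (\<lambda>w. (?U w, ?X2 w, ?Q w)) = ent JJ (\<lambda>w. (snd w, x2 (fst w), snd (fst w)))"
      "ent J (\<lambda>w. (?U w, ?X1 w, ?X2 w, ?Q w)) = ent JJ (\<lambda>w. (snd w, x1 (fst w), x2 (fst w), snd (fst w)))"
      "ent J (\<lambda>w. (?U w, ?Q w)) = ent JJ (\<lambda>w. (snd w, snd (fst w)))"
      unfolding J ent_map by (rule ent_eqI[OF finJJ]; auto)+
    have eB: "ent J (\<lambda>w. g (?X1 w) (?X2 w) (?Q w)) = ent B (\<lambda>x. g (x1 x) (x2 x) (snd x))" for g :: "bool \<Rightarrow> bool \<Rightarrow> nat \<Rightarrow> 'z"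
      unfolding J ent_map JJ_def using ent_attach_fst[of B _ "\<lambda>x. g (x1 x) (x2 x) (snd x)"] by simp
    have D: "ent JJ (\<lambda>w. (snd w, x1 (fst w), snd (fst w))) - ent B (\<lambda>x. (x1 x, snd x))
      + (ent JJ (\<lambda>w. (snd w, x2 (fst w), snd (fst w))) - ent B (\<lambda>x. (x2 x, snd x)))
      - (ent JJ (\<lambda>w. (snd w, x1 (fst w), x2 (fst w), snd (fst w))) - ent B (\<lambda>x. (x1 x, x2 x, snd x)))
      \<le> wsum B (\<lambda>x. - log 2 (wt (adder (x1 x) (x2 x))))"
      unfolding JJ_def
      by (rule double_broadcast_bound[OF finB, where K = "\<lambda>x y. chan (adder x y)" and ?W1.0 = bsc and ?W2.0 = bsc])
        (auto simp: chan_factor wt_pos)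
    have A: "slope p * (ent B (\<lambda>x. (adder (x1 x) (x2 x), snd x)) - ent B snd)
     - (1 - slope p) * (ent JJ (\<lambda>w. (snd w, snd (fst w))) - ent B snd)
     + (1 - slope p) * wsum B (\<lambda>x. - log 2 (wt (adder (x1 x) (x2 x)))) \<le> adder_rate p"
      unfolding JJ_def by (rule adder_cond_bound[OF finB]) (auto simp: adder_range[simplified])
    have main: "slope p * (ent J (\<lambda>w. (adder (?X1 w) (?X2 w), ?Q w)) - ent J ?Q) + (1 - slope p) *
         (- cmi J (\<lambda>w. (?X1 w, ?X2 w)) ?U ?Q + cmi J ?X2 ?U (\<lambda>w. (?X1 w, ?Q w)) + cmi J ?X1 ?U (\<lambda>w. (?X2 w, ?Q w))) \<le> adder_rate p"
    proof -
      define E where "E = wsum B (\<lambda>x. - log 2 (wt (adder (x1 x) (x2 x))))"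
      define T where "T = ent JJ (\<lambda>w. (snd w, snd (fst w))) - ent B snd"
      have "- cmi J (\<lambda>w. (?X1 w, ?X2 w)) ?U ?Q + cmi J ?X2 ?U (\<lambda>w. (?X1 w, ?Q w)) + cmi J ?X1 ?U (\<lambda>w. (?X2 w, ?Q w)) \<le> E - T"
        unfolding upper_terms_eq[OF fin] eU
        using D eB[of "\<lambda>a b c. (a, c)"] eB[of "\<lambda>a b c. (b, c)"] eB[of "\<lambda>a b c. (a, b, c)"] eB[of "\<lambda>a b c. c"]
        by (simp add: E_def T_def)
      then have "(1 - slope p) * (- cmi J (\<lambda>w. (?X1 w, ?X2 w)) ?U ?Q + cmi J ?X2 ?U (\<lambda>w. (?X1 w, ?Q w)) + cmi J ?X1 ?U (\<lambda>w. (?X2 w, ?Q w)))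
        \<le> (1 - slope p) * (E - T)"
        using slope_bounds[OF p(1,2)] by (intro mult_left_mono) auto
      moreover have Yeq: "ent J (\<lambda>w. (adder (?X1 w) (?X2 w), ?Q w)) - ent J ?Q = ent B (\<lambda>x. (adder (x1 x) (x2 x), snd x)) - ent B snd"
        using eB[of "\<lambda>a b c. (adder a b, c)"] eB[of "\<lambda>a b c. c"] by simp
      ultimately show ?thesis using A unfolding Yeq E_def[symmetric] T_def[symmetric]
        by (simp only: right_diff_distrib[of "1 - slope p" E T])
    qed
    have "ub_value C1 C2 J \<le> capacity_formula C1 C2"
      unfolding ub_value_alt Let_def
    proof (rule upper_value_le[OF C fin, where ?X1.0 = ?X1 and ?X2.0 = ?X2 and Q = ?Q and U = ?U])
      fix p' :: real assume "C1 + C2 = 2 - p'"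
      then have "p' = p" using pC(3) by linarith
      then show "slope p' * (ent J (\<lambda>w. (adder (?X1 w) (?X2 w), ?Q w)) - ent J ?Q) + (1 - slope p') *
         (- cmi J (\<lambda>w. (?X1 w, ?X2 w)) ?U ?Q + cmi J ?X2 ?U (\<lambda>w. (?X1 w, ?Q w)) + cmi J ?X1 ?U (\<lambda>w. (?X2 w, ?Q w))) \<le> adder_rate p'"
        using main by simp
    qed (simp_all only: min_le_iff_disj order_refl simp_thms)
    then show "ub_value C1 C2 (ub_joint P Kq ?Ku) \<le> capacity_formula C1 C2" by (simp add: J_def)
  qed
qed

lemma upper_bound_eq:
  assumes C: "0 \<le> C1" "C1 \<le> C2"
  shows "upper_bound C1 C2 = capacity_formula C1 C2"
proof -
  let ?QK = "{Kq :: bool \<times> bool \<Rightarrow> nat pmf. \<forall>x. finite (set_pmf (Kq x))}"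
  let ?UK = "{Ku :: nat \<Rightarrow> nat pmf. \<forall>y. finite (set_pmf (Ku y))}"
  let ?v = "\<lambda>P Kq Ku. ub_value C1 C2 (ub_joint P Kq Ku)"
  \<comment> \<open>A constant \<open>Q\<close> bounds the inner supremum from below, whatever
    \<open>Ku\<close> is.\<close>
  let ?K0 = "\<lambda>_ :: bool \<times> bool. return_pmf (0::nat)"
  have bdd: "bdd_above ((\<lambda>Kq. ?v P Kq Ku) ` ?QK)" for P Ku
    by (rule bdd_aboveI2[of _ _ "C1 + C2"]) (simp add: ub_value_def Let_def)
  have K0: "?v P ?K0 Ku \<le> Sup ((\<lambda>Kq. ?v P Kq Ku) ` ?QK)" for P Ku
    by (rule cSUP_upper[OF _ bdd]) simp
  have fin0: "finite (set_pmf (ub_joint P ?K0 Ku))" if "Ku \<in> ?UK" for P Ku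
    using that by (intro finite_ub_joint) auto
  have Q0: "fst (snd (snd w)) = 0" if "w \<in> set_pmf (ub_joint P ?K0 Ku)" for w P Ku
    using that by (auto simp: ub_joint_def)
  let ?X1 = "fst :: bool \<times> bool \<times> nat \<times> nat \<Rightarrow> bool" and ?X2 = "\<lambda>w :: bool \<times> bool \<times> nat \<times> nat. fst (snd w)"
    and ?Q = "\<lambda>w :: bool \<times> bool \<times> nat \<times> nat. fst (snd (snd w))"
    and ?Y = "\<lambda>w :: bool \<times> bool \<times> nat \<times> nat. adder (fst w) (fst (snd w))"
  have v0: "r \<le> ?v P ?K0 Ku"
    if Ku: "Ku \<in> ?UK" and J: "J = ub_joint P ?K0 Ku"
      and r: "r \<le> C1 + C2" "r \<le> C1 + cmi J ?X2 ?Y (\<lambda>w. (?X1 w, ?Q w))" "r \<le> C2 + cmi J ?X1 ?Y (\<lambda>w. (?X2 w, ?Q w))"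
      "r \<le> cmi J (\<lambda>w. (?X1 w, ?X2 w)) ?Y ?Q" "r \<le> C1 + C2 - cmi J ?X1 ?X2 ?Q" for r P Ku J
  proof -
    have fin: "finite (set_pmf J)" unfolding J by (rule fin0[OF Ku])
    have "r \<le> C1 + C2 + (- cmi J (\<lambda>w. (?X1 w, ?X2 w)) (\<lambda>w. snd (snd (snd w))) ?Q + cmi J ?X2 (\<lambda>w. snd (snd (snd w))) (\<lambda>w. (?X1 w, ?Q w))
        + cmi J ?X1 (\<lambda>w. snd (snd (snd w))) (\<lambda>w. (?X2 w, ?Q w)))"
      using upper_terms_ge[OF fin, of ?X1 ?X2 ?Q "\<lambda>w. snd (snd (snd w))"] r(5) by linarith
    then show ?thesis unfolding ub_value_alt Let_def J[symmetric] using r(1-4) by (intro min.boundedI)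
  qed
  have "Sup ((\<lambda>P. Inf ((\<lambda>Ku. Sup ((\<lambda>Kq. ?v P Kq Ku) ` ?QK)) ` ?UK)) ` UNIV) = capacity_formula C1 C2"
  proof (rule cSUP_eq_capacity_formula)
    fix P :: "(bool \<times> bool) pmf"
    obtain Ku where Ku': "\<forall>y. finite (set_pmf (Ku y))" "\<forall>Kq. (\<forall>x. finite (set_pmf (Kq x))) \<longrightarrow> ?v P Kq Ku \<le> capacity_formula C1 C2"
      by (rule ub_good_test_channel[OF C, of P])
    then have Ku: "Ku \<in> ?UK" "\<And>Kq. Kq \<in> ?QK \<Longrightarrow> ?v P Kq Ku \<le> capacity_formula C1 C2" by simp_all
    let ?I = "cmi P fst snd (\<lambda>_. ())"
    \<comment> \<open>An infimum of reals lies below its members only if the set is bounded below.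
      The constant \<open>Q\<close> supplies a bound that depends on \<open>P\<close> but not on
      \<open>Ku\<close>.\<close>
    have "bdd_below ((\<lambda>Ku. Sup ((\<lambda>Kq. ?v P Kq Ku) ` ?QK)) ` ?UK)"
    proof (rule bdd_belowI2)
      fix Ku assume Ku: "Ku \<in> ?UK"
      define J where "J = ub_joint P ?K0 Ku"
      note fin = fin0[OF Ku, of P, folded J_def]
      have P: "P = map_pmf (\<lambda>w. (fst w, fst (snd w))) J" by (simp add: J_def map_ub_joint)
      have "cmi J fst (\<lambda>w. fst (snd w)) (\<lambda>w. fst (snd (snd w))) = ?I"
        unfolding cmi_def P ent_map
        by (intro arg_cong2[of _ _ _ _ minus] arg_cong2[of _ _ _ _ plus] ent_eqI[OF fin]) (simp_all add: Q0[of _ P Ku, folded J_def])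
      then have "min (C1 + C2) (min C1 (min C2 (min 0 (C1 + C2 - ?I)))) \<le> ?v P ?K0 Ku"
        using cmi_nonneg[OF fin, of ?X2 ?Y "\<lambda>w. (?X1 w, ?Q w)"] cmi_nonneg[OF fin, of ?X1 ?Y "\<lambda>w. (?X2 w, ?Q w)"]
          cmi_nonneg[OF fin, of "\<lambda>w. (?X1 w, ?X2 w)" ?Y ?Q]
        by (intro v0[OF Ku J_def]) linarith+
      then show "min (C1 + C2) (min C1 (min C2 (min 0 (C1 + C2 - ?I)))) \<le> Sup ((\<lambda>Kq. ?v P Kq Ku) ` ?QK)"
        using K0[of P Ku] by simp
    qed
    then have "Inf ((\<lambda>Ku. Sup ((\<lambda>Kq. ?v P Kq Ku) ` ?QK)) ` ?UK) \<le> Sup ((\<lambda>Kq. ?v P Kq Ku) ` ?QK)"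
      by (rule cINF_lower) (rule Ku(1))
    also have "\<dots> \<le> capacity_formula C1 C2"
    proof (rule cSUP_least)
      show "?QK \<noteq> {}" by (subst ex_in_conv[symmetric], rule exI[of _ ?K0]) simp
    qed (rule Ku(2))
    finally show "Inf ((\<lambda>Ku. Sup ((\<lambda>Kq. ?v P Kq Ku) ` ?QK)) ` ?UK) \<le> capacity_formula C1 C2" .
  next
    fix p :: real assume p: "0 \<le> p" "p \<le> 1/2"
    then have p1: "p \<le> 1" by simp
    have "min (C1 + C2 - 1 + h2 p) (min (C1 + h2 p) (h2 p + 1 - p)) \<le> Inf ((\<lambda>Ku. Sup ((\<lambda>Kq. ?v (dsbs p) Kq Ku) ` ?QK)) ` ?UK)"
    proof (rule cINF_greatest)
      show "?UK \<noteq> {}" by (subst ex_in_conv[symmetric], rule exI[of _ "\<lambda>_. return_pmf 0"]) simp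
      fix Ku assume Ku: "Ku \<in> ?UK"
      define J where "J = ub_joint (dsbs p) ?K0 Ku"
      note fin = fin0[OF Ku, of "dsbs p", folded J_def]
      have J: "map_pmf (\<lambda>w. (fst w, fst (snd w))) J = dsbs p" by (simp add: J_def map_ub_joint)
      have Q: "fst (snd (snd w)) = fst (snd (snd w'))" if "w \<in> set_pmf J" "w' \<in> set_pmf J" for w w'
        using that by (simp add: Q0[of _ "dsbs p" Ku, folded J_def])
      note q = dsbs_quantities[OF p(1) p1 fin J, of "\<lambda>w. fst (snd (snd w))", OF Q]
      have "min (C1 + C2 - 1 + h2 p) (min (C1 + h2 p) (h2 p + 1 - p)) \<le> ?v (dsbs p) ?K0 Ku"
        using q C h2_le_1[OF p(1) p1] by (intro v0[OF Ku J_def]) linarith+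
      then show "min (C1 + C2 - 1 + h2 p) (min (C1 + h2 p) (h2 p + 1 - p)) \<le> Sup ((\<lambda>Kq. ?v (dsbs p) Kq Ku) ` ?QK)"
        using K0[of "dsbs p" Ku] by simp
    qed
    then show "\<exists>P\<in>UNIV. min (C1 + C2 - 1 + h2 p) (min (C1 + h2 p) (h2 p + 1 - p)) \<le> Inf ((\<lambda>Ku. Sup ((\<lambda>Kq. ?v P Kq Ku) ` ?QK)) ` ?UK)"
      by (rule bexI[OF _ UNIV_I])
  qed
  then show ?thesis unfolding upper_bound_def .
qed

section \<open>The converse\<close>

lemma wsum_indicator:
  assumes "finite (set_pmf P)"
  shows "wsum P (\<lambda>w. if w \<in> A then 1 else 0) = measure_pmf.prob P A"
proof -
  have "measure_pmf.prob P A = measure_pmf.prob P (A \<inter> set_pmf P)" by (simp add: measure_Int_set_pmf)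
  also have "\<dots> = (\<Sum>w\<in>A \<inter> set_pmf P. pmf P w)" using assms by (intro measure_measure_pmf_finite) auto
  also have "\<dots> = wsum P (\<lambda>w. if w \<in> A then 1 else 0)"
    unfolding wsum_def using assms by (intro sum.mono_neutral_cong_left) auto
  finally show ?thesis by simp
qed

text \<open>The reference kernel puts mass \<open>1 - e\<close> on the decoded message and spreads
  \<open>e\<close> evenly over all messages. Its cross entropy costs about \<open>log 2 M\<close>
  only in the event of an error.\<close>

lemma fano:
  fixes M :: nat and Y :: "nat \<Rightarrow> 'y" and d :: "'y \<Rightarrow> nat"
  assumes M: "M \<ge> 1" and e: "0 < e" "e < 1"
    and err: "measure_pmf.prob (pmf_of_set {1..M}) {w. d (Y w) \<noteq> w} < e"
  shows "(1 - e) * log 2 M \<le> ent (pmf_of_set {1..M}) Y - log 2 (1 - e) - e * log 2 e"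
proof -
  let ?W = "pmf_of_set {1..M}"
  have S: "set_pmf ?W = {1..M}" using M by (intro set_pmf_of_set) auto
  have fin: "finite (set_pmf ?W)" unfolding S by simp
  define k where "k y w = (if d y = w then 1 - e else 0) + e / M" for y w
  have "ent ?W (\<lambda>w. (w, Y w)) - ent ?W Y \<le> wsum ?W (\<lambda>w. - log 2 (k (Y w) w))"
  proof (rule cond_ent_le_cross[OF fin])
    show "0 \<le> k y w" for y w using e by (simp add: k_def)
    show "0 < k (Y w) w" for w using e M by (simp add: k_def add_nonneg_pos)
    fix y
    have "(\<Sum>w\<in>{1..M}. k y w) = (if d y \<in> {1..M} then 1 - e else 0) + e"
      using M by (simp add: k_def sum.distrib sum.delta)
    then show "(\<Sum>w\<in>(\<lambda>w. w) ` set_pmf ?W. k y w) \<le> 1" unfolding S image_ident using e by simp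
  qed
  also have "\<dots> \<le> wsum ?W (\<lambda>w. - log 2 (1 - e) + (log 2 M - log 2 e) * (if w \<in> {w. d (Y w) \<noteq> w} then 1 else 0))"
  proof (rule wsum_mono)
    fix w
    have le: "log 2 e \<le> 0" "log 2 (1 - e) \<le> 0" using e by auto
    show "- log 2 (k (Y w) w) \<le> - log 2 (1 - e) + (log 2 M - log 2 e) * (if w \<in> {w. d (Y w) \<noteq> w} then 1 else 0)"
    proof (cases "d (Y w) = w")
      case True
      then have "log 2 (1 - e) \<le> log 2 (k (Y w) w)" using e M by (intro log_mono) (auto simp: k_def)
      then show ?thesis using True by simp
    next
      case False
      then have "log 2 (k (Y w) w) = log 2 e - log 2 M" using e M by (simp add: k_def log_divide)
      then show ?thesis using False le by simp
    qed
  qed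
  also have "\<dots> = - log 2 (1 - e) + (log 2 M - log 2 e) * measure_pmf.prob ?W {w. d (Y w) \<noteq> w}"
    by (simp only: wsum_add wsum_const[OF fin] wsum_cmult wsum_indicator[OF fin])
  also have "\<dots> \<le> - log 2 (1 - e) + (log 2 M - log 2 e) * e"
  proof -
    have "0 \<le> log 2 M - log 2 e" using e M by (simp add: order_trans[of _ 0])
    then show ?thesis using err by (simp add: mult_left_mono)
  qed
  finally have 1: "ent ?W (\<lambda>w. (w, Y w)) - ent ?W Y \<le> - log 2 (1 - e) + (log 2 M - log 2 e) * e" .
  have "ent ?W (\<lambda>w. (w, Y w)) = ent ?W (\<lambda>w. w)" by (rule ent_eqI[OF fin]) auto
  also have "\<dots> = wsum ?W (\<lambda>w. log 2 M)"
    unfolding ent_wsum[OF fin] using M by (intro wsum_cong) (auto simp: S log_divide)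
  also have "\<dots> = log 2 M" by (rule wsum_const[OF fin])
  finally show ?thesis using 1 by (simp add: algebra_simps)
qed

lemma achievable_le:
  assumes C: "0 \<le> C1" "C1 \<le> C2" and R: "achievable C1 C2 R"
  shows "R \<le> capacity_formula C1 C2"
proof (cases "R \<le> 0")
  case True
  then show ?thesis using capacity_formula_nonneg[OF C] by simp
next
  case False
  let ?F = "capacity_formula C1 C2"
  have key: "(1 - e) * R \<le> ?F - log 2 (1 - e) - e * log 2 e" if e: "0 < e" "e < 1" for e
  proof -
    from R[unfolded achievable_def, rule_format, OF e(1)]
    obtain n :: nat and e1 e2 :: "nat \<Rightarrow> nat" and r1 r2 :: "nat \<Rightarrow> bool list" and d :: "nat list \<Rightarrow> nat" where n: "n \<ge> 1"
      and code: "let M = nat \<lceil>2 powr (real n * R)\<rceil>; W = pmf_of_set {1..M} in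
           (\<forall>v. length (r1 v) = n) \<and> (\<forall>v. length (r2 v) = n) \<and>
           ent W e1 \<le> real n * C1 \<and> ent W e2 \<le> real n * C2 \<and>
           measure_pmf.prob W {w. d (map2 adder (r1 (e1 w)) (r2 (e2 w))) \<noteq> w} < e"
      by blast
    define M where "M = nat \<lceil>2 powr (real n * R)\<rceil>"
    define W where "W = pmf_of_set {1..M}"
    have len: "\<forall>v. length (r1 v) = n" "\<forall>v. length (r2 v) = n"
      and H: "ent W e1 \<le> real n * C1" "ent W e2 \<le> real n * C2"
      and err: "measure_pmf.prob W {w. d (map2 adder (r1 (e1 w)) (r2 (e2 w))) \<noteq> w} < e"
      using code unfolding Let_def M_def[symmetric] W_def[symmetric] by simp_all
    have "0 < 2 powr (real n * R)" by simp
    then have M1: "M \<ge> 1" and M2: "2 powr (real n * R) \<le> real M" unfolding M_def by linarith+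
    have S: "set_pmf W = {1..M}" using M1 unfolding W_def by (intro set_pmf_of_set) auto
    have fin: "finite (set_pmf W)" unfolding S by simp
    let ?X1 = "\<lambda>w. r1 (e1 w)" and ?X2 = "\<lambda>w. r2 (e2 w)"
    have "ent W ?X1 \<le> ent W e1" "ent W ?X2 \<le> ent W e2" by (rule ent_mono[OF fin]; simp)+
    then have "ent W (\<lambda>w. map2 adder (?X1 w) (?X2 w)) \<le> real n * ?F"
      using H len by (intro ent_output_block_le[OF C fin n]) auto
    moreover have "(1 - e) * log 2 M \<le> ent W (\<lambda>w. map2 adder (?X1 w) (?X2 w)) - log 2 (1 - e) - e * log 2 e"
      using fano[OF M1 e, of d "\<lambda>w. map2 adder (?X1 w) (?X2 w)"] err unfolding W_def by simp
    moreover have "real n * R \<le> log 2 M"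
    proof -
      have "log 2 (2 powr (real n * R)) \<le> log 2 (real M)" using M2 by (intro log_mono) auto
      then show ?thesis by simp
    qed
    then have "(1 - e) * (real n * R) \<le> (1 - e) * log 2 M" using e by (intro mult_left_mono) auto
    ultimately have "(1 - e) * (real n * R) \<le> real n * ?F + (- log 2 (1 - e) - e * log 2 e)" by simp
    \<comment> \<open>The block length comes with \<open>e\<close> and is not controlled.
      Multiplying the nonnegative correction by n \<ge> 1 yields a bound without n, in which e can
      tend to 0.\<close>
    also have "\<dots> \<le> real n * ?F + real n * (- log 2 (1 - e) - e * log 2 e)"
    proof -
      have "log 2 (1 - e) \<le> 0" "e * log 2 e \<le> 0" using e by (auto intro: mult_nonneg_nonpos)
      then have "1 * (- log 2 (1 - e) - e * log 2 e) \<le> real n * (- log 2 (1 - e) - e * log 2 e)"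
        using n by (intro mult_right_mono) auto
      then show ?thesis by simp
    qed
    finally have "real n * ((1 - e) * R) \<le> real n * (?F - log 2 (1 - e) - e * log 2 e)" by (simp add: algebra_simps)
    then show ?thesis using n by (simp only: mult_le_cancel_left_pos)
  qed
  have "((\<lambda>e. (1 - e) * R) \<longlongrightarrow> R) (at_right 0)"
    by (auto intro!: tendsto_eq_intros)
  moreover have "((\<lambda>e. ?F - log 2 (1 - e) - e * log 2 e) \<longlongrightarrow> ?F) (at_right 0)"
  proof -
    have "((\<lambda>e. ln (1 - e) / ln 2 + e * ln e / ln 2) \<longlongrightarrow> 0) (at_right (0::real))" by real_asymp
    from tendsto_diff[OF tendsto_const this, of ?F] show ?thesis by (simp add: log_def diff_diff_eq)
  qed
  moreover have "eventually (\<lambda>e::real. 0 < e \<and> e < 1) (at_right 0)"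
    using eventually_at_right_real[of 0 1] by simp
  then have "eventually (\<lambda>e. (1 - e) * R \<le> ?F - log 2 (1 - e) - e * log 2 e) (at_right 0)"
    by (rule eventually_mono) (use key in auto)
  ultimately show ?thesis by (intro tendsto_le[OF trivial_limit_at_right_real])
qed

section \<open>Achievability\<close>

lemma exists_ge_average:
  fixes f :: "'a \<Rightarrow> real"
  assumes "finite X" "X \<noteq> {}"
  shows "\<exists>x\<in>X. sum f X / card X \<le> f x"
proof (rule ccontr)
  assume "\<not> ?thesis"
  then have "\<And>x. x \<in> X \<Longrightarrow> f x < sum f X / card X" by force
  then have "sum f X < (\<Sum>x\<in>X. sum f X / card X)" using assms by (intro sum_strict_mono) auto
  then show False using assms by simp
qed

text \<open>Method of conditional expectations: the right-hand side is the expectation of the left-hand side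
  for \<open>xs\<close> with independent uniform entries.\<close>
lemma quadratic_pick:
  fixes G :: "'a \<Rightarrow> real" and K :: "'a \<Rightarrow> 'a \<Rightarrow> real"
  assumes X: "finite X" "X \<noteq> {}"
  defines "D \<equiv> real (card X)"
  shows "\<exists>xs. length xs = N \<and> set xs \<subseteq> X \<and>
    (\<Sum>x\<leftarrow>xs. G x) - (\<Sum>x\<leftarrow>xs. \<Sum>z\<leftarrow>xs. K x z)
      \<ge> real N * ((\<Sum>x\<in>X. G x) - (\<Sum>x\<in>X. K x x)) / D - real N * (real N - 1) * (\<Sum>x\<in>X. \<Sum>z\<in>X. K x z) / D\<^sup>2"
proof (induction N arbitrary: G)
  case 0
  show ?case by (rule exI[of _ "[]"]) simp
next
  case (Suc N)
  have D: "D > 0" using X by (simp add: D_def card_gt_0_iff)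
  define kk where "kk = (\<Sum>x\<in>X. \<Sum>z\<in>X. K x z)"
  define gd where "gd = (\<Sum>x\<in>X. G x) - (\<Sum>x\<in>X. K x x)"
  \<comment> \<open>The conditional expectation of the objective once the first entry is
    \<open>x\<close>. The cross terms of \<open>x\<close> with later entries are linear in those, so
    they are absorbed into \<open>G\<close> for the induction hypothesis.\<close>
  define \<Phi> where "\<Phi> x = G x - K x x + real N * (gd - (\<Sum>z\<in>X. K x z) - (\<Sum>z\<in>X. K z x)) / D - real N * (real N - 1) * kk / D\<^sup>2" for x
  obtain x where x: "x \<in> X" "sum \<Phi> X / D \<le> \<Phi> x" using exists_ge_average[OF X, of \<Phi>] by (auto simp: D_def)
  have "sum \<Phi> X = gd + real N * (D * gd - kk - kk) / D - D * (real N * (real N - 1) * kk / D\<^sup>2)"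
  proof -
    have "(\<Sum>x\<in>X. \<Sum>z\<in>X. K z x) = kk" unfolding kk_def by (rule sum.swap)
    then have "(\<Sum>x\<in>X. gd - (\<Sum>z\<in>X. K x z) - (\<Sum>z\<in>X. K z x)) = D * gd - kk - kk"
      by (simp add: sum_subtractf kk_def D_def)
    then show ?thesis unfolding \<Phi>_def
      by (simp add: sum.distrib sum_subtractf sum_distrib_left[symmetric] sum_divide_distrib[symmetric] gd_def D_def)
  qed
  moreover define k g where "k = kk / D\<^sup>2" and "g = gd / D"
  then have kg: "kk = k * D\<^sup>2" "gd = g * D" using D by auto
  have "real N * (D * gd - kk - kk) / D = real N * (g * D - 2 * k * D)"
    unfolding kg using D by (simp add: field_simps power2_eq_square)
  moreover have "D * (real N * (real N - 1) * kk / D\<^sup>2) = D * (real N * (real N - 1) * k)" unfolding kg using D by simp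
  ultimately have "sum \<Phi> X = g * D + real N * (g * D - 2 * k * D) - D * (real N * (real N - 1) * k)" by (simp only: kg(2))
  then have "sum \<Phi> X / D = real (Suc N) * g - real (Suc N) * (real (Suc N) - 1) * k"
    using D by (simp add: field_simps)
  then have avg: "sum \<Phi> X / D = real (Suc N) * gd / D - real (Suc N) * (real (Suc N) - 1) * kk / D\<^sup>2"
    by (simp add: k_def g_def)
  obtain xs where xs: "length xs = N" "set xs \<subseteq> X"
    and le: "(\<Sum>z\<leftarrow>xs. G z - K x z - K z x) - (\<Sum>y\<leftarrow>xs. \<Sum>z\<leftarrow>xs. K y z)
      \<ge> real N * ((\<Sum>z\<in>X. G z - K x z - K z x) - (\<Sum>x\<in>X. K x x)) / D - real N * (real N - 1) * kk / D\<^sup>2"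
    using Suc.IH[of "\<lambda>z. G z - K x z - K z x"] unfolding kk_def by blast
  have s: "(\<Sum>z\<in>X. G z - K x z - K z x) - (\<Sum>x\<in>X. K x x) = gd - (\<Sum>z\<in>X. K x z) - (\<Sum>z\<in>X. K z x)"
    by (simp add: gd_def sum_subtractf)
  have "(\<Sum>y\<leftarrow>x # xs. G y) - (\<Sum>y\<leftarrow>x # xs. \<Sum>z\<leftarrow>x # xs. K y z)
    = G x - K x x + ((\<Sum>z\<leftarrow>xs. G z - K x z - K z x) - (\<Sum>y\<leftarrow>xs. \<Sum>z\<leftarrow>xs. K y z))"
    by (simp add: sum_list_addf sum_list_subtractf)
  also have "\<dots> \<ge> \<Phi> x" using le unfolding s \<Phi>_def by simp
  finally have "real (Suc N) * gd / D - real (Suc N) * (real (Suc N) - 1) * kk / D\<^sup>2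
     \<le> (\<Sum>y\<leftarrow>x # xs. G y) - (\<Sum>y\<leftarrow>x # xs. \<Sum>z\<leftarrow>x # xs. K y z)" using x(2) avg by simp
  then show ?case using xs x(1) unfolding gd_def kk_def by (intro exI[of _ "x # xs"]) auto
qed

lemma sum_list_sum_swap: "(\<Sum>x\<leftarrow>xs. \<Sum>y\<in>A. h x y) = (\<Sum>y\<in>A. \<Sum>x\<leftarrow>xs. (h x y :: real))"
  by (induction xs) (auto simp: sum.distrib)

lemma sum_list_mult_sum_list: "(\<Sum>x\<leftarrow>xs. a x) * (\<Sum>z\<leftarrow>ys. b z) = (\<Sum>x\<leftarrow>xs. \<Sum>z\<leftarrow>ys. a x * (b z :: real))"
  by (simp add: sum_list_mult_const sum_list_const_mult)

text \<open>Let r y be the number of index pairs representing y. Then 3 * r y - (r y)^2 is at most 2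
  if y is hit and 0 otherwise, and the sum of these over \<open>Ys\<close> is quadratic in each
  list. In the bracket, \<open>N1 / D\<close> and \<open>N2 / D\<close> pay for repeated entries of
  one list: by cancellation, two representations of y sharing a coordinate coincide. The last loss
  pays for coincidences of sums with both positions different.\<close>

lemma sumset_pick:
  fixes f :: "'a \<Rightarrow> 'a \<Rightarrow> 'y" and N1 N2 L :: nat
  assumes X: "finite X" "X \<noteq> {}" and Ys: "finite Ys"
    and L: "\<And>y. y \<in> Ys \<Longrightarrow> card {(x, z). x \<in> X \<and> z \<in> X \<and> f x z = y} = L"
    and cr: "\<And>x z z'. x \<in> X \<Longrightarrow> z \<in> X \<Longrightarrow> z' \<in> X \<Longrightarrow> f x z = f x z' \<Longrightarrow> z = z'"
    and cl: "\<And>x x' z. x \<in> X \<Longrightarrow> x' \<in> X \<Longrightarrow> z \<in> X \<Longrightarrow> f x z = f x' z \<Longrightarrow> x = x'"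
  defines "D \<equiv> real (card X)"
  shows "\<exists>xs zs. length xs = N1 \<and> length zs = N2 \<and> set xs \<subseteq> X \<and> set zs \<subseteq> X \<and>
    real N1 * real N2 * (real (card Ys) * real L / D\<^sup>2) * (2 - N1 / D - N2 / D - real N1 * real N2 * real L / D\<^sup>2)
      \<le> 2 * card {y \<in> Ys. \<exists>x\<in>set xs. \<exists>z\<in>set zs. f x z = y}"
proof -
  have D: "D > 0" using X by (simp add: D_def card_gt_0_iff)
  define \<delta> :: "'y \<Rightarrow> 'a \<Rightarrow> 'a \<Rightarrow> real" where "\<delta> y x z = of_bool (f x z = y)" for y x z
  define S where "S = real (card Ys) * real L"
  have dd: "\<delta> y x z * \<delta> y x z = \<delta> y x z" for y x z by (cases "f x z = y") (auto simp: \<delta>_def)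
  have \<delta>0: "0 \<le> \<delta> y x z" for y x z by (simp add: \<delta>_def)
  have rep: "(\<Sum>x\<in>X. \<Sum>z\<in>X. \<delta> y x z) = L" if "y \<in> Ys" for y
  proof -
    have "(\<Sum>x\<in>X. \<Sum>z\<in>X. \<delta> y x z) = (\<Sum>p\<in>X \<times> X. of_bool (f (fst p) (snd p) = y))"
      by (simp add: sum.cartesian_product' \<delta>_def)
    also have "\<dots> = real (card {p \<in> X \<times> X. f (fst p) (snd p) = y})" using X by (simp add: of_bool_def sum.inter_filter[symmetric])
    also have "{p \<in> X \<times> X. f (fst p) (snd p) = y} = {(x, z). x \<in> X \<and> z \<in> X \<and> f x z = y}" by auto
    finally show ?thesis using L[OF that] by simp
  qed
  have le1: "(\<Sum>x\<in>A. of_bool (g x)) \<le> (1::real)" if "finite A" "\<And>x x'. x \<in> A \<Longrightarrow> x' \<in> A \<Longrightarrow> g x \<Longrightarrow> g x' \<Longrightarrow> x = x'" for A :: "'a set" and g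
  proof -
    have "(\<Sum>x\<in>A. of_bool (g x) :: real) = real (card {x\<in>A. g x})" using that(1) by (simp add: of_bool_def sum.inter_filter[symmetric])
    moreover have "card {x\<in>A. g x} \<le> 1" using that by (subst card_le_Suc0_iff_eq[simplified One_nat_def[symmetric]]) auto
    ultimately show ?thesis by simp
  qed
  have c1: "(\<Sum>x\<in>X. \<delta> y x z) \<le> 1" if "z \<in> X" for y z unfolding \<delta>_def using X cl that by (intro le1) auto
  have c2: "(\<Sum>z\<in>X. \<delta> y x z) \<le> 1" if "x \<in> X" for y x unfolding \<delta>_def using X cr that by (intro le1) auto
  have sq: "t * t \<le> t" if "0 \<le> t" "t \<le> 1" for t :: real using that by (simp add: mult_left_le)
  define c where "c y z = (\<Sum>x\<in>X. \<delta> y x z)" for y z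
  \<comment> \<open>\<open>G2\<close> and \<open>K2\<close> are chosen so that the objective in
    \<open>zs\<close> is the average over \<open>xs\<close> of the final objective (see
    \<open>link\<close>). Thus \<open>zs\<close> can be fixed before \<open>xs\<close>, by the same
    lemma.\<close>
  define G2 where "G2 z = N1 / D * (3 * (\<Sum>y\<in>Ys. c y z))" for z
  define K2 where "K2 z z' = N1 / D * (\<Sum>y\<in>Ys. \<Sum>x\<in>X. \<delta> y x z * \<delta> y x z') + N1 * (real N1 - 1) / D\<^sup>2 * (\<Sum>y\<in>Ys. c y z * c y z')" for z z'
  obtain zs where zs: "length zs = N2" "set zs \<subseteq> X"
    and zs_le: "real N2 * ((\<Sum>z\<in>X. G2 z) - (\<Sum>z\<in>X. K2 z z)) / D - real N2 * (real N2 - 1) * (\<Sum>z\<in>X. \<Sum>z'\<in>X. K2 z z') / D\<^sup>2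
      \<le> (\<Sum>z\<leftarrow>zs. G2 z) - (\<Sum>z\<leftarrow>zs. \<Sum>z'\<leftarrow>zs. K2 z z')"
    using quadratic_pick[OF X, of N2 G2 K2] unfolding D_def by blast
  define a where "a y x = (\<Sum>z\<leftarrow>zs. \<delta> y x z)" for y x
  define G where "G x = 3 * (\<Sum>y\<in>Ys. a y x)" for x
  define K where "K x x' = (\<Sum>y\<in>Ys. a y x * a y x')" for x x'
  obtain xs where xs: "length xs = N1" "set xs \<subseteq> X"
    and xs_le: "real N1 * ((\<Sum>x\<in>X. G x) - (\<Sum>x\<in>X. K x x)) / D - real N1 * (real N1 - 1) * (\<Sum>x\<in>X. \<Sum>x'\<in>X. K x x') / D\<^sup>2
      \<le> (\<Sum>x\<leftarrow>xs. G x) - (\<Sum>x\<leftarrow>xs. \<Sum>x'\<leftarrow>xs. K x x')"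
    using quadratic_pick[OF X, of N1 G K] unfolding D_def by blast
  have swap: "(\<Sum>x\<in>X. a y x) = (\<Sum>z\<leftarrow>zs. c y z)" for y unfolding a_def c_def by (rule sum_list_sum_swap[symmetric])
  have sG: "(\<Sum>x\<in>X. G x) = (\<Sum>z\<leftarrow>zs. 3 * (\<Sum>y\<in>Ys. c y z))"
    unfolding G_def sum_distrib_left[symmetric] sum_list_const_mult
    by (subst sum.swap) (simp add: swap sum_list_sum_swap)
  have sKd: "(\<Sum>x\<in>X. K x x) = (\<Sum>z\<leftarrow>zs. \<Sum>z'\<leftarrow>zs. \<Sum>y\<in>Ys. \<Sum>x\<in>X. \<delta> y x z * \<delta> y x z')"
    unfolding K_def a_def sum_list_mult_sum_list
    by (subst sum.swap) (simp add: sum_list_sum_swap)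
  have sK: "(\<Sum>x\<in>X. \<Sum>x'\<in>X. K x x') = (\<Sum>z\<leftarrow>zs. \<Sum>z'\<leftarrow>zs. \<Sum>y\<in>Ys. c y z * c y z')"
  proof -
    have "(\<Sum>x\<in>X. \<Sum>x'\<in>X. K x x') = (\<Sum>x\<in>X. \<Sum>y\<in>Ys. a y x * (\<Sum>x'\<in>X. a y x'))"
      unfolding K_def by (rule sum.cong[OF refl]) (subst sum.swap, simp add: sum_distrib_left)
    also have "\<dots> = (\<Sum>y\<in>Ys. (\<Sum>x\<in>X. a y x) * (\<Sum>x'\<in>X. a y x'))"
      by (subst sum.swap) (simp add: sum_distrib_right)
    also have "\<dots> = (\<Sum>z\<leftarrow>zs. \<Sum>z'\<leftarrow>zs. \<Sum>y\<in>Ys. c y z * c y z')"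
      unfolding swap sum_list_mult_sum_list by (simp add: sum_list_sum_swap)
    finally show ?thesis .
  qed
  have link: "real N1 * ((\<Sum>x\<in>X. G x) - (\<Sum>x\<in>X. K x x)) / D - real N1 * (real N1 - 1) * (\<Sum>x\<in>X. \<Sum>x'\<in>X. K x x') / D\<^sup>2
    = (\<Sum>z\<leftarrow>zs. G2 z) - (\<Sum>z\<leftarrow>zs. \<Sum>z'\<leftarrow>zs. K2 z z')"
  proof -
    have "(\<Sum>z\<leftarrow>zs. G2 z) = N1 / D * (\<Sum>z\<leftarrow>zs. 3 * (\<Sum>y\<in>Ys. c y z))"
      unfolding G2_def by (rule sum_list_const_mult)
    moreover have "(\<Sum>z\<leftarrow>zs. \<Sum>z'\<leftarrow>zs. K2 z z') = N1 / D * (\<Sum>z\<leftarrow>zs. \<Sum>z'\<leftarrow>zs. \<Sum>y\<in>Ys. \<Sum>x\<in>X. \<delta> y x z * \<delta> y x z')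
        + N1 * (real N1 - 1) / D\<^sup>2 * (\<Sum>z\<leftarrow>zs. \<Sum>z'\<leftarrow>zs. \<Sum>y\<in>Ys. c y z * c y z')"
      unfolding K2_def by (simp only: sum_list_addf sum_list_const_mult)
    moreover have "x * (A - B) / u - x * y * C / v = x / u * A - (x / u * B + x * y / v * C)" for x y u v A B C :: real
      by (simp add: right_diff_distrib diff_divide_distrib)
    ultimately show ?thesis unfolding sG sKd sK by (simp only:)
  qed
  have cL: "(\<Sum>z\<in>X. c y z) = L" if "y \<in> Ys" for y unfolding c_def by (subst sum.swap) (rule rep[OF that])
  have SY: "(\<Sum>y\<in>Ys. \<Sum>z\<in>X. c y z) = S" by (simp add: cL S_def)
  have SZ: "(\<Sum>z\<in>X. \<Sum>y\<in>Ys. c y z) = S" by (subst sum.swap) (rule SY)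
  have sG2: "(\<Sum>z\<in>X. G2 z) = N1 / D * (3 * S)"
    unfolding G2_def sum_distrib_left[symmetric] by (simp add: SZ)
  have n1: "0 \<le> real N1 * (real N1 - 1)" "0 \<le> real N2 * (real N2 - 1)" by (cases N1; simp) (cases N2; simp)
  have sK2d: "(\<Sum>z\<in>X. K2 z z) \<le> N1 / D * S + N1 * (real N1 - 1) / D\<^sup>2 * S"
  proof -
    have "(\<Sum>z\<in>X. \<Sum>y\<in>Ys. \<Sum>x\<in>X. \<delta> y x z * \<delta> y x z) = S"
      using SZ unfolding c_def by (simp add: dd)
    moreover have "(\<Sum>z\<in>X. \<Sum>y\<in>Ys. c y z * c y z) \<le> S"
    proof -
      have "(\<Sum>z\<in>X. \<Sum>y\<in>Ys. c y z * c y z) \<le> (\<Sum>z\<in>X. \<Sum>y\<in>Ys. c y z)"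
        unfolding c_def by (intro sum_mono sq c1 sum_nonneg) (auto simp: \<delta>0)
      then show ?thesis by (simp add: SZ)
    qed
    then have "N1 * (real N1 - 1) / D\<^sup>2 * (\<Sum>z\<in>X. \<Sum>y\<in>Ys. c y z * c y z) \<le> N1 * (real N1 - 1) / D\<^sup>2 * S"
      using n1 D by (intro mult_left_mono) auto
    ultimately show ?thesis unfolding K2_def sum.distrib sum_distrib_left[symmetric] by simp
  qed
  have sK2: "(\<Sum>z\<in>X. \<Sum>z'\<in>X. K2 z z') \<le> N1 / D * S + N1 * (real N1 - 1) / D\<^sup>2 * (L * S)"
  proof -
    have "(\<Sum>z\<in>X. \<Sum>z'\<in>X. \<Sum>y\<in>Ys. \<Sum>x\<in>X. \<delta> y x z * \<delta> y x z') = (\<Sum>y\<in>Ys. \<Sum>x\<in>X. (\<Sum>z\<in>X. \<delta> y x z) * (\<Sum>z'\<in>X. \<delta> y x z'))"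
    proof -
      have "(\<Sum>z\<in>X. \<Sum>z'\<in>X. \<Sum>y\<in>Ys. \<Sum>x\<in>X. \<delta> y x z * \<delta> y x z') = (\<Sum>z\<in>X. \<Sum>y\<in>Ys. \<Sum>x\<in>X. \<Sum>z'\<in>X. \<delta> y x z * \<delta> y x z')"
        by (rule sum.cong[OF refl], subst sum.swap, rule sum.cong[OF refl], rule sum.swap)
      also have "\<dots> = (\<Sum>y\<in>Ys. \<Sum>x\<in>X. \<Sum>z\<in>X. \<Sum>z'\<in>X. \<delta> y x z * \<delta> y x z')"
        by (subst sum.swap, rule sum.cong[OF refl], rule sum.swap)
      finally show ?thesis by (simp add: sum_product)
    qed
    also have "\<dots> \<le> (\<Sum>y\<in>Ys. \<Sum>x\<in>X. \<Sum>z\<in>X. \<delta> y x z)"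
      by (intro sum_mono sq c2 sum_nonneg) (auto simp: \<delta>0)
    also have "\<dots> = S" by (simp add: rep S_def)
    finally have "N1 / D * (\<Sum>z\<in>X. \<Sum>z'\<in>X. \<Sum>y\<in>Ys. \<Sum>x\<in>X. \<delta> y x z * \<delta> y x z') \<le> N1 / D * S"
      using D by (intro mult_left_mono) auto
    moreover have "(\<Sum>z\<in>X. \<Sum>z'\<in>X. \<Sum>y\<in>Ys. c y z * c y z') = L * S"
    proof -
      have "(\<Sum>z\<in>X. \<Sum>z'\<in>X. \<Sum>y\<in>Ys. c y z * c y z') = (\<Sum>y\<in>Ys. (\<Sum>z\<in>X. c y z) * (\<Sum>z'\<in>X. c y z'))"
      proof -
        have "(\<Sum>z\<in>X. \<Sum>z'\<in>X. \<Sum>y\<in>Ys. c y z * c y z') = (\<Sum>z\<in>X. \<Sum>y\<in>Ys. \<Sum>z'\<in>X. c y z * c y z')"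
          by (rule sum.cong[OF refl], rule sum.swap)
        also have "\<dots> = (\<Sum>y\<in>Ys. \<Sum>z\<in>X. \<Sum>z'\<in>X. c y z * c y z')" by (rule sum.swap)
        finally show ?thesis by (simp add: sum_product)
      qed
      also have "\<dots> = (\<Sum>y\<in>Ys. real L * real L)" by (rule sum.cong) (auto simp: cL)
      finally show ?thesis by (simp add: S_def)
    qed
    ultimately show ?thesis unfolding K2_def sum.distrib sum_distrib_left[symmetric] by simp
  qed
  define r where "r y = (\<Sum>x\<leftarrow>xs. a y x)" for y
  let ?hit = "{y \<in> Ys. \<exists>x\<in>set xs. \<exists>z\<in>set zs. f x z = y}"
  have "(\<Sum>x\<leftarrow>xs. G x) - (\<Sum>x\<leftarrow>xs. \<Sum>x'\<leftarrow>xs. K x x') = (\<Sum>y\<in>Ys. 3 * r y - r y * r y)"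
    unfolding G_def K_def r_def sum_list_mult_sum_list
    by (simp add: sum_list_const_mult sum_list_sum_swap sum_subtractf sum_distrib_left)
  also have "\<dots> \<le> (\<Sum>y\<in>Ys. 2 * of_bool (y \<in> ?hit))"
  proof (rule sum_mono)
    fix y assume y: "y \<in> Ys"
    define m where "m = (\<Sum>x\<leftarrow>xs. \<Sum>z\<leftarrow>zs. of_bool (f x z = y) :: nat)"
    have rm: "r y = real m"
    proof -
      have of_nat_sl: "real (\<Sum>x\<leftarrow>us. g x) = (\<Sum>x\<leftarrow>us. real (g x))" for us :: "'a list" and g by (induction us) auto
      show ?thesis by (simp add: r_def a_def \<delta>_def m_def of_nat_sl)
    qed
    show "3 * r y - r y * r y \<le> 2 * of_bool (y \<in> ?hit)"
    proof (cases "y \<in> ?hit")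
      case True
      have "3 * real m - real m * real m \<le> 2"
      proof -
        \<comment> \<open>No integer lies strictly between 1 and 2: this is the Bonferroni
          inequality for a single y.\<close>
        have "0 \<le> (int m - 1) * (int m - 2)"
          by (cases "m \<le> 1") (auto simp: mult_nonpos_nonpos)
        then have "3 * int m - int m * int m \<le> 2" by (simp add: algebra_simps)
        then have "real_of_int (3 * int m - int m * int m) \<le> 2" by linarith
        then show ?thesis by simp
      qed
      then show ?thesis using True rm by simp
    next
      case False
      have "m = 0" unfolding m_def using False y by (auto simp: sum_list_nonneg_eq_0_iff)
      then show ?thesis using False rm by simp
    qed
  qed
  also have "\<dots> = 2 * card ?hit"
    using Ys by (simp add: sum_distrib_left[symmetric] of_bool_def sum.inter_filter[symmetric] Int_def)
  finally have up: "(\<Sum>x\<leftarrow>xs. G x) - (\<Sum>x\<leftarrow>xs. \<Sum>x'\<leftarrow>xs. K x x') \<le> 2 * card ?hit" .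
  have "real N1 * real N2 * (S / D\<^sup>2) * (2 - N1 / D - N2 / D - real N1 * real N2 * real L / D\<^sup>2)
    \<le> real N2 * (N1 / D * (3 * S) - (N1 / D * S + N1 * (real N1 - 1) / D\<^sup>2 * S)) / D
      - real N2 * (real N2 - 1) * (N1 / D * S + N1 * (real N1 - 1) / D\<^sup>2 * (L * S)) / D\<^sup>2"
  proof -
    have "(real N1 - 1) * (real N2 - 1) * L / D\<^sup>2 \<le> real N1 * real N2 * real L / D\<^sup>2" if "N1 > 0" "N2 > 0"
      using that by (intro divide_right_mono mult_right_mono mult_mono) auto
    then have br: "2 - N1 / D - N2 / D - real N1 * real N2 * real L / D\<^sup>2
      \<le> 2 - (real N1 - 1) / D - (real N2 - 1) / D - (real N1 - 1) * (real N2 - 1) * L / D\<^sup>2" if "N1 > 0" "N2 > 0"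
      using that D divide_right_mono[of "real N1 - 1" "real N1" D] divide_right_mono[of "real N2 - 1" "real N2" D] by simp
    have step: "real N1 * real N2 * (S / D\<^sup>2) * (2 - N1 / D - N2 / D - real N1 * real N2 * real L / D\<^sup>2)
      \<le> real N1 * real N2 * (S / D\<^sup>2) * (2 - (real N1 - 1) / D - (real N2 - 1) / D - (real N1 - 1) * (real N2 - 1) * L / D\<^sup>2)"
    proof (cases "N1 > 0 \<and> N2 > 0")
      case True
      have "0 \<le> real N1 * real N2 * (S / D\<^sup>2)" by (simp add: S_def)
      with True show ?thesis by (intro mult_left_mono br) auto
    qed auto
    note step
    also have "real N1 * real N2 * (S / D\<^sup>2) * (2 - (real N1 - 1) / D - (real N2 - 1) / D - (real N1 - 1) * (real N2 - 1) * L / D\<^sup>2) = real N2 * (N1 / D * (3 * S) - (N1 / D * S + N1 * (real N1 - 1) / D\<^sup>2 * S)) / D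
      - real N2 * (real N2 - 1) * (N1 / D * S + N1 * (real N1 - 1) / D\<^sup>2 * (L * S)) / D\<^sup>2"
      using D by (simp add: field_simps power2_eq_square)
    finally show ?thesis .
  qed
  also have "\<dots> \<le> real N2 * ((\<Sum>z\<in>X. G2 z) - (\<Sum>z\<in>X. K2 z z)) / D - real N2 * (real N2 - 1) * (\<Sum>z\<in>X. \<Sum>z'\<in>X. K2 z z') / D\<^sup>2"
    using sG2 sK2d sK2 n1 D by (intro diff_mono divide_right_mono mult_left_mono) auto
  also note zs_le
  also note link[symmetric]
  also note xs_le
  also note up
  finally show ?thesis using xs zs unfolding S_def by blast
qed

text \<open>As j varies, k^j / j! is largest at j = k, since consecutive terms have ratio k / (j +
  1).\<close>

lemma fact_power_le: "fact k * real k ^ j \<le> fact j * real k ^ k"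
proof (cases "j \<le> k")
  case True
  have "fact (j + i) * real (j + i) ^ j \<le> fact j * real (j + i) ^ (j + i)" for i
  proof -
    have "fact (j + i) \<le> fact j * real m ^ i" if "j + i \<le> m" for m
      using that
    proof (induction i)
      case (Suc i)
      have "fact (j + Suc i) = real (j + Suc i) * fact (j + i)" by simp
      also have "\<dots> \<le> real m * (fact j * real m ^ i)" by (rule mult_mono) (use Suc in auto)
      finally show ?case by (simp add: mult_ac)
    qed simp
    from this[of "j + i"] have "fact (j + i) * real (j + i) ^ j \<le> fact j * real (j + i) ^ i * real (j + i) ^ j"
      by (intro mult_right_mono) auto
    then show ?thesis by (simp add: power_add mult_ac)
  qed
  from this[of "k - j"] show ?thesis using True by simp
next
  case False
  have "fact k * real k ^ (k + i) \<le> fact (k + i) * real k ^ k" for i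
  proof (induction i)
    case (Suc i)
    have "fact k * real k ^ (k + Suc i) = real k * (fact k * real k ^ (k + i))" by simp
    also have "\<dots> \<le> real (k + Suc i) * (fact (k + i) * real k ^ k)" by (rule mult_mono) (use Suc in auto)
    finally show ?case by (simp add: mult_ac)
  qed simp
  from this[of "j - k"] show ?thesis using False by simp
qed

text \<open>The term \<open>j = k\<close> dominates the expansion of \<open>(k + (n - k)) ^ n\<close>.\<close>
lemma binomial_entropy_bound:
  assumes k: "0 < k" "k < n"
  shows "2 powr (real n * h2 (real k / real n)) \<le> (real n + 1) * real (n choose k)"
proof -
  define l where "l = n - k"
  have n: "n = k + l" "l > 0" using k by (auto simp: l_def)
  have mode: "real (n choose j) * real k ^ j * real l ^ (n - j) \<le> real (n choose k) * real k ^ k * real l ^ l" if j: "j \<le> n" for j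
  proof -
    have "(fact k * real k ^ j) * (fact l * real l ^ (n - j)) \<le> (fact j * real k ^ k) * (fact (n - j) * real l ^ l)"
      by (intro mult_mono fact_power_le) auto
    moreover have bj: "real (n choose j) = fact n / (fact j * fact (n - j))" using binomial_fact[OF j] .
    moreover have bk: "real (n choose k) = fact n / (fact k * fact l)" using binomial_fact[of k n] n by simp
    ultimately show ?thesis unfolding bj bk by (simp add: field_simps)
  qed
  have "real n ^ n = (real k + real l) ^ n" using n by simp
  also have "\<dots> = (\<Sum>j\<le>n. real (n choose j) * real k ^ j * real l ^ (n - j))" by (rule binomial_ring)
  also have "\<dots> \<le> (\<Sum>j\<le>n. real (n choose k) * real k ^ k * real l ^ l)" by (rule sum_mono) (use mode in auto)
  also have "\<dots> = (real n + 1) * real (n choose k) * (real k ^ k * real l ^ l)" by simp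
  finally have le: "real n ^ n \<le> (real n + 1) * real (n choose k) * (real k ^ k * real l ^ l)" .
  have pos: "0 < real k" "0 < real l" "0 < real n" using k n by auto
  have "real n * h2 (real k / real n) = real n * log 2 n - real k * log 2 k - real l * log 2 l"
  proof -
    have "1 - real k / real n = real l / real n" using pos n by (simp add: field_simps)
    then have "real n * h2 (real k / real n) = - (real n * (real k / real n)) * log 2 (real k / real n) - (real n * (real l / real n)) * log 2 (real l / real n)"
      by (simp add: h2_def right_diff_distrib)
    also have "\<dots> = - real k * (log 2 k - log 2 n) - real l * (log 2 l - log 2 n)" using pos by (simp add: log_divide_pos)
    also have "\<dots> = real n * log 2 n - real k * log 2 k - real l * log 2 l" using n by (simp add: algebra_simps)
    finally show ?thesis .
  qed
  then have "2 powr (real n * h2 (real k / real n)) = 2 powr (real n * log 2 n) / 2 powr (real k * log 2 k) / 2 powr (real l * log 2 l)"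
    by (simp add: powr_diff)
  also have "\<dots> = real n ^ n / (real k ^ k * real l ^ l)"
  proof -
    have pw: "2 powr (real m * log 2 m) = real m ^ m" if "m > 0" for m :: nat
    proof -
      have "2 powr (real m * log 2 m) = (2 powr log 2 m) powr m" by (simp add: powr_powr mult.commute)
      also have "\<dots> = real m powr m" using that by simp
      finally show ?thesis using that by (simp add: powr_realpow)
    qed
    have "2 powr (real n * log 2 n) = real n ^ n" "2 powr (real k * log 2 k) = real k ^ k" "2 powr (real l * log 2 l) = real l ^ l"
      using pos by (auto intro: pw)
    then show ?thesis by simp
  qed
  also have "\<dots> \<le> (real n + 1) * real (n choose k)" using le pos by (simp add: divide_le_eq)
  finally show ?thesis .
qed

section \<open>Counting adder outputs and their representations\<close>

definition bits :: "nat \<Rightarrow> bool list set" where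
  "bits n = {x. length x = n}"

lemma card_bits: "finite (bits n)" "card (bits n) = 2 ^ n"
  using finite_lists_length_eq[of "UNIV :: bool set" n] card_lists_length_eq[of "UNIV :: bool set" n]
  by (simp_all add: bits_def)

lemma card_adder_reps:
  "set y \<subseteq> {0, 1, 2} \<Longrightarrow> card {(x, z). x \<in> bits (length y) \<and> z \<in> bits (length y) \<and> map2 adder x z = y} = 2 ^ ones y"
proof (induction y)
  case Nil
  have "{(x, z). x \<in> bits 0 \<and> z \<in> bits 0 \<and> map2 adder x z = []} = {([], [])}" by (auto simp: bits_def)
  then show ?case by simp
next
  case (Cons b y)
  let ?R = "{(x, z). x \<in> bits (length y) \<and> z \<in> bits (length y) \<and> map2 adder x z = y}"
  let ?A = "{(a, c). adder a c = b}"
  let ?g = "\<lambda>((a, c), (x, z)). (a # x, c # z)"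
  have "{(x, z). x \<in> bits (length (b # y)) \<and> z \<in> bits (length (b # y)) \<and> map2 adder x z = b # y} = ?g ` (?A \<times> ?R)"
  proof (intro equalityI subsetI)
    fix p assume "p \<in> {(x, z). x \<in> bits (length (b # y)) \<and> z \<in> bits (length (b # y)) \<and> map2 adder x z = b # y}"
    then obtain a x c z where "p = (a # x, c # z)" "length x = length y" "length z = length y" "adder a c = b" "map2 adder x z = y"
      by (auto simp: bits_def length_Suc_conv)
    then have "p = ?g ((a, c), (x, z))" "((a, c), (x, z)) \<in> ?A \<times> ?R" by (simp_all add: bits_def)
    then show "p \<in> ?g ` (?A \<times> ?R)" by (rule image_eqI)
  next
    fix p assume "p \<in> ?g ` (?A \<times> ?R)"
    then obtain u where u: "u \<in> ?A \<times> ?R" "p = ?g u" by (elim imageE)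
    obtain a c x z where u': "u = ((a, c), (x, z))" by (metis prod.collapse)
    show "p \<in> {(x, z). x \<in> bits (length (b # y)) \<and> z \<in> bits (length (b # y)) \<and> map2 adder x z = b # y}"
      using u(1) unfolding u(2) u' by (simp add: bits_def)
  qed
  moreover have "inj_on ?g (?A \<times> ?R)"
    by (rule inj_on_inverseI[where g = "\<lambda>(x, z). ((hd x, hd z), (tl x, tl z))"]) (simp add: case_prod_beta)
  moreover have "card ?A = (if b = 1 then 2 else 1)"
  proof -
    have tab: "(adder a c = 0) = (\<not> a \<and> \<not> c)" "(adder a c = 1) = (a \<noteq> c)" "(adder a c = 2) = (a \<and> c)" for a c
      by (cases a; cases c; simp add: adder_def)+
    have "b \<in> {0, 1, 2}" using Cons.prems by simp
    then consider "b = 0" | "b = 1" | "b = 2" by auto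
    then show ?thesis
    proof cases
      case 1
      have "?A = {(False, False)}" unfolding 1 tab by auto
      then show ?thesis using 1 by simp
    next
      case 2
      have "?A = {(False, True), (True, False)}" unfolding 2 tab by auto
      then show ?thesis using 2 by simp
    next
      case 3
      have "?A = {(True, True)}" unfolding 3 tab by auto
      then show ?thesis using 3 by simp
    qed
  qed
  moreover have "card ?R = 2 ^ ones y" using Cons by simp
  ultimately show ?case by (simp add: card_image card_cartesian_product)
qed

definition types :: "nat \<Rightarrow> nat \<Rightarrow> nat list set" where
  "types n k = {y. length y = n \<and> set y \<subseteq> {0, 1, 2} \<and> ones y = k}"

lemma finite_types: "finite (types n k)"
  by (rule finite_subset[OF _ finite_lists_length_eq[of "{0, 1, 2}" n]]) (auto simp: types_def)

text \<open>Multiplying by 2^k avoids the truncated exponent \<open>n - k\<close>, so the identity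
  also covers k > n and Pascal's recursion needs no case distinction there.\<close>

lemma card_types: "card (types n k) * 2 ^ k = (n choose k) * 2 ^ n"
proof (induction n arbitrary: k)
  case 0
  have "types 0 k = (if k = 0 then {[]} else {})" by (auto simp: types_def)
  then show ?case by (cases k) auto
next
  case (Suc n)
  have 0: "types (Suc n) 0 = (#) 0 ` types n 0 \<union> (#) 2 ` types n 0"
    by (auto simp: types_def length_Suc_conv split: if_splits)
  have S: "types (Suc n) (Suc k) = (#) 0 ` types n (Suc k) \<union> (#) 2 ` types n (Suc k) \<union> (#) 1 ` types n k" for k
    by (auto simp: types_def length_Suc_conv split: if_splits)
  have c: "card ((#) b ` types n k) = card (types n k)" for b k by (rule card_image) (auto simp: inj_on_def)
  have fin: "finite ((#) b ` types n k)" for b k by (simp add: finite_types)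
  show ?case
  proof (cases k)
    case 0
    have "card (types (Suc n) 0) = card (types n 0) + card (types n 0)"
      unfolding \<open>types (Suc n) 0 = _\<close> by (subst card_Un_disjoint[OF fin fin]) (auto simp: c)
    then show ?thesis using Suc.IH[of 0] 0 by simp
  next
    case (Suc k')
    have "card (types (Suc n) (Suc k')) = card (types n (Suc k')) + card (types n (Suc k')) + card (types n k')"
      unfolding S by (subst card_Un_disjoint; (subst card_Un_disjoint)?) (auto simp: c fin)
    then show ?thesis using Suc.IH[of "Suc k'"] Suc.IH[of k'] Suc by (simp add: algebra_simps)
  qed
qed

lemma adder_sumset:
  "\<exists>xs zs. length xs = N1 \<and> length zs = N2 \<and> set xs \<subseteq> bits n \<and> set zs \<subseteq> bits n \<and>
    real N1 * real N2 * (real (n choose k) / 2 ^ n) * (2 - N1 / 2 ^ n - N2 / 2 ^ n - real N1 * real N2 * 2 ^ k / (2 ^ n)\<^sup>2)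
      \<le> 2 * card {map2 adder x z |x z. x \<in> set xs \<and> z \<in> set zs}"
proof -
  have reps: "card {(x, z). x \<in> bits n \<and> z \<in> bits n \<and> map2 adder x z = y} = 2 ^ k" if "y \<in> types n k" for y
    using card_adder_reps[of y] that by (auto simp: types_def)
  have ne: "bits n \<noteq> {}" using card_bits(2)[of n] by auto
  obtain xs zs where xz: "length xs = N1" "length zs = N2" "set xs \<subseteq> bits n" "set zs \<subseteq> bits n"
    and le: "real N1 * real N2 * (real (card (types n k)) * real (2 ^ k) / (real (card (bits n)))\<^sup>2)
     * (2 - N1 / real (card (bits n)) - N2 / real (card (bits n)) - real N1 * real N2 * real (2 ^ k) / (real (card (bits n)))\<^sup>2)
      \<le> 2 * card {y \<in> types n k. \<exists>x\<in>set xs. \<exists>z\<in>set zs. map2 adder x z = y}"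
  proof -
    have "z = z'" if "x \<in> bits n" "z \<in> bits n" "z' \<in> bits n" "map2 adder x z = map2 adder x z'" for x z z'
      using that map2_adder_inj[of x z z'] by (simp add: bits_def)
    moreover have "x = x'" if "x \<in> bits n" "x' \<in> bits n" "z \<in> bits n" "map2 adder x z = map2 adder x' z" for x x' z
      using that map2_adder_inj[of z x x'] map2_adder_commute[of z] by (simp add: bits_def)
    ultimately show thesis
      using sumset_pick[OF card_bits(1) ne finite_types reps, of n k N1 N2] that by blast
  qed
  have "real (card (types n k)) * real (2 ^ k) = real (n choose k) * 2 ^ n"
    using arg_cong[OF card_types[of n k], of real] by simp
  then have "real (card (types n k)) * real (2 ^ k) / (real (card (bits n)))\<^sup>2 = real (n choose k) / 2 ^ n"
    by (simp add: card_bits power2_eq_square)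
  moreover have "card {y \<in> types n k. \<exists>x\<in>set xs. \<exists>z\<in>set zs. map2 adder x z = y} \<le> card {map2 adder x z |x z. x \<in> set xs \<and> z \<in> set zs}"
  proof (rule card_mono)
    have "{map2 adder x z |x z. x \<in> set xs \<and> z \<in> set zs} = (\<lambda>(x, z). map2 adder x z) ` (set xs \<times> set zs)" by auto
    then show "finite {map2 adder x z |x z. x \<in> set xs \<and> z \<in> set zs}" by simp
  qed auto
  ultimately show ?thesis using xz le
    by (intro exI[of _ xs] exI[of _ zs]) (simp add: card_bits)
qed

section \<open>From sumsets to codes\<close>

lemma achievable_of_sumset:
  fixes C1 C2 R :: real and xs zs :: "bool list list"
  assumes n: "n \<ge> 1" and xz: "set xs \<subseteq> bits n" "set zs \<subseteq> bits n"
    and c1: "log 2 (length xs) \<le> real n * C1" and c2: "log 2 (length zs) \<le> real n * C2"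
    and M: "nat \<lceil>2 powr (real n * R)\<rceil> \<le> card {map2 adder x z |x z. x \<in> set xs \<and> z \<in> set zs}"
  shows "achievable C1 C2 R"
proof -
  define M where "M = nat \<lceil>2 powr (real n * R)\<rceil>"
  define W where "W = pmf_of_set {1..M}"
  have "0 < 2 powr (real n * R)" by simp
  then have M1: "M \<ge> 1" unfolding M_def by linarith
  have S: "set_pmf W = {1..M}" using M1 unfolding W_def by (intro set_pmf_of_set) auto
  have fin: "finite (set_pmf W)" unfolding S by simp
  obtain T where T: "T \<subseteq> {map2 adder x z |x z. x \<in> set xs \<and> z \<in> set zs}" "card T = M" "finite T"
    using obtain_subset_with_card_n[OF M[folded M_def]] by blast
  obtain g where g: "bij_betw g {1..M} T" using ex_bij_betw_nat_finite_1[OF T(3)] T(2) by blast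
  have "\<forall>w\<in>{1..M}. \<exists>ij. fst ij < length xs \<and> snd ij < length zs \<and> map2 adder (xs ! fst ij) (zs ! snd ij) = g w"
  proof
    fix w assume "w \<in> {1..M}"
    then have "g w \<in> T" using g by (auto simp: bij_betw_def)
    then obtain x z where "x \<in> set xs" "z \<in> set zs" "map2 adder x z = g w" using T(1) by fastforce
    moreover then obtain i j where "i < length xs" "xs ! i = x" "j < length zs" "zs ! j = z" by (metis in_set_conv_nth)
    ultimately show "\<exists>ij. fst ij < length xs \<and> snd ij < length zs \<and> map2 adder (xs ! fst ij) (zs ! snd ij) = g w"
      by (intro exI[of _ "(i, j)"]) simp
  qed
  then obtain ij where ij: "\<And>w. w \<in> {1..M} \<Longrightarrow> fst (ij w) < length xs \<and> snd (ij w) < length zs \<and> map2 adder (xs ! fst (ij w)) (zs ! snd (ij w)) = g w"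
    by metis
  define e1 e2 where "e1 w = fst (ij w)" and "e2 w = snd (ij w)" for w
  \<comment> \<open>The pipes carry list positions. Words of length n are returned beyond the lists
    as well, because \<open>achievable\<close> constrains the relay maps on every natural
    number.\<close>
  define r1 r2 where "r1 v = (if v < length xs then xs ! v else replicate n False)" and "r2 v = (if v < length zs then zs ! v else replicate n False)" for v
  have len: "\<forall>v. length (r1 v) = n" "\<forall>v. length (r2 v) = n"
    using xz by (auto simp: r1_def r2_def bits_def dest!: nth_mem)
  have "ent W e1 \<le> log 2 (card {..<length xs})"
    by (rule ent_le_log_card[OF fin]) (use ij in \<open>auto simp: S e1_def\<close>)
  then have H1: "ent W e1 \<le> real n * C1" using c1 by simp
  have "ent W e2 \<le> log 2 (card {..<length zs})"
    by (rule ent_le_log_card[OF fin]) (use ij in \<open>auto simp: S e2_def\<close>)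
  then have H2: "ent W e2 \<le> real n * C2" using c2 by simp
  define d where "d = inv_into {1..M} g"
  have dec: "d (map2 adder (r1 (e1 w)) (r2 (e2 w))) = w" if "w \<in> {1..M}" for w
    using ij[OF that] g that by (simp add: r1_def r2_def e1_def e2_def d_def bij_betw_def inv_into_f_f)
  have "measure_pmf.prob W {w. d (map2 adder (r1 (e1 w)) (r2 (e2 w))) \<noteq> w} = 0"
    unfolding measure_pmf_zero_iff S using dec by auto
  then have "let M = nat \<lceil>2 powr (real n * R)\<rceil>; W = pmf_of_set {1..M} in
      (\<forall>v. length (r1 v) = n) \<and> (\<forall>v. length (r2 v) = n) \<and> ent W e1 \<le> real n * C1 \<and> ent W e2 \<le> real n * C2 \<and>
      measure_pmf.prob W {w. d (map2 adder (r1 (e1 w)) (r2 (e2 w))) \<noteq> w} < e" if "0 < e" for e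
    unfolding Let_def M_def[symmetric] W_def[symmetric] using len H1 H2 that by simp
  then show ?thesis unfolding achievable_def
    by (intro allI impI, rule_tac exI[of _ n], rule_tac conjI[OF n], rule_tac exI[of _ e1], rule_tac exI[of _ e2],
        rule_tac exI[of _ r1], rule_tac exI[of _ r2], rule_tac exI[of _ d])
qed

text \<open>For rational p the number k = n * p is an integer along the multiples n of b. After a
  small reduction of the pipe rates, each of the three losses in \<open>adder_sumset\<close> is at
  most 1/4: the first two because \<open>C1\<close> and \<open>C2\<close> are at most 1, the third
  because \<open>C1 + C2 \<le> 2 - p\<close>. The expected number of representations then determines
  the rate.\<close>

lemma achievable_rational:
  assumes C: "0 \<le> C1" "C1 \<le> 1" "0 \<le> C2" "C2 \<le> 1" and ab: "0 < a" "2 * a \<le> b"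
    and p: "p = real a / real b" and c: "C1 + C2 \<le> 2 - p" and R: "0 \<le> R" "R < C1 + C2 - 1 + h2 p"
  shows "achievable C1 C2 R"
proof -
  \<comment> \<open>A quarter of the slack is given up per pipe, which leaves \<gamma> at least half
    of it. The cap at 1 is needed for \<open>E1 \<le> 1 - \<delta>\<close> when \<open>E1\<close> is
    0.\<close>
  define \<delta> where "\<delta> = min 1 ((C1 + C2 - 1 + h2 p - R) / 4)"
  define \<gamma> where "\<gamma> = C1 + C2 - 1 + h2 p - 2 * \<delta> - R"
  have \<delta>: "0 < \<delta>" "\<delta> \<le> 1" "0 < \<gamma>" using R by (auto simp: \<delta>_def \<gamma>_def min_def field_simps)
  have p01: "0 < p" "p \<le> 1/2" using ab by (auto simp: p field_simps)
  \<comment> \<open>16 collects a factor 2 for each of the two floors, one for the factor in front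
    of the cardinality and one for the ceiling in the number of messages. The polynomial factor
    comes from \<open>binomial_entropy_bound\<close>.\<close>
  have "eventually (\<lambda>x::real. 16 * (x + 1) \<le> 2 powr (x * \<gamma>)) at_top" using \<delta>(3) by real_asymp
  then obtain x0 where x0: "\<And>x. x \<ge> x0 \<Longrightarrow> 16 * (x + 1) \<le> 2 powr (x * \<gamma>)" unfolding eventually_at_top_linorder by blast
  obtain m :: nat where m: "max (max x0 (2 / \<delta>)) 1 \<le> real m" using real_arch_simple by blast
  define n where "n = m * b"
  define k where "k = m * a"
  have b: "b \<ge> 1" "b > 0" using ab by auto
  have "m \<le> n" using b by (simp add: n_def)
  then have mn: "real m \<le> real n" by simp
  have n: "x0 \<le> real n" "2 \<le> real n * \<delta>" "n \<ge> 1" "real n > 0"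
  proof -
    show "x0 \<le> real n" using m mn by simp
    have "2 / \<delta> \<le> real n" using m mn by simp
    then show "2 \<le> real n * \<delta>" using \<delta> by (simp add: divide_le_eq)
    show "n \<ge> 1" "real n > 0" using m mn by linarith+
  qed
  have m0: "m > 0" using m by (cases m) auto
  have kn: "0 < k" "k < n" using ab m0 by (auto simp: k_def n_def)
  have pn: "real k / real n = p" using m0 by (simp add: k_def n_def p)
  have kp: "real k = real n * p" using pn n(4) by (simp add: field_simps)
  \<comment> \<open>Truncation at 0 keeps at least one word in each list when a pipe rate is below
    \<delta>.\<close>
  define E1 E2 where "E1 = max 0 (C1 - \<delta>)" and "E2 = max 0 (C2 - \<delta>)"
  have E: "0 \<le> E1" "0 \<le> E2" "E1 \<le> C1" "E2 \<le> C2" "C1 - \<delta> \<le> E1" "C2 - \<delta> \<le> E2" "E1 \<le> 1 - \<delta>" "E2 \<le> 1 - \<delta>" "E1 + E2 \<le> 2 - p - \<delta>"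
    using C c \<delta> p01 by (auto simp: E1_def E2_def max_def)
  define N1 N2 where "N1 = nat \<lfloor>2 powr (real n * E1)\<rfloor>" and "N2 = nat \<lfloor>2 powr (real n * E2)\<rfloor>"
  have fl: "1 \<le> nat \<lfloor>t\<rfloor>" "real (nat \<lfloor>t\<rfloor>) \<le> t" "t / 2 \<le> real (nat \<lfloor>t\<rfloor>)" if "1 \<le> t" for t :: real
  proof -
    have f: "1 \<le> \<lfloor>t\<rfloor>" "real (nat \<lfloor>t\<rfloor>) = of_int \<lfloor>t\<rfloor>" using that by auto
    then show "1 \<le> nat \<lfloor>t\<rfloor>" by linarith
    show "real (nat \<lfloor>t\<rfloor>) \<le> t" unfolding f by simp
    show "t / 2 \<le> real (nat \<lfloor>t\<rfloor>)" unfolding f(2) using f(1) by linarith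
  qed
  have ge1: "1 \<le> 2 powr (real n * E1)" "1 \<le> 2 powr (real n * E2)" using E by (auto intro!: ge_one_powr_ge_zero)
  have N1: "1 \<le> N1" "real N1 \<le> 2 powr (real n * E1)" "2 powr (real n * E1) / 2 \<le> real N1" unfolding N1_def using fl[OF ge1(1)] by auto
  have N2: "1 \<le> N2" "real N2 \<le> 2 powr (real n * E2)" "2 powr (real n * E2) / 2 \<le> real N2" unfolding N2_def using fl[OF ge1(2)] by auto
  have p2: "(2::real) ^ j = 2 powr real j" for j by (simp add: powr_realpow)
  have quarter: "2 powr t \<le> 1/4" if "t \<le> - (real n * \<delta>)" for t :: real
  proof -
    have "2 powr t \<le> 2 powr (-2 :: real)" using that n(2) by (intro powr_mono) auto
    then show ?thesis by (simp add: powr_minus)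
  qed
  have q1: "N1 / 2 ^ n \<le> 1/4"
  proof -
    have "N1 / 2 ^ n \<le> 2 powr (real n * E1) / 2 powr real n" unfolding p2 using N1 by (intro divide_right_mono) auto
    also have "\<dots> = 2 powr (real n * E1 - real n)" by (simp add: powr_diff)
    also have "\<dots> \<le> 1/4" using mult_left_mono[OF E(7), of "real n"] by (intro quarter) (simp add: algebra_simps)
    finally show ?thesis .
  qed
  have q2: "N2 / 2 ^ n \<le> 1/4"
  proof -
    have "N2 / 2 ^ n \<le> 2 powr (real n * E2) / 2 powr real n" unfolding p2 using N2 by (intro divide_right_mono) auto
    also have "\<dots> = 2 powr (real n * E2 - real n)" by (simp add: powr_diff)
    also have "\<dots> \<le> 1/4" using mult_left_mono[OF E(8), of "real n"] by (intro quarter) (simp add: algebra_simps)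
    finally show ?thesis .
  qed
  have q3: "real N1 * real N2 * 2 ^ k / (2 ^ n)\<^sup>2 \<le> 1/4"
  proof -
    have "real N1 * real N2 * 2 ^ k / (2 ^ n)\<^sup>2 \<le> 2 powr (real n * E1) * 2 powr (real n * E2) * 2 powr real k / (2 powr real n)\<^sup>2"
      unfolding p2 using N1 N2 by (intro divide_right_mono mult_right_mono mult_mono) auto
    also have "\<dots> = 2 powr (real n * E1 + real n * E2 + real k - real n - real n)"
      by (simp only: powr_diff powr_add power2_eq_square divide_divide_eq_left)
    also have "\<dots> \<le> 1/4" unfolding kp using mult_left_mono[OF E(9), of "real n"] by (intro quarter) (simp add: algebra_simps)
    finally show ?thesis .
  qed
  obtain xs zs where xz: "length xs = N1" "length zs = N2" "set xs \<subseteq> bits n" "set zs \<subseteq> bits n"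
    and le: "real N1 * real N2 * (real (n choose k) / 2 ^ n) * (2 - N1 / 2 ^ n - N2 / 2 ^ n - real N1 * real N2 * 2 ^ k / (2 ^ n)\<^sup>2)
      \<le> 2 * card {map2 adder x z |x z. x \<in> set xs \<and> z \<in> set zs}"
    using adder_sumset[of N1 N2 n k] by blast
  have "real N1 * real N2 * (real (n choose k) / 2 ^ n) * 1
    \<le> real N1 * real N2 * (real (n choose k) / 2 ^ n) * (2 - N1 / 2 ^ n - N2 / 2 ^ n - real N1 * real N2 * 2 ^ k / (2 ^ n)\<^sup>2)"
    by (rule mult_left_mono) (use q1 q2 q3 in linarith, simp)
  with le have "real N1 * real N2 * (real (n choose k) / 2 ^ n) \<le> 2 * card {map2 adder x z |x z. x \<in> set xs \<and> z \<in> set zs}" by linarith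
  moreover have "4 * 2 powr (real n * R) \<le> real N1 * real N2 * (real (n choose k) / 2 ^ n)"
  proof -
    have "2 powr (real n * h2 p) \<le> (real n + 1) * real (n choose k)" using binomial_entropy_bound[OF kn] by (simp add: pn)
    then have B: "2 powr (real n * h2 p) / (real n + 1) \<le> real (n choose k)" by (simp add: divide_le_eq mult.commute)
    have "16 * (real n + 1) * 2 powr (real n * R) \<le> 2 powr (real n * \<gamma>) * 2 powr (real n * R)"
      using x0[OF n(1)] by (intro mult_right_mono) auto
    also have "\<dots> = 2 powr (real n * (C1 + C2 - 1 + h2 p - 2 * \<delta>))"
      by (simp add: powr_add[symmetric] \<gamma>_def algebra_simps)
    also have "\<dots> \<le> 2 powr (real n * E1 + real n * E2 + real n * h2 p - real n)"
    proof (rule powr_mono)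
      have "real n * (C1 + C2 - 1 + h2 p - 2 * \<delta>) \<le> real n * (E1 + E2 - 1 + h2 p)" using E by (intro mult_left_mono) auto
      then show "real n * (C1 + C2 - 1 + h2 p - 2 * \<delta>) \<le> real n * E1 + real n * E2 + real n * h2 p - real n" by (simp add: algebra_simps)
    qed simp
    also have "\<dots> = 2 powr (real n * E1) * 2 powr (real n * E2) * (2 powr (real n * h2 p) / 2 powr real n)"
      by (simp add: powr_add powr_diff)
    finally have F: "16 * (real n + 1) * 2 powr (real n * R) \<le> 2 powr (real n * E1) * 2 powr (real n * E2) * (2 powr (real n * h2 p) / 2 powr real n)" .
    have "4 * X \<le> (A / 2) * (B / 2) * ((H / Z) / N)" if "16 * Z * X \<le> A * B * (H / N)" "0 < Z" for A B H N X Z :: real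
    proof -
      have "4 * X = 16 * Z * X / (4 * Z)" using that(2) by simp
      also have "\<dots> \<le> A * B * (H / N) / (4 * Z)" using that by (intro divide_right_mono) auto
      finally show ?thesis by (simp add: mult_ac)
    qed
    from this[OF F] have "4 * 2 powr (real n * R) \<le> (2 powr (real n * E1) / 2) * (2 powr (real n * E2) / 2) * ((2 powr (real n * h2 p) / (real n + 1)) / 2 powr real n)"
      by simp
    also have "\<dots> \<le> real N1 * real N2 * (real (n choose k) / 2 powr real n)"
      using N1 N2 B by (intro mult_mono divide_right_mono) auto
    finally show ?thesis by (simp add: p2)
  qed
  ultimately have "2 * 2 powr (real n * R) \<le> card {map2 adder x z |x z. x \<in> set xs \<and> z \<in> set zs}" by linarith
  moreover have "1 \<le> 2 powr (real n * R)" using R by (intro ge_one_powr_ge_zero) auto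
  ultimately have M: "nat \<lceil>2 powr (real n * R)\<rceil> \<le> card {map2 adder x z |x z. x \<in> set xs \<and> z \<in> set zs}" by linarith
  have lg: "log 2 (real N) \<le> real n * C" if "1 \<le> N" "real N \<le> 2 powr (real n * E)" "E \<le> C" for N :: nat and E C :: real
  proof -
    have "log 2 (real N) \<le> log 2 (2 powr (real n * E))" using that by (intro log_mono) auto
    also have "\<dots> \<le> real n * C" using that(3) by (simp add: mult_left_mono)
    finally show ?thesis .
  qed
  show ?thesis
    by (rule achievable_of_sumset[OF n(3) xz(3,4) _ _ M]) (use lg[OF N1(1,2) E(3)] lg[OF N2(1,2) E(4)] xz in auto)
qed

lemma achievable_mono:
  assumes "achievable C1 C2 R" "C1 \<le> C1'" "C2 \<le> C2'"
  shows "achievable C1' C2' R"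
proof -
  show ?thesis unfolding achievable_def
  proof (intro allI impI)
    fix e :: real assume "0 < e"
    from assms(1)[unfolded achievable_def, rule_format, OF this]
    obtain n :: nat and e1 e2 :: "nat \<Rightarrow> nat" and r1 r2 :: "nat \<Rightarrow> bool list" and d :: "nat list \<Rightarrow> nat" where n: "n \<ge> 1"
      and code: "let M = nat \<lceil>2 powr (real n * R)\<rceil>; W = pmf_of_set {1..M} in
           (\<forall>v. length (r1 v) = n) \<and> (\<forall>v. length (r2 v) = n) \<and>
           ent W e1 \<le> real n * C1 \<and> ent W e2 \<le> real n * C2 \<and>
           measure_pmf.prob W {w. d (map2 adder (r1 (e1 w)) (r2 (e2 w))) \<noteq> w} < e"
      by blast
    have m: "real n * C1 \<le> real n * C1'" "real n * C2 \<le> real n * C2'" using assms by (auto intro: mult_left_mono)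
    have "let M = nat \<lceil>2 powr (real n * R)\<rceil>; W = pmf_of_set {1..M} in
           (\<forall>v. length (r1 v) = n) \<and> (\<forall>v. length (r2 v) = n) \<and>
           ent W e1 \<le> real n * C1' \<and> ent W e2 \<le> real n * C2' \<and>
           measure_pmf.prob W {w. d (map2 adder (r1 (e1 w)) (r2 (e2 w))) \<noteq> w} < e"
      using code order_trans[OF _ m(1)] order_trans[OF _ m(2)] unfolding Let_def by blast
    with n show "\<exists>n\<ge>1. \<exists>(e1::nat \<Rightarrow> nat) (e2::nat \<Rightarrow> nat) (r1::nat \<Rightarrow> bool list) (r2::nat \<Rightarrow> bool list) (d::nat list \<Rightarrow> nat).
         (let M = nat \<lceil>2 powr (real n * R)\<rceil>; W = pmf_of_set {1..M} in
           (\<forall>v. length (r1 v) = n) \<and> (\<forall>v. length (r2 v) = n) \<and>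
           ent W e1 \<le> real n * C1' \<and> ent W e2 \<le> real n * C2' \<and>
           measure_pmf.prob W {w. d (map2 adder (r1 (e1 w)) (r2 (e2 w))) \<noteq> w} < e)"
      by blast
  qed
qed

lemma achievable_nonpos:
  assumes "0 \<le> C1" "0 \<le> C2" "R \<le> 0"
  shows "achievable C1 C2 R"
proof (rule achievable_of_sumset[of 1 "[[False]]" "[[False]]"])
  have "{map2 adder x z |x z. x \<in> set [[False]] \<and> z \<in> set [[False]]} = {map2 adder [False] [False]}" by auto
  moreover have "2 powr (real 1 * R) \<le> 2 powr 0" using assms by (intro powr_mono) auto
  ultimately show "nat \<lceil>2 powr (real 1 * R)\<rceil> \<le> card {map2 adder x z |x z. x \<in> set [[False]] \<and> z \<in> set [[False]]}" by simp
qed (use assms in \<open>auto simp: bits_def\<close>)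

text \<open>Three reductions to \<open>achievable_rational\<close>: p is moved to a rational q; the
  capacities are capped at 1, since a relay sends n bits at most; and if their sum still exceeds 2 -
  q, they are scaled down to the line where it equals 2 - q. On that line
  \<open>C1 + C2 - 1 + h2 q\<close> becomes \<open>h2 q + 1 - q\<close>.\<close>

lemma achievable_below_formula:
  assumes C: "0 \<le> C1" "C1 \<le> C2" and p: "0 \<le> p" "p \<le> 1/2"
    and R: "R < min (C1 + C2 - 1 + h2 p) (min (C1 + h2 p) (h2 p + 1 - p))"
  shows "achievable C1 C2 R"
proof (cases "R \<le> 0")
  case True
  then show ?thesis using C by (intro achievable_nonpos) auto
next
  case False
  let ?v = "\<lambda>p. min (C1 + C2 - 1 + h2 p) (min (C1 + h2 p) (h2 p + 1 - p))"
  have "\<exists>q\<in>\<rat>. 0 < q \<and> q \<le> 1/2 \<and> R < ?v q"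
  proof (cases "p = 0 \<or> p = 1/2")
    case True
    \<comment> \<open>At 0 the entropy is not differentiable, but the value at 1/2 is at least as
      large as that at 0, and 1/2 is rational.\<close>
    have "R < ?v (1/2)"
    proof (cases "p = 0")
      case True
      have "h2 0 = 0" by (simp add: h2_def)
      then show ?thesis using True R unfolding h2_half min_less_iff_conj by simp
    next
      case False
      then have "p = 1/2" using \<open>p = 0 \<or> p = 1/2\<close> by simp
      then show ?thesis using R by (simp only:)
    qed
    then show ?thesis by (intro bexI[of _ "1/2"]) auto
  next
    case False
    then have p': "0 < p" "p < 1/2" using p by auto
    have "isCont h2 p" using h2_deriv[of p] p' by (intro DERIV_isCont) auto
    then have "isCont ?v p" by (intro continuous_intros) auto
    then have "eventually (\<lambda>q. R < ?v q) (at p)" using R by (intro order_tendstoD) (auto simp: isCont_def)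
    then obtain e where e: "e > 0" "\<And>q. q \<noteq> p \<Longrightarrow> dist q p < e \<Longrightarrow> R < ?v q" unfolding eventually_at by blast
    obtain q where q: "q \<in> \<rat>" "max 0 (p - e) < q" "q < p" using Rats_dense_in_real[of "max 0 (p - e)" p] p' e by auto
    then have "R < ?v q" by (intro e(2)) (auto simp: dist_real_def)
    then show ?thesis using q p' by (intro bexI[of _ q]) auto
  qed
  then obtain q where q: "q \<in> \<rat>" "0 < q" "q \<le> 1/2" "R < ?v q" by blast
  obtain a b :: nat where ab: "b \<noteq> 0" "\<bar>q\<bar> = real a / real b" by (rule Rats_abs_nat_div_natE[OF q(1)])
  then have qab: "q = real a / real b" using q by simp
  have ab': "0 < a" "2 * a \<le> b"
  proof -
    show "0 < a" using q(2) qab by (cases a) auto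
    have "2 * real a \<le> real b" using q(3) qab ab(1) by (simp add: field_simps)
    then show "2 * a \<le> b" by linarith
  qed
  define D1 D2 where "D1 = min C1 1" and "D2 = min C2 1"
  have D: "0 \<le> D1" "D1 \<le> 1" "0 \<le> D2" "D2 \<le> 1" "D1 \<le> C1" "D2 \<le> C2" using C by (auto simp: D1_def D2_def)
  \<comment> \<open>If only \<open>C2\<close> is capped, the first expression becomes
    \<open>C1 + h2 q\<close>: this is where the second term of the formula enters. If both are
    capped it is \<open>1 + h2 q\<close>, which exceeds \<open>h2 q + 1 - q\<close> since q >
    0.\<close>
  have RD: "R < D1 + D2 - 1 + h2 q" "R < h2 q + 1 - q" 
  proof -
    have "R < C1 + C2 - 1 + h2 q" "R < C1 + h2 q" "R < h2 q + 1 - q" using q(4) by simp_all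
    then show "R < D1 + D2 - 1 + h2 q" "R < h2 q + 1 - q" using q(2) C unfolding D1_def D2_def min_def by auto
  qed
  show ?thesis
  proof (cases "D1 + D2 \<le> 2 - q")
    case True
    have "achievable D1 D2 R"
      by (rule achievable_rational[OF D(1-4) ab' qab True _ RD(1)]) (use False in simp)
    from achievable_mono[OF this D(5,6)] show ?thesis .
  next
    case F: False
    define t where "t = (2 - q) / (D1 + D2)"
    have pos: "0 < D1 + D2" "2 - q \<le> D1 + D2" using F q by auto
    have "t * D1 + t * D2 = t * (D1 + D2)" by (simp add: distrib_left)
    also have "\<dots> = 2 - q" using pos by (simp add: t_def)
    finally have t: "0 \<le> t" "t \<le> 1" "t * D1 + t * D2 = 2 - q"
      using pos q by (auto simp: t_def)
    have tD: "t * D1 \<le> D1" "t * D2 \<le> D2" using t D by (auto simp: mult_left_le_one_le)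
    have "achievable (t * D1) (t * D2) R"
    proof (rule achievable_rational[OF _ _ _ _ ab' qab])
      show "0 \<le> t * D1" "0 \<le> t * D2" using t(1) D by auto
      show "t * D1 \<le> 1" "t * D2 \<le> 1" using tD D by linarith+
      show "t * D1 + t * D2 \<le> 2 - q" "R < t * D1 + t * D2 - 1 + h2 q" unfolding t(3) using RD(2) by auto
    qed (use False in simp)
    moreover have "t * D1 \<le> C1" "t * D2 \<le> C2" using tD D by linarith+
    ultimately show ?thesis by (rule achievable_mono)
  qed
qed

lemma diamond_capacity_eq:
  assumes C: "0 \<le> C1" "C1 \<le> C2"
  shows "diamond_capacity C1 C2 = capacity_formula C1 C2"
  unfolding diamond_capacity_def
proof (rule antisym)
  have ne: "{R. achievable C1 C2 R} \<noteq> {}" using achievable_nonpos[of C1 C2 0] C by auto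
  show "Sup {R. achievable C1 C2 R} \<le> capacity_formula C1 C2"
    using ne by (rule cSup_least) (auto intro: achievable_le[OF C])
  have bdd: "bdd_above {R. achievable C1 C2 R}"
    by (rule bdd_aboveI[of _ "capacity_formula C1 C2"]) (auto intro: achievable_le[OF C])
  show "capacity_formula C1 C2 \<le> Sup {R. achievable C1 C2 R}"
    unfolding capacity_formula_def
  proof (rule cSUP_least)
    fix p :: real assume "p \<in> {0..1/2}"
    then have p: "0 \<le> p" "p \<le> 1/2" by auto
    show "min (C1 + C2 - 1 + h2 p) (min (C1 + h2 p) (h2 p + 1 - p)) \<le> Sup {R. achievable C1 C2 R}"
    proof (rule dense_le)
      fix R assume "R < min (C1 + C2 - 1 + h2 p) (min (C1 + h2 p) (h2 p + 1 - p))"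
      from achievable_below_formula[OF C p this] show "R \<le> Sup {R. achievable C1 C2 R}"
        using bdd by (intro cSup_upper) simp_all
    qed
  qed simp
qed

theorem theorem8:
  fixes C1 C2 :: real
  assumes "0 \<le> C1" and "C1 \<le> C2"
  shows "diamond_capacity C1 C2 = capacity_formula C1 C2
       \<and> lower_bound C1 C2 = capacity_formula C1 C2
       \<and> upper_bound C1 C2 = capacity_formula C1 C2"
  using assms by (simp add: diamond_capacity_eq lower_bound_eq upper_bound_eq)

end
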